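(* Assume (H1)–(H5) and (H4)$_{st}$. Let $u\in C(\mathbb{R}^n\times[0,T))$ be a viscosity solution of (1.1)–(1.2). Then: (1) if $(C_1,K_3)\ne(0,0)$, for all $(x,t)\in\mathbb{R}^n\times(0,T)$ and $p\in D_x^-u(x,t)$, $$I(x,t;u_0)e^{-(C_1+K_3)t}-\frac{C_1\beta}{C_1+K_3}(1-e^{-(C_1+K_3)t})\le|p|\le S(x,t;u_0)e^{(C_1+K_3)t}+\frac{C_1\beta}{C_1+K_3}(e^{(C_1+K_3)t}-1);$$ (2) if $(C_1,K_3)=(0,0)$, $I(x,t;u_0)\le|p|\le S(x,t;u_0)$ for all $(x,t)\in\mathbb{R}^n\times(0,T)$ and $p\in D_x^-u(x,t)$.
   Context: $T>0$; $H:\mathbb{R}^n\times[0,T]\times\mathbb{R}\times\mathbb{R}^n\to\mathbb{R}$; $u_0$ Lipschitz. Problem (1.1)–(1.2): $u_t+H(x,t,u,D_xu)=0$ in $\mathbb{R}^n\times(0,T)$, $u(x,0)=u_0(x)$. (H1) there exist $C_1\ge0$, $\beta\in\{0,1\}$ with $|H(x,t,u,p)-H(y,t,u,p)|\le C_1(\beta+|p|)|x-y|$. (H2) there exist $A_2,B_2\ge0$ with $|H(x,t,u,p)-H(x,t,u,q)|\le(A_2|x|+B_2)|p-q|$. (H3) there exists $K_3\ge0$ with $|H(x,t,u,p)-H(x,t,v,p)|\le K_3|u-v|$. (H4) $p\mapsto H$ convex. (H5) $H\in C^2$. (H4)$_{st}$ $D_{pp}H$ positive definite everywhere. Viscosity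 solution: $u\in C(\mathbb{R}^n\times[0,T))$, $u(\cdot,0)=u_0$, and for every $\phi\in C^1(\mathbb{R}^n\times(0,T))$, if $u-\phi$ has a local max (resp. min) at $(x,t)\in\mathbb{R}^n\times(0,T)$ then $\phi_t+H(x,t,u(x,t),D_x\phi(x,t))\le0$ (resp. $\ge0$). $D^-f(x)=\{D\phi(x):\phi\in C^1,\ f-\phi$ has a local min at $x\}$; $D_x^-u(x,t)=\{p:(p,\tau)\in D^-u(x,t)\}$. $R(x,t)=(\frac{B_2}{A_2}+|x|)(e^{A_2t}-1)$ if $A_2>0$, $=B_2t$ if $A_2=0$. $S(x,t;u_0)=\sup\{|p|:p\in D^-u_0(y),\ y\in\overline{B_{R(x,t)}(x)}\}$, $I(x,t;u_0)=\inf\{|p|:p\in D^-u_0(y),\ y\in\overline{B_{R(x,t)}(x)}\}$. *)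

theory Defs
  imports "HOL-Analysis.Analysis"
begin

definition C1_on :: "('z::real_normed_vector \<Rightarrow> real) \<Rightarrow> 'z set \<Rightarrow> bool" where
  "C1_on f S \<longleftrightarrow> (\<exists>D :: 'z \<Rightarrow> ('z \<Rightarrow>\<^sub>L real). continuous_on S D \<and>
      (\<forall>z\<in>S. (f has_derivative blinfun_apply (D z)) (at z within S)))"

definition C2_on :: "('z::real_normed_vector \<Rightarrow> real) \<Rightarrow> 'z set \<Rightarrow> bool" where
  "C2_on f S \<longleftrightarrow> (\<exists>(D :: 'z \<Rightarrow> ('z \<Rightarrow>\<^sub>L real)) (D2 :: 'z \<Rightarrow> ('z \<Rightarrow>\<^sub>L ('z \<Rightarrow>\<^sub>L real))).
      continuous_on S D2 \<and>
      (\<forall>z\<in>S. (f has_derivative blinfun_apply (D z)) (at z within S) \<and>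
              (D has_derivative blinfun_apply (D2 z)) (at z within S)))"

definition hess_p :: "('a::real_normed_vector \<Rightarrow> real \<Rightarrow> real \<Rightarrow> 'a \<Rightarrow> real)
    \<Rightarrow> 'a \<Rightarrow> real \<Rightarrow> real \<Rightarrow> 'a \<Rightarrow> 'a \<Rightarrow> 'a \<Rightarrow> real" where
  "hess_p H x t u p \<xi> \<eta> = deriv (\<lambda>s. deriv (\<lambda>r. H x t u (p + s *\<^sub>R \<eta> + r *\<^sub>R \<xi>)) 0) 0"

definition local_min_within :: "('z::metric_space \<Rightarrow> real) \<Rightarrow> 'z set \<Rightarrow> 'z \<Rightarrow> bool" where
  "local_min_within f S z \<longleftrightarrow> z \<in> S \<and> (\<exists>e>0. \<forall>w\<in>ball z e \<inter> S. f z \<le> f w)"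

definition local_max_within :: "('z::metric_space \<Rightarrow> real) \<Rightarrow> 'z set \<Rightarrow> 'z \<Rightarrow> bool" where
  "local_max_within f S z \<longleftrightarrow> z \<in> S \<and> (\<exists>e>0. \<forall>w\<in>ball z e \<inter> S. f w \<le> f z)"

definition subdiff :: "('z::real_inner \<Rightarrow> real) \<Rightarrow> 'z set \<Rightarrow> 'z \<Rightarrow> 'z set" where
  "subdiff f S z = {q. \<exists>\<phi>. C1_on \<phi> S \<and> (\<phi> has_derivative (\<lambda>v. q \<bullet> v)) (at z)
                        \<and> local_min_within (\<lambda>w. f w - \<phi> w) S z}"

definition subdiff_x :: "('a::real_inner \<Rightarrow> real \<Rightarrow> real) \<Rightarrow> real \<Rightarrow> 'a \<Rightarrow> real \<Rightarrow> 'a set" where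
  "subdiff_x u T x t = {p. \<exists>\<tau>. (p, \<tau>) \<in> subdiff (\<lambda>(y, s). u y s) (UNIV \<times> {0<..<T}) (x, t)}"

definition viscosity_solution ::
  "('a::real_inner \<Rightarrow> real \<Rightarrow> real \<Rightarrow> 'a \<Rightarrow> real) \<Rightarrow> ('a \<Rightarrow> real) \<Rightarrow> real \<Rightarrow> ('a \<Rightarrow> real \<Rightarrow> real) \<Rightarrow> bool" where
  "viscosity_solution H u0 T u \<longleftrightarrow>
     continuous_on (UNIV \<times> {0..<T}) (\<lambda>(x, t). u x t) \<and> (\<forall>x. u x 0 = u0 x) \<and>
     (\<forall>(\<phi> :: 'a \<Rightarrow> real \<Rightarrow> real) x t q \<tau>.
        C1_on (\<lambda>(y, s). \<phi> y s) (UNIV \<times> {0<..<T}) \<and> t \<in> {0<..<T} \<and>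
        ((\<lambda>(y, s). \<phi> y s) has_derivative (\<lambda>(v, r). q \<bullet> v + \<tau> * r)) (at (x, t)) \<longrightarrow>
          (local_max_within (\<lambda>(y, s). u y s - \<phi> y s) (UNIV \<times> {0<..<T}) (x, t)
              \<longrightarrow> \<tau> + H x t (u x t) q \<le> 0) \<and>
          (local_min_within (\<lambda>(y, s). u y s - \<phi> y s) (UNIV \<times> {0<..<T}) (x, t)
              \<longrightarrow> \<tau> + H x t (u x t) q \<ge> 0))"

definition R_fun :: "real \<Rightarrow> real \<Rightarrow> 'a::real_normed_vector \<Rightarrow> real \<Rightarrow> real" where
  "R_fun A2 B2 x t = (if A2 > 0 then (B2 / A2 + norm x) * (exp (A2 * t) - 1) else B2 * t)"

definition S_fun :: "real \<Rightarrow> real \<Rightarrow> ('a::real_inner \<Rightarrow> real) \<Rightarrow> 'a \<Rightarrow> real \<Rightarrow> real" where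
  "S_fun A2 B2 u0 x t = Sup {norm p | p y. y \<in> cball x (R_fun A2 B2 x t) \<and> p \<in> subdiff u0 UNIV y}"

definition I_fun :: "real \<Rightarrow> real \<Rightarrow> ('a::real_inner \<Rightarrow> real) \<Rightarrow> 'a \<Rightarrow> real \<Rightarrow> real" where
  "I_fun A2 B2 u0 x t = Inf {norm p | p y. y \<in> cball x (R_fun A2 B2 x t) \<and> p \<in> subdiff u0 UNIV y}"

end

theory Submission
  imports Defs
begin

text \<open>
  Since \<open>H\<close> is \<open>C\<^sup>2\<close> with controlled growth, characteristics \<open>(\<xi>, z, p)\<close> exist on all of \<open>[0, T]\<close>. Along a
  characteristic, smooth paraboloids \<open>z + p \<bullet> \<eta> \<plusminus> K |\<eta>|\<^sup>2 / 2\<close>, \<open>\<eta> = y - \<xi>\<close>, are sub- or supersolutions in a thin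
  tube once \<open>K\<close> varies suitably in time, and can be compared with \<open>u\<close>.

  Comparing from above shows that \<open>\<tau> + H \<le> 0\<close> holds for all \<open>(q, \<tau>) \<in> D\<^sup>-u\<close> (Barron-Jensen), so \<open>-u\<close> is
  a subsolution of a convex equation in reversed time. Hence a paraboloid touching \<open>u\<close> from below at
  \<open>(x, t)\<close> stays below \<open>u\<close> along the backward characteristic. If it were strictly below at an earlier time, the
  supersolution property would push it strictly below a short time later; so contact persists
  down to time \<open>0\<close> and \<open>p(0) \<in> D\<^sup>-u\<^sub>0(\<xi>(0))\<close>. Gronwall's inequality compares \<open>|p(0)|\<close> with \<open>|p(t)|\<close> and
  \<open>|\<xi>(0) - x|\<close> with \<open>R(x, t)\<close>.

  A general \<open>p \<in> D\<^sub>x\<^sup>-u(x, t)\<close> is a limit of gradients of touching paraboloids at nearby points. Strict convexity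
  gives \<open>|H\<^sub>p| < A\<^sub>2|x| + B\<^sub>2\<close>, which keeps the feet of the corresponding characteristics inside the closed
  ball of radius \<open>R(x, t)\<close>.
\<close>

section \<open>Ordinary differential equations\<close>

text \<open>Since nothing restricts \<open>u\<close> at infinity, every comparison takes place in a
  tube of radius at most 1 around a single characteristic. There \<open>u\<close> is bounded by
  compactness, and a paraboloid of large enough curvature beats that bound on the lateral boundary.

  The obstacle is the curvature. In the direction favoured by convexity the residual of a paraboloid
  is linear in the curvature, so exponential growth in time compensates it up to any horizon. In the
  opposite direction it is quadratic, the equation for the curvature is of Riccati type, and contact
  is carried only over a short time. The length of that time depends on the curvature bound found in
  the first direction, hence is uniform, and finitely many steps suffice.

  A test function that is merely C1 carries no curvature bound, whence the proximal approximation.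
  It moves the base point, and the displacement is paid for by the distance between the actual and
  the maximal speed, which is uniform on compact sets.\<close>

lemma has_vector_derivative_reflect:
  assumes "(X has_vector_derivative d) (at (c - r))"
  shows "((\<lambda>r. X (c - r)) has_vector_derivative - d) (at r)"
proof -
  have "((\<lambda>r. c - r) has_vector_derivative - 1) (at r)" by (auto intro!: derivative_eq_intros)
  from vector_diff_chain_at[OF this assms] show ?thesis by (simp add: o_def)
qed

text \<open>Integrating a derivative bounded by \<open>c * exp (l * \<bar>r\<bar>)\<close> gains the
  factor \<open>1 / l\<close>. In a norm weighted by this exponential, integration is therefore a
  small operator when \<open>l\<close> is large.\<close>

lemma exp_growth_bound:
  fixes h :: "real \<Rightarrow> 'b::real_normed_vector"
  assumes h: "\<And>r. (h has_vector_derivative h' r) (at r)" and "h 0 = 0" "l > 0" "c \<ge> 0"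
    and bd: "\<And>r. norm (h' r) \<le> c * exp (l * \<bar>r\<bar>)"
  shows "norm (h s) \<le> c / l * exp (l * \<bar>s\<bar>)"
proof -
  have key: "norm (k s) \<le> c / l * exp (l * s)"
    if k: "\<And>r. (k has_vector_derivative k' r) (at r)" and "k 0 = 0" "s > 0"
    and kb: "\<And>r. norm (k' r) \<le> c * exp (l * \<bar>r\<bar>)" for k k' :: "real \<Rightarrow> 'b" and s
  proof -
    have "norm (k s - k 0) \<le> c / l * exp (l * s) - c / l * exp (l * 0)"
    proof (rule differentiable_bound_general[where f' = k' and \<phi>' = "\<lambda>r. c * exp (l * r)"])
      show "continuous_on {0..s} k"
        using k by (meson continuous_at_imp_continuous_on has_vector_derivative_continuous)
      show "((\<lambda>r. c / l * exp (l * r)) has_vector_derivative c * exp (l * r)) (at r)" for r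
        using \<open>l > 0\<close> unfolding has_real_derivative_iff_has_vector_derivative[symmetric]
        by (auto intro!: derivative_eq_intros)
      show "norm (k' r) \<le> c * exp (l * r)" if "0 < r" for r using kb[of r] that by simp
    qed (use k \<open>s > 0\<close> \<open>l > 0\<close> in \<open>auto intro!: continuous_intros\<close>)
    moreover have "0 \<le> c / l" using assms by simp
    ultimately show ?thesis using \<open>k 0 = 0\<close> by simp
  qed
  consider "s > 0" | "s = 0" | "s < 0" by linarith
  then show ?thesis
  proof cases
    case 1 then show ?thesis using key[OF h \<open>h 0 = 0\<close> 1 bd] by simp
  next
    case 2 then show ?thesis using assms by simp
  next
    case 3
    have "((\<lambda>r. h (- r)) has_vector_derivative - h' (- r)) (at r)" for r
      using has_vector_derivative_reflect[of h "h' (- r)" 0 r] h[of "- r"] by simp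
    from key[OF this, of "- s"] show ?thesis using 3 bd[of "- _"] \<open>h 0 = 0\<close> by simp
  qed
qed

text \<open>Picard iteration in Bielecki's weighted norm: the unknown is \<open>V\<close> with
  \<open>Y = exp (l * \<bar>r\<bar>) *\<^sub>R V\<close>. With \<open>l\<close> above
  \<open>2 * \<bar>L\<bar>\<close> the integral operator contracts by 1/2 on bounded continuous
  functions of the whole line, so local solutions need not be glued. The bound \<open>M\<close> on
  the field keeps the rescaled iterates bounded.\<close>

theorem picard_global:
  fixes F :: "real \<Rightarrow> 'b::euclidean_space \<Rightarrow> 'b"
  assumes cont: "continuous_on UNIV (\<lambda>(s, y). F s y)"
    and lip: "\<And>s x y. norm (F s x - F s y) \<le> L * norm (x - y)"
    and bd: "\<And>s y. norm (F s y) \<le> M"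
  shows "\<exists>Y. Y t0 = y0 \<and> (\<forall>s. (Y has_vector_derivative F s (Y s)) (at s))"
proof -
  have M0: "0 \<le> M" using bd[of 0 0] norm_ge_zero order_trans by blast
  define l where "l = 2 * \<bar>L\<bar> + 1"
  have l: "l > 0" "\<bar>L\<bar> / l \<le> 1/2" unfolding l_def by (auto simp: field_simps)
  define f where "f V r = F (t0 + r) (exp (l * \<bar>r\<bar>) *\<^sub>R apply_bcontfun V r)" for V r
  have fcont: "continuous_on UNIV (f V)" for V
  proof -
    have "continuous_on UNIV (\<lambda>r. (t0 + r, exp (l * \<bar>r\<bar>) *\<^sub>R apply_bcontfun V r))"
      by (intro continuous_intros) auto
    from continuous_on_compose2[OF cont this] show ?thesis unfolding f_def by (simp add: case_prod_beta)
  qed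
  have "\<exists>G. G 0 = 0 \<and> (\<forall>r. (G has_vector_derivative f V r) (at r))" for V
  proof -
    have "\<exists>G. \<forall>x::real. -\<infinity> < ereal x \<longrightarrow> x < \<infinity> \<longrightarrow> (G has_vector_derivative f V x) (at x)"
      by (rule einterval_antiderivative) (use fcont[of V] in \<open>auto simp: continuous_on_eq_continuous_at\<close>)
    then obtain G where G: "\<And>x. (G has_vector_derivative f V x) (at x)" by auto
    have "((\<lambda>x. G x - G 0) has_vector_derivative f V x) (at x)" for x
      using G[of x] by (auto intro!: derivative_eq_intros)
    then show ?thesis by (intro exI[of _ "\<lambda>x. G x - G 0"]) auto
  qed
  then obtain G where G0: "\<And>V. G V 0 = 0" and G: "\<And>V r. (G V has_vector_derivative f V r) (at r)"
    by metis
  have Gcont: "continuous_on UNIV (G V)" for V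
    using G by (meson continuous_at_imp_continuous_on has_vector_derivative_continuous)
  have Gb: "norm (G V s) \<le> M / l * exp (l * \<bar>s\<bar>)" for V s
  proof (rule exp_growth_bound[OF G G0 l(1) M0])
    fix r
    have "M * 1 \<le> M * exp (l * \<bar>r\<bar>)" using l M0 by (intro mult_left_mono) auto
    then show "norm (f V r) \<le> M * exp (l * \<bar>r\<bar>)" using bd unfolding f_def by (metis mult.right_neutral order_trans)
  qed
  define P where "P V r = exp (- l * \<bar>r\<bar>) *\<^sub>R (y0 + G V r)" for V r
  have Pb: "P V \<in> bcontfun" for V
  proof -
    have "continuous_on UNIV (P V)" unfolding P_def by (intro continuous_intros Gcont)
    moreover have "norm (P V r) \<le> norm y0 + M / l" for r
    proof -
      have "norm (P V r) \<le> exp (- l * \<bar>r\<bar>) * (norm y0 + M / l * exp (l * \<bar>r\<bar>))"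
        unfolding P_def norm_scaleR using norm_triangle_ineq[of y0 "G V r"] Gb[of V r] by auto
      also have "\<dots> = exp (- l * \<bar>r\<bar>) * norm y0 + M / l"
        by (simp add: distrib_left exp_minus field_simps)
      also have "\<dots> \<le> norm y0 + M / l" using l mult_right_mono[of "exp (- l * \<bar>r\<bar>)" 1 "norm y0"] by simp
      finally show ?thesis .
    qed
    ultimately show ?thesis unfolding bcontfun_def bounded_iff by blast
  qed
  define \<Phi> where "\<Phi> V = Bcontfun (P V)" for V
  have \<Phi>: "apply_bcontfun (\<Phi> V) = P V" for V
    unfolding \<Phi>_def by (rule Bcontfun_inverse[OF Pb])
  have "dist (\<Phi> V) (\<Phi> W) \<le> 1/2 * dist V W" for V W
  proof (rule dist_bound)
    fix s
    have "norm (G V s - G W s) \<le> (\<bar>L\<bar> * dist V W) / l * exp (l * \<bar>s\<bar>)"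
    proof (rule exp_growth_bound[where h' = "\<lambda>r. f V r - f W r"])
      fix r
      have "norm (f V r - f W r) \<le> L * norm (exp (l * \<bar>r\<bar>) *\<^sub>R apply_bcontfun V r - exp (l * \<bar>r\<bar>) *\<^sub>R apply_bcontfun W r)"
        unfolding f_def by (rule lip)
      also have "\<dots> = L * (exp (l * \<bar>r\<bar>) * dist (apply_bcontfun V r) (apply_bcontfun W r))"
        by (simp add: dist_norm flip: scaleR_diff_right)
      also have "\<dots> \<le> \<bar>L\<bar> * (exp (l * \<bar>r\<bar>) * dist V W)"
        by (intro mult_mono mult_left_mono dist_bounded) auto
      finally show "norm (f V r - f W r) \<le> \<bar>L\<bar> * dist V W * exp (l * \<bar>r\<bar>)" by (simp add: mult_ac)
    qed (use l G0 in \<open>auto intro!: derivative_intros G\<close>)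
    also have "\<dots> \<le> 1/2 * dist V W * exp (l * \<bar>s\<bar>)"
      using mult_right_mono[OF l(2), of "dist V W * exp (l * \<bar>s\<bar>)"] by (simp add: field_simps)
    finally have "exp (- l * \<bar>s\<bar>) * norm (G V s - G W s) \<le> exp (- l * \<bar>s\<bar>) * (1/2 * dist V W * exp (l * \<bar>s\<bar>))"
      by simp
    also have "\<dots> = 1/2 * dist V W" by (simp add: exp_minus)
    finally show "dist (apply_bcontfun (\<Phi> V) s) (apply_bcontfun (\<Phi> W) s) \<le> 1/2 * dist V W"
      unfolding \<Phi> P_def dist_norm scaleR_diff_right[symmetric] by simp
  qed
  then have "\<exists>!V. \<Phi> V = V" by (intro banach_fix_type[of "1/2"]) auto
  then obtain V where V: "\<Phi> V = V" by blast
  define Y where "Y s = y0 + G V (s - t0)" for s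
  have Y: "exp (l * \<bar>r\<bar>) *\<^sub>R apply_bcontfun V r = y0 + G V r" for r
    using \<Phi>[of V] unfolding V P_def by (simp add: exp_minus)
  have "(Y has_vector_derivative F s (Y s)) (at s)" for s
  proof -
    have "((G V \<circ> (\<lambda>s. s - t0)) has_vector_derivative 1 *\<^sub>R f V (s - t0)) (at s)"
      by (rule vector_diff_chain_at) (auto intro!: derivative_eq_intros G)
    moreover have "f V (s - t0) = F s (Y s)" unfolding f_def Y Y_def by simp
    ultimately show ?thesis unfolding Y_def by (auto intro!: derivative_eq_intros simp: o_def)
  qed
  moreover have "Y t0 = y0" by (simp add: Y_def G0)
  ultimately show ?thesis by blast
qed

section \<open>Gronwall's inequality\<close>

text \<open>For \<open>A \<ge> 0\<close> this is the integral of \<open>exp (A * s)\<close> over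
  \<open>s\<close> from 0 to \<open>r\<close>, the solution of y' = A y + 1 with y(0) = 0. It treats
  the cases of \<open>R_fun\<close>, and the cases (1) and (2) of the theorem, uniformly.\<close>

definition exp_int :: "real \<Rightarrow> real \<Rightarrow> real" where
  "exp_int A r = (if A > 0 then (exp (A * r) - 1) / A else r)"

lemma exp_int_nonneg: "r \<ge> 0 \<Longrightarrow> exp_int A r \<ge> 0"
  by (simp add: exp_int_def)

lemma exp_int_mono: "r \<le> s \<Longrightarrow> exp_int A r \<le> exp_int A s"
  by (simp add: exp_int_def divide_right_mono)

lemma exp_int_pos: "r > 0 \<Longrightarrow> exp_int A r > 0"
  by (simp add: exp_int_def)

lemma exp_int_deriv:
  "A \<ge> 0 \<Longrightarrow> (exp_int A has_real_derivative A * exp_int A r + 1) (at r)"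
  unfolding exp_int_def by (auto intro!: derivative_eq_intros simp: field_simps)

lemma gronwall_forward:
  fixes X :: "real \<Rightarrow> 'b::real_inner"
  assumes X: "\<And>s. s \<in> {a..b} \<Longrightarrow> (X has_vector_derivative X' s) (at s)"
    and bd: "\<And>s. s \<in> {a..b} \<Longrightarrow> norm (X' s) \<le> A * norm (X s) + B"
    and "A \<ge> 0" "B \<ge> 0" "a \<le> b"
  shows "norm (X b) \<le> norm (X a) * exp (A * (b - a)) + B * exp_int A (b - a)"
proof (rule field_le_epsilon)
  fix e :: real assume "e > 0"
  \<comment> \<open>\<open>N\<close> is a smooth majorant of \<open>norm \<circ> X\<close> that satisfies the same differential inequality.\<close>
  define k where "k = e * exp (- (A * (b - a)))"
  have "k > 0" using \<open>e > 0\<close> by (simp add: k_def)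
  define N where "N s = sqrt (X s \<bullet> X s + k\<^sup>2)" for s
  have pos: "X s \<bullet> X s + k\<^sup>2 > 0" for s using \<open>k > 0\<close> by (simp add: add_nonneg_pos)
  have Npos: "N s > 0" for s using pos by (simp add: N_def)
  have NX: "norm (X s) \<le> N s" for s
    unfolding N_def norm_eq_sqrt_inner by (intro real_sqrt_le_mono) simp
  have Nk: "N s \<le> norm (X s) + k" for s
    unfolding N_def using \<open>k > 0\<close> sqrt_add_le_add_sqrt[of "X s \<bullet> X s" "k\<^sup>2"]
    by (simp add: norm_eq_sqrt_inner)
  have dN: "(N has_real_derivative (X s \<bullet> X' s) / N s) (at s)" if "s \<in> {a..b}" for s
  proof -
    have "((\<lambda>s. X s \<bullet> X s + k\<^sup>2) has_real_derivative 2 * (X s \<bullet> X' s)) (at s)"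
      using bounded_bilinear.has_vector_derivative[OF bounded_bilinear_inner X[OF that] X[OF that]]
      unfolding has_real_derivative_iff_has_vector_derivative
      by (auto intro!: derivative_eq_intros simp: inner_commute)
    from DERIV_chain2[OF DERIV_real_sqrt[OF pos] this] show ?thesis
      unfolding N_def by (simp add: field_simps)
  qed
  \<comment> \<open>\<open>Z s\<close> is the bound for \<open>N b\<close> that Gronwall's
    inequality gives when started at time \<open>s\<close>. The differential inequality makes it
    nonincreasing, and at \<open>s = b\<close> it is \<open>N b\<close> itself.\<close>
  define Z where "Z s = N s * exp (A * (b - s)) + B * exp_int A (b - s)" for s
  have "Z a \<ge> Z b"
  proof (rule DERIV_nonpos_imp_nonincreasing[OF \<open>a \<le> b\<close>])
    fix s assume s: "a \<le> s" "s \<le> b"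
    have "((\<lambda>s. exp_int A (b - s)) has_real_derivative - (A * exp_int A (b - s) + 1)) (at s)"
      using has_vector_derivative_reflect[of "exp_int A" "A * exp_int A (b - s) + 1" b s] exp_int_deriv[OF \<open>A \<ge> 0\<close>]
      by (simp add: has_real_derivative_iff_has_vector_derivative)
    then have dZ: "(Z has_real_derivative (X s \<bullet> X' s) / N s * exp (A * (b - s))
        + N s * (exp (A * (b - s)) * (- A)) + B * - (A * exp_int A (b - s) + 1)) (at s)"
      unfolding Z_def by (auto intro!: derivative_eq_intros dN simp: s)
    have "X s \<bullet> X' s \<le> norm (X s) * norm (X' s)" by (rule norm_cauchy_schwarz)
    also have "\<dots> \<le> N s * (A * N s + B)"
      using bd[of s] s NX[of s] mult_left_mono[OF NX[of s] \<open>A \<ge> 0\<close>] Npos[of s]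
      by (intro mult_mono) auto
    finally have "(X s \<bullet> X' s) / N s \<le> A * N s + B" using Npos[of s] by (simp add: field_simps)
    then have "(X s \<bullet> X' s) / N s * exp (A * (b - s)) \<le> (A * N s + B) * exp (A * (b - s))"
      by (rule mult_right_mono) simp
    moreover have "exp (A * (b - s)) = A * exp_int A (b - s) + 1"
      using \<open>A \<ge> 0\<close> by (auto simp: exp_int_def)
    ultimately have "(X s \<bullet> X' s) / N s * exp (A * (b - s))
        + N s * (exp (A * (b - s)) * (- A)) + B * - (A * exp_int A (b - s) + 1) \<le> 0"
      by (simp add: algebra_simps add_divide_distrib)
    with dZ show "\<exists>y. (Z has_real_derivative y) (at s) \<and> y \<le> 0" by blast
  qed
  moreover have "Z b = N b" by (simp add: Z_def exp_int_def)
  moreover have "N a * exp (A * (b - a)) \<le> norm (X a) * exp (A * (b - a)) + e"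
    using mult_right_mono[OF Nk[of a], of "exp (A * (b - a))"] by (simp add: k_def distrib_right exp_minus mult.assoc)
  ultimately show "norm (X b) \<le> norm (X a) * exp (A * (b - a)) + B * exp_int A (b - a) + e"
    using NX[of b] unfolding Z_def by linarith
qed

text \<open>The bound on the derivative is invariant under time reversal, so either end may serve as
  the starting time. Later this gives the upper and the lower gradient estimate from one
  inequality.\<close>

lemma gronwall:
  fixes X :: "real \<Rightarrow> 'b::real_inner"
  assumes X: "\<And>s. s \<in> {a..b} \<Longrightarrow> (X has_vector_derivative X' s) (at s)"
    and bd: "\<And>s. s \<in> {a..b} \<Longrightarrow> norm (X' s) \<le> A * norm (X s) + B"
    and "A \<ge> 0" "B \<ge> 0" "s \<in> {a..b}" "t \<in> {a..b}"
  shows "norm (X s) \<le> norm (X t) * exp (A * \<bar>s - t\<bar>) + B * exp_int A \<bar>s - t\<bar>"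
proof (cases "t \<le> s")
  case True
  then show ?thesis using gronwall_forward[of t s X X' A B] assms by auto
next
  case False
  have "((\<lambda>r. X (- r)) has_vector_derivative - X' (- r)) (at r)" if "r \<in> {- t..- s}" for r
    using has_vector_derivative_reflect[of X "X' (- r)" 0 r] X[of "- r"] that assms by auto
  then have "norm (X (- (- s))) \<le> norm (X (- (- t))) * exp (A * (- s - - t)) + B * exp_int A (- s - - t)"
    using bd assms False by (intro gronwall_forward[where X' = "\<lambda>r. - X' (- r)"]) auto
  then show ?thesis
    using False by simp
qed

section \<open>Comparison in a tube around a curve\<close>

lemma C1_on_gradient:
  fixes g :: "'z::real_inner \<Rightarrow> 'z"
  assumes "continuous_on S g" "\<And>z. z \<in> S \<Longrightarrow> (f has_derivative (\<lambda>v. g z \<bullet> v)) (at z)"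
  shows "C1_on f S"
proof -
  have "continuous_on S (\<lambda>z. blinfun_inner_right (g z))"
    by (rule bounded_linear.continuous_on[OF bounded_linear_blinfun_inner_right assms(1)])
  then show ?thesis unfolding C1_on_def using assms(2) has_derivative_at_withinI by fastforce
qed

text \<open>The Hamiltonian is left free so that one comparison lemma serves three purposes:
  \<open>u\<close> with \<open>H\<close>; \<open>- u\<close> with
  \<open>- H x t (- v) (- q)\<close>, which is the supersolution property; and
  \<open>- u x (T - t)\<close> with \<open>H x (T - t) (- v) (- q)\<close>, which expresses the
  Barron-Jensen inequality.\<close>

definition visc_sub :: "real \<Rightarrow> ('a::real_inner \<Rightarrow> real \<Rightarrow> real \<Rightarrow> 'a \<Rightarrow> real) \<Rightarrow> ('a \<Rightarrow> real \<Rightarrow> real) \<Rightarrow> bool" where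
  "visc_sub T G f \<longleftrightarrow> (\<forall>(\<phi> :: 'a \<times> real \<Rightarrow> real) x t q \<tau>.
      C1_on \<phi> (UNIV \<times> {0<..<T}) \<longrightarrow> t \<in> {0<..<T} \<longrightarrow>
      (\<phi> has_derivative (\<lambda>v. (q, \<tau>) \<bullet> v)) (at (x, t)) \<longrightarrow>
      local_max_within (\<lambda>w. f (fst w) (snd w) - \<phi> w) (UNIV \<times> {0<..<T}) (x, t) \<longrightarrow>
      \<tau> + G x t (f x t) q \<le> 0)"

text \<open>Maximising \<open>exp (- \<lambda> s) * (f - \<psi>)\<close> with \<open>\<lambda> > K\<close> makes the zero-order dependence of \<open>G\<close> harmless;
  the term \<open>\<Lambda> * (max 0 (s - s1))\<^sup>2\<close> keeps the maximum away from the terminal time.\<close>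

lemma tube_comparison_open:
  fixes f \<psi> :: "'a::euclidean_space \<Rightarrow> real \<Rightarrow> real"
  assumes ab: "0 \<le> a" "a < b" "b \<le> T" and "K \<ge> 0" "\<rho> > 0"
    and sub: "visc_sub T G f"
    and lip: "\<And>x t v w q. t \<in> {0<..<T} \<Longrightarrow> \<bar>G x t v q - G x t w q\<bar> \<le> K * \<bar>v - w\<bar>"
    and fc: "continuous_on (UNIV \<times> {a..b}) (\<lambda>w. f (fst w) (snd w))"
    and \<psi>c: "continuous_on (UNIV \<times> {a..b}) (\<lambda>w. \<psi> (fst w) (snd w))"
    and d\<psi>: "\<And>w. snd w \<in> {0<..<T} \<Longrightarrow> ((\<lambda>w. \<psi> (fst w) (snd w)) has_derivative (\<lambda>v. (dx w, dt w) \<bullet> v)) (at w)"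
    and dc: "continuous_on (UNIV \<times> {0<..<T}) dx" "continuous_on (UNIV \<times> {0<..<T}) dt"
    and \<xi>: "continuous_on UNIV \<xi>"
    and super: "\<And>y s. s \<in> {a<..<b} \<Longrightarrow> norm (y - \<xi> s) < \<rho> \<Longrightarrow> dt (y, s) + G y s (\<psi> y s) (dx (y, s)) \<ge> 0"
    and init: "\<And>y. norm (y - \<xi> a) \<le> \<rho> \<Longrightarrow> f y a \<le> \<psi> y a"
    and lat: "\<And>y s. s \<in> {a..b} \<Longrightarrow> norm (y - \<xi> s) = \<rho> \<Longrightarrow> f y s \<le> \<psi> y s"
    and s1: "s1 \<in> {a..<b}" and y1: "norm (y1 - \<xi> s1) \<le> \<rho>"
  shows "f y1 s1 \<le> \<psi> y1 s1"
proof (rule ccontr)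
  assume "\<not> ?thesis"
  then have gt: "f y1 s1 > \<psi> y1 s1" by simp
  have \<xi>c: "continuous_on S (\<lambda>w::'a \<times> real. \<xi> (snd w))" for S
    by (rule continuous_on_compose2[OF \<xi> continuous_on_snd]) (auto intro: continuous_on_id)
  define l where "l = K + 1"
  define Q where "Q = {w. snd w \<in> {a..b} \<and> norm (fst w - \<xi> (snd w)) \<le> \<rho>}"
  have "Q = (\<lambda>(\<eta>, s). (\<xi> s + \<eta>, s)) ` (cball 0 \<rho> \<times> {a..b})"
  proof (intro set_eqI iffI)
    fix w assume "w \<in> Q"
    then show "w \<in> (\<lambda>(\<eta>, s). (\<xi> s + \<eta>, s)) ` (cball 0 \<rho> \<times> {a..b})"
      by (intro image_eqI[of _ _ "(fst w - \<xi> (snd w), snd w)"]) (auto simp: Q_def)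
  qed (auto simp: Q_def)
  moreover have "compact ((\<lambda>(\<eta>, s). (\<xi> s + \<eta>, s)) ` (cball 0 \<rho> \<times> {a..b}))"
    unfolding case_prod_beta
    by (intro compact_continuous_image compact_Times compact_cball compact_Icc continuous_intros \<xi>c)
  ultimately have cQ: "compact Q" by simp
  have QS: "Q \<subseteq> UNIV \<times> {a..b}" by (auto simp: Q_def)
  define g where "g w = exp (- l * snd w) * (f (fst w) (snd w) - \<psi> (fst w) (snd w))" for w
  have gc: "continuous_on Q g" unfolding g_def
    by (intro continuous_intros continuous_on_subset[OF fc QS] continuous_on_subset[OF \<psi>c QS])
  have in1: "(y1, s1) \<in> Q" using s1 y1 by (auto simp: Q_def)
  have "bounded (g ` Q)" using compact_continuous_image[OF gc cQ] compact_imp_bounded by blast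
  then obtain N where N: "\<And>w. w \<in> Q \<Longrightarrow> g w \<le> N"
    unfolding bounded_iff by (metis abs_le_D1 image_eqI real_norm_def)
  have gpos: "g (y1, s1) > 0" using gt by (simp add: g_def)
  have N0: "N > 0" using N[OF in1] gpos by linarith
  \<comment> \<open>The penalty at time \<open>b\<close> equals \<open>N + 1\<close> and exceeds
    every value of \<open>g\<close>, so the positive maximum of \<open>h\<close> cannot lie there.
    At \<open>(y1, s1)\<close> the penalty vanishes, which keeps the maximum positive.\<close>
  define \<Lambda> where "\<Lambda> = (N + 1) / (b - s1)\<^sup>2"
  have \<Lambda>0: "\<Lambda> > 0" using N0 s1 by (auto simp: \<Lambda>_def)
  define m where "m s = \<Lambda> * (max 0 (s - s1))\<^sup>2" for s
  define h where "h w = g w - m (snd w)" for w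
  have hc: "continuous_on Q h" unfolding h_def m_def by (intro continuous_intros gc)
  obtain w2 where w2: "w2 \<in> Q" and max: "\<And>w. w \<in> Q \<Longrightarrow> h w \<le> h w2"
    using continuous_attains_sup[OF cQ _ hc] in1 by blast
  obtain y2 s2 where ys: "w2 = (y2, s2)" by force
  define M where "M = h w2"
  have Mpos: "M > 0"
    using max[OF in1] gpos by (simp add: M_def h_def m_def)
  have m0: "m s \<ge> 0" for s using \<Lambda>0 by (simp add: m_def)
  have s2: "s2 \<in> {a..b}" and y2: "norm (y2 - \<xi> s2) \<le> \<rho>" using w2 by (auto simp: Q_def ys)
  have g2: "g w2 > 0" using Mpos m0[of s2] by (simp add: M_def h_def ys)
  then have f2: "f y2 s2 > \<psi> y2 s2" by (simp add: g_def ys zero_less_mult_iff)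
  have "s2 \<noteq> b"
  proof
    assume "s2 = b"
    then have "m s2 = N + 1" using s1 by (simp add: m_def \<Lambda>_def)
    then show False using N[OF w2] Mpos by (simp add: M_def h_def ys)
  qed
  moreover have "s2 \<noteq> a" using init[of y2] f2 y2 by force
  ultimately have s2i: "s2 \<in> {a<..<b}" using s2 by auto
  have "norm (y2 - \<xi> s2) \<noteq> \<rho>" using lat[OF s2, of y2] f2 by force
  then have y2i: "norm (y2 - \<xi> s2) < \<rho>" using y2 by simp
  have s2T: "s2 \<in> {0<..<T}" using s2i ab by auto
  \<comment> \<open>Obtained by solving \<open>h w = M\<close> for \<open>f\<close>: the difference
    \<open>f - \<phi>\<close> is \<open>exp (l * s) * (h - M)\<close>, so \<open>\<phi>\<close>
    touches \<open>f\<close> from above where \<open>h\<close> attains its maximum.\<close>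
  define \<phi> where "\<phi> w = \<psi> (fst w) (snd w) + exp (l * snd w) * (M + m (snd w))" for w
  define e where "e s = l * (exp (l * s) * (M + m s)) + exp (l * s) * (\<Lambda> * (2 * max 0 (s - s1)))" for s
  have dm: "(m has_real_derivative \<Lambda> * (2 * max 0 (s - s1))) (at s)" for s
  proof -
    have "((\<lambda>r::real. (max 0 r)\<^sup>2) has_real_derivative 2 * max 0 r) (at r)" for r
    proof -
      consider "r > 0" | "r < 0" | "r = 0" by linarith
      then show ?thesis
      proof cases
        case 1
        have "((\<lambda>r::real. r\<^sup>2) has_real_derivative 2 * max 0 r) (at r)"
          using 1 by (auto intro!: derivative_eq_intros)
        then show ?thesis
          by (rule has_field_derivative_transform_within_open[of _ _ _ "{0<..}"]) (use 1 in auto)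
      next
        case 2
        have "((\<lambda>r::real. 0) has_real_derivative 2 * max 0 r) (at r)"
          using 2 by (auto intro!: derivative_eq_intros)
        then show ?thesis
          by (rule has_field_derivative_transform_within_open[of _ _ _ "{..<0}"]) (use 2 in auto)
      next
        case 3
        have "((\<lambda>h::real. (max 0 (0 + h))\<^sup>2 / h) \<longlongrightarrow> 0) (at 0)"
        proof (rule Lim_null_comparison)
          show "\<forall>\<^sub>F h in at 0. norm ((max 0 (0 + h))\<^sup>2 / h) \<le> \<bar>h::real\<bar>"
            by (auto simp: eventually_at_filter max_def power2_eq_square)
          show "((\<lambda>h::real. \<bar>h\<bar>) \<longlongrightarrow> 0) (at 0)" by (intro tendsto_eq_intros) auto
        qed
        then show ?thesis using 3 by (simp add: DERIV_def)
      qed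
    qed
    note this[of "s - s1"]
    moreover have "((\<lambda>s. s - s1) has_real_derivative 1) (at s)" by (auto intro!: derivative_eq_intros)
    ultimately have "((\<lambda>s. (max 0 (s - s1))\<^sup>2) has_real_derivative 2 * max 0 (s - s1) * 1) (at s)"
      by (rule DERIV_chain2)
    from DERIV_cmult[OF this, of \<Lambda>] show ?thesis unfolding m_def by simp
  qed
  have dexp: "((\<lambda>s. exp (l * s) * (M + m s)) has_real_derivative e s) (at s)" for s
    unfolding e_def by (auto intro!: derivative_eq_intros dm simp: algebra_simps)
  have d\<phi>: "(\<phi> has_derivative (\<lambda>v. (dx w, dt w + e (snd w)) \<bullet> v)) (at w)" if "snd w \<in> {0<..<T}" for w
  proof -
    have "((\<lambda>s. exp (l * s) * (M + m s)) has_derivative (\<lambda>r. e (snd w) * r)) (at (snd w))"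
      using dexp[of "snd w"] by (simp add: has_field_derivative_def)
    from has_derivative_compose[OF has_derivative_snd[OF has_derivative_ident] this]
    have "((\<lambda>w. exp (l * snd w) * (M + m (snd w))) has_derivative (\<lambda>v. e (snd w) * snd v)) (at w)" by simp
    from has_derivative_add[OF d\<psi>[OF that] this] show ?thesis
      unfolding \<phi>_def by (rule has_derivative_eq_rhs) (auto simp: inner_prod_def algebra_simps)
  qed
  have C1: "C1_on \<phi> (UNIV \<times> {0<..<T})"
  proof (rule C1_on_gradient[where g = "\<lambda>w. (dx w, dt w + e (snd w))"])
    show "continuous_on (UNIV \<times> {0<..<T}) (\<lambda>w. (dx w, dt w + e (snd w)))"
      unfolding e_def m_def by (intro continuous_intros dc)
  qed (use d\<phi> in auto)
  have fd: "f (fst w) (snd w) - \<phi> w = exp (l * snd w) * (h w - M)" for w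
    unfolding \<phi>_def h_def g_def by (simp add: right_diff_distrib distrib_left mult.assoc[symmetric] flip: exp_add)
  have lm: "local_max_within (\<lambda>w. f (fst w) (snd w) - \<phi> w) (UNIV \<times> {0<..<T}) (y2, s2)"
  proof -
    define O1 where "O1 = snd -` {a<..<b} \<inter> (\<lambda>w. norm (fst w - \<xi> (snd w))) -` {..<\<rho>}"
    have "continuous_on UNIV (\<lambda>w. norm (fst w - \<xi> (snd w)))"
      by (intro continuous_intros \<xi>c)
    from open_vimage[OF open_lessThan this, of \<rho>]
    have "open O1" unfolding O1_def
      by (intro open_Int open_vimage_snd) auto
    moreover have "(y2, s2) \<in> O1" using s2i y2i by (simp add: O1_def)
    ultimately obtain d where "d > 0" and d: "ball (y2, s2) d \<subseteq> O1"
      unfolding open_contains_ball by blast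
    have "f (fst w) (snd w) - \<phi> w \<le> f (fst w2) (snd w2) - \<phi> w2" if "w \<in> ball (y2, s2) d" for w
    proof -
      have "w \<in> Q" using subsetD[OF d that] by (auto simp: Q_def O1_def)
      from max[OF this] have "h w \<le> M" by (simp add: M_def)
      then show ?thesis unfolding fd M_def by (simp add: mult_nonneg_nonpos)
    qed
    then show ?thesis unfolding local_max_within_def using s2T \<open>d > 0\<close> ys by auto
  qed
  \<comment> \<open>Replacing \<open>f\<close> by \<open>\<psi>\<close> inside \<open>G\<close>
    costs at most \<open>K * (f - \<psi>)\<close>, while the time derivative \<open>e\<close>
    contributes at least \<open>(K + 1) * (f - \<psi>)\<close>. The surplus contradicts the
    supersolution inequality.\<close>
  have "dt (y2, s2) + e s2 + G y2 s2 (f y2 s2) (dx (y2, s2)) \<le> 0"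
    using sub[unfolded visc_sub_def, rule_format, OF C1 s2T d\<phi>[of "(y2, s2)", unfolded snd_conv, OF s2T] lm] .
  moreover have "G y2 s2 (f y2 s2) (dx (y2, s2)) \<ge> G y2 s2 (\<psi> y2 s2) (dx (y2, s2)) - K * (exp (l * s2) * (M + m s2))"
  proof -
    have "f y2 s2 - \<psi> y2 s2 = exp (l * s2) * (M + m s2)"
      using fd[of w2] by (simp add: M_def ys \<phi>_def)
    then show ?thesis
      using lip[OF s2T, of y2 "f y2 s2" "dx (y2, s2)" "\<psi> y2 s2"] f2 by simp
  qed
  moreover have "e s2 \<ge> l * (exp (l * s2) * (M + m s2))"
    using \<Lambda>0 by (simp add: e_def)
  moreover have "exp (l * s2) * (M + m s2) > 0" using Mpos m0[of s2] by simp
  moreover have "l * (exp (l * s2) * (M + m s2)) = K * (exp (l * s2) * (M + m s2)) + exp (l * s2) * (M + m s2)"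
    by (simp add: l_def distrib_right)
  moreover note super[OF s2i y2i]
  ultimately show False by linarith
qed

text \<open>The final time is reached by continuity along the translate of \<open>\<xi>\<close> that
  ends at \<open>y1\<close>, which stays in the tube. Including it matters for \<open>b = T\<close>:
  after time reversal this is the initial time, where the foot of the characteristic lies.\<close>

lemma tube_comparison:
  fixes f \<psi> :: "'a::euclidean_space \<Rightarrow> real \<Rightarrow> real"
  assumes ab: "0 \<le> a" "a < b" "b \<le> T" and "K \<ge> 0" "\<rho> > 0"
    and sub: "visc_sub T G f"
    and lip: "\<And>x t v w q. t \<in> {0<..<T} \<Longrightarrow> \<bar>G x t v q - G x t w q\<bar> \<le> K * \<bar>v - w\<bar>"
    and fc: "continuous_on (UNIV \<times> {a..b}) (\<lambda>w. f (fst w) (snd w))"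
    and \<psi>c: "continuous_on (UNIV \<times> {a..b}) (\<lambda>w. \<psi> (fst w) (snd w))"
    and d\<psi>: "\<And>w. snd w \<in> {0<..<T} \<Longrightarrow> ((\<lambda>w. \<psi> (fst w) (snd w)) has_derivative (\<lambda>v. (dx w, dt w) \<bullet> v)) (at w)"
    and dc: "continuous_on (UNIV \<times> {0<..<T}) dx" "continuous_on (UNIV \<times> {0<..<T}) dt"
    and \<xi>: "continuous_on UNIV \<xi>"
    and super: "\<And>y s. s \<in> {a<..<b} \<Longrightarrow> norm (y - \<xi> s) < \<rho> \<Longrightarrow> dt (y, s) + G y s (\<psi> y s) (dx (y, s)) \<ge> 0"
    and init: "\<And>y. norm (y - \<xi> a) \<le> \<rho> \<Longrightarrow> f y a \<le> \<psi> y a"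
    and lat: "\<And>y s. s \<in> {a..b} \<Longrightarrow> norm (y - \<xi> s) = \<rho> \<Longrightarrow> f y s \<le> \<psi> y s"
    and s1: "s1 \<in> {a..b}" and y1: "norm (y1 - \<xi> s1) \<le> \<rho>"
  shows "f y1 s1 \<le> \<psi> y1 s1"
proof -
  have opn: "f y s \<le> \<psi> y s" if s: "s \<in> {a..<b}" and y: "norm (y - \<xi> s) \<le> \<rho>" for y s
    by (rule tube_comparison_open[where f = f and \<psi> = \<psi> and dx = dx and dt = dt and \<xi> = \<xi> and G = G
          and a = a and b = b and T = T and K = K and \<rho> = \<rho>])
       (fact ab \<open>K \<ge> 0\<close> \<open>\<rho> > 0\<close> sub lip fc \<psi>c d\<psi> dc \<xi> super init lat s y)+
  show ?thesis
  proof (cases "s1 = b")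
    case False
    then show ?thesis using opn[OF _ y1] s1 by simp
  next
    case True
    define c where "c s = (\<xi> s + (y1 - \<xi> b), s)" for s
    have cc: "continuous_on {a..b} c" unfolding c_def
      by (intro continuous_intros continuous_on_subset[OF \<xi>]) auto
    have im: "c ` {a..b} \<subseteq> UNIV \<times> {a..b}" by (auto simp: c_def)
    have "continuous_on {a..b} (\<lambda>s. \<psi> (fst (c s)) (snd (c s)) - f (fst (c s)) (snd (c s)))"
      using continuous_on_compose2[OF fc cc im] continuous_on_compose2[OF \<psi>c cc im]
      by (intro continuous_intros)
    then have lim: "((\<lambda>s. \<psi> (fst (c s)) (snd (c s)) - f (fst (c s)) (snd (c s))) \<longlongrightarrow>
        \<psi> (fst (c b)) (snd (c b)) - f (fst (c b)) (snd (c b))) (at b within {a..b})"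
      using ab by (auto simp: continuous_on_def)
    have "\<forall>\<^sub>F s in at b within {a..b}. 0 \<le> \<psi> (fst (c s)) (snd (c s)) - f (fst (c s)) (snd (c s))"
      unfolding eventually_at_filter
    proof (rule always_eventually, intro allI impI)
      fix s assume "s \<noteq> b" "s \<in> {a..b}"
      then show "0 \<le> \<psi> (fst (c s)) (snd (c s)) - f (fst (c s)) (snd (c s))"
        using opn[of s "fst (c s)"] y1 True
        by (simp add: c_def)
    qed
    moreover have "at b within {a..b} \<noteq> bot"
      using ab by (simp add: at_within_Icc_at_left)
    ultimately have "0 \<le> \<psi> (fst (c b)) (snd (c b)) - f (fst (c b)) (snd (c b))"
      using tendsto_lowerbound[OF lim] by blast
    then show ?thesis using True by (simp add: c_def)
  qed
qed

text \<open>In \<open>super\<close> the Hamiltonian is evaluated at the affine value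
  \<open>z + p \<bullet> \<eta>\<close>, which the Taylor expansion along characteristics controls.
  The true value differs by the quadratic term and by \<open>\<theta>\<close>. The Lipschitz bound
  in the value charges \<open>K\<close> times both, which explains the summand with
  \<open>- K * k s\<close> and the condition
  \<open>K * \<bar>\<theta> s\<bar> \<le> \<theta>' s\<close>; exponentials satisfy the latter with
  equality. The terms with \<open>\<xi>'\<close> come from differentiating
  \<open>\<eta> = y - \<xi> s\<close> in time.\<close>

lemma paraboloid_comparison:
  fixes f :: "'a::euclidean_space \<Rightarrow> real \<Rightarrow> real" and \<xi> p :: "real \<Rightarrow> 'a" and z k \<theta> :: "real \<Rightarrow> real"
  assumes ab: "0 \<le> a" "a < b" "b \<le> T" and K: "K \<ge> 0" and \<rho>: "\<rho> > 0"
    and sub: "visc_sub T G f"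
    and lip: "\<And>x t v w q. t \<in> {0<..<T} \<Longrightarrow> \<bar>G x t v q - G x t w q\<bar> \<le> K * \<bar>v - w\<bar>"
    and fc: "continuous_on (UNIV \<times> {a..b}) (\<lambda>w. f (fst w) (snd w))"
    and d\<xi>: "\<And>s. (\<xi> has_vector_derivative \<xi>' s) (at s)" "continuous_on UNIV \<xi>'"
    and dp: "\<And>s. (p has_vector_derivative p' s) (at s)" "continuous_on UNIV p'"
    and dz: "\<And>s. (z has_real_derivative z' s) (at s)" "continuous_on UNIV z'"
    and dk: "\<And>s. (k has_real_derivative k' s) (at s)" "continuous_on UNIV k'"
    and d\<theta>: "\<And>s. (\<theta> has_real_derivative \<theta>' s) (at s)" "continuous_on UNIV \<theta>'"
    and \<theta>: "\<And>s. s \<in> {a<..<b} \<Longrightarrow> K * \<bar>\<theta> s\<bar> \<le> \<theta>' s"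
    and k0: "\<And>s. s \<in> {a..b} \<Longrightarrow> 0 \<le> k s"
    and super: "\<And>s \<eta>. s \<in> {a<..<b} \<Longrightarrow> norm \<eta> < \<rho> \<Longrightarrow>
      z' s + p' s \<bullet> \<eta> - p s \<bullet> \<xi>' s - k s * (\<eta> \<bullet> \<xi>' s) + (k' s - K * k s) * (norm \<eta>)\<^sup>2 / 2
        + G (\<xi> s + \<eta>) s (z s + p s \<bullet> \<eta>) (p s + k s *\<^sub>R \<eta>) \<ge> 0"
    and init: "\<And>\<eta>. norm \<eta> \<le> \<rho> \<Longrightarrow> f (\<xi> a + \<eta>) a \<le> z a + p a \<bullet> \<eta> + k a * (norm \<eta>)\<^sup>2 / 2 + \<theta> a"
    and lat: "\<And>s \<eta>. s \<in> {a..b} \<Longrightarrow> norm \<eta> = \<rho> \<Longrightarrow> f (\<xi> s + \<eta>) s \<le> z s + p s \<bullet> \<eta> + k s * \<rho>\<^sup>2 / 2 + \<theta> s"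
    and s: "s \<in> {a..b}" and \<eta>: "norm \<eta> \<le> \<rho>"
  shows "f (\<xi> s + \<eta>) s \<le> z s + p s \<bullet> \<eta> + k s * (norm \<eta>)\<^sup>2 / 2 + \<theta> s"
proof -
  define \<psi> where "\<psi> y s = z s + p s \<bullet> (y - \<xi> s) + k s * ((y - \<xi> s) \<bullet> (y - \<xi> s)) / 2 + \<theta> s" for y s
  define dx where "dx w = p (snd w) + k (snd w) *\<^sub>R (fst w - \<xi> (snd w))" for w
  define dt where "dt w = z' (snd w) + p' (snd w) \<bullet> (fst w - \<xi> (snd w)) - p (snd w) \<bullet> \<xi>' (snd w)
      + k' (snd w) * ((fst w - \<xi> (snd w)) \<bullet> (fst w - \<xi> (snd w))) / 2
      - k (snd w) * ((fst w - \<xi> (snd w)) \<bullet> \<xi>' (snd w)) + \<theta>' (snd w)" for w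
  have cs: "continuous_on S (\<lambda>w::'a \<times> real. h (snd w))" if "continuous_on UNIV h"
    for h :: "real \<Rightarrow> 'c::topological_space" and S
    by (rule continuous_on_compose2[OF that continuous_on_snd]) (auto intro: continuous_on_id)
  have cv: "continuous_on UNIV h" if "\<And>s. (h has_vector_derivative h' s) (at s)"
    for h :: "real \<Rightarrow> 'c::real_normed_vector" and h'
    using that by (meson continuous_at_imp_continuous_on has_vector_derivative_continuous)
  have cr: "continuous_on UNIV h" if "\<And>s. (h has_real_derivative h' s) (at s)" for h h'
    using that by (meson DERIV_isCont continuous_at_imp_continuous_on)
  note cc = cs[OF cv[OF d\<xi>(1)]] cs[OF cv[OF dp(1)]] cs[OF cr[OF dz(1)]] cs[OF cr[OF dk(1)]] cs[OF cr[OF d\<theta>(1)]]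
    cs[OF d\<xi>(2)] cs[OF dp(2)] cs[OF dz(2)] cs[OF dk(2)] cs[OF d\<theta>(2)]
  have dv: "((\<lambda>w::'a \<times> real. h (snd w)) has_derivative (\<lambda>v. snd v *\<^sub>R h' (snd w))) (at w)"
    if "\<And>s. (h has_vector_derivative h' s) (at s)" for h :: "real \<Rightarrow> 'c::real_normed_vector" and h' w
    using has_derivative_compose[OF has_derivative_snd[OF has_derivative_ident], of h "\<lambda>r. r *\<^sub>R h' (snd w)" w UNIV]
      that[of "snd w"] by (simp add: has_vector_derivative_def)
  have dr: "((\<lambda>w::'a \<times> real. h (snd w)) has_derivative (\<lambda>v. snd v * h' (snd w))) (at w)"
    if "\<And>s. (h has_real_derivative h' s) (at s)" for h h' w
    using dv[of h h' w] that by (simp add: has_real_derivative_iff_has_vector_derivative)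
  have d\<psi>: "((\<lambda>w. \<psi> (fst w) (snd w)) has_derivative (\<lambda>v. (dx w, dt w) \<bullet> v)) (at w)" for w
    unfolding \<psi>_def
    by (rule has_derivative_eq_rhs, (rule derivative_intros dv[OF d\<xi>(1)] dv[OF dp(1)] dr[OF dz(1)] dr[OF dk(1)] dr[OF d\<theta>(1)] | simp)+)
       (auto simp: fun_eq_iff dx_def dt_def inner_prod_def inner_add inner_diff inner_commute field_simps)
  have "f (\<xi> s + \<eta>) s \<le> \<psi> (\<xi> s + \<eta>) s"
  proof (rule tube_comparison[where f = f and \<psi> = \<psi> and dx = dx and dt = dt and \<xi> = \<xi> and G = G
          and a = a and b = b and T = T and K = K and \<rho> = \<rho>])
    show "continuous_on (UNIV \<times> {a..b}) (\<lambda>w. \<psi> (fst w) (snd w))"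
      unfolding \<psi>_def by (intro continuous_intros cc) simp_all
    show "continuous_on (UNIV \<times> {0<..<T}) dx"
      unfolding dx_def by (intro continuous_intros cc)
    show "continuous_on (UNIV \<times> {0<..<T}) dt"
      unfolding dt_def by (intro continuous_intros cc) simp_all
    show "continuous_on UNIV \<xi>" by (rule cv[OF d\<xi>(1)])
    fix y r assume r: "r \<in> {a<..<b}" and y: "norm (y - \<xi> r) < \<rho>"
    define e where "e = y - \<xi> r"
    have "\<bar>G y r (\<psi> y r) (dx (y, r)) - G y r (z r + p r \<bullet> e) (dx (y, r))\<bar> \<le> K * \<bar>\<psi> y r - (z r + p r \<bullet> e)\<bar>"
      using r ab by (intro lip) auto
    also have "\<bar>\<psi> y r - (z r + p r \<bullet> e)\<bar> \<le> k r * (norm e)\<^sup>2 / 2 + \<bar>\<theta> r\<bar>"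
    proof -
      have "\<psi> y r - (z r + p r \<bullet> e) = k r * (norm e)\<^sup>2 / 2 + \<theta> r"
        by (simp add: \<psi>_def e_def power2_norm_eq_inner)
      moreover have "0 \<le> k r * (norm e)\<^sup>2 / 2" using k0[of r] r by simp
      ultimately show ?thesis by linarith
    qed
    finally have "G y r (\<psi> y r) (dx (y, r)) \<ge> G y r (z r + p r \<bullet> e) (dx (y, r)) - K * (k r * (norm e)\<^sup>2 / 2 + \<bar>\<theta> r\<bar>)"
      using K by (auto simp: mult_left_mono abs_le_iff)
    moreover have "K * (k r * (norm e)\<^sup>2 / 2 + \<bar>\<theta> r\<bar>) \<le> K * k r * (norm e)\<^sup>2 / 2 + \<theta>' r"
      using \<theta>[OF r] by (simp add: distrib_left mult.assoc)
    moreover have "dt (y, r) = z' r + p' r \<bullet> e - p r \<bullet> \<xi>' r + k' r * (norm e)\<^sup>2 / 2 - k r * (e \<bullet> \<xi>' r) + \<theta>' r"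
      by (simp add: dt_def e_def power2_norm_eq_inner)
    moreover have "z' r + p' r \<bullet> e - p r \<bullet> \<xi>' r - k r * (e \<bullet> \<xi>' r) + (k' r - K * k r) * (norm e)\<^sup>2 / 2
        + G y r (z r + p r \<bullet> e) (dx (y, r)) \<ge> 0"
      using super[OF r, of e] y by (simp add: dx_def e_def)
    moreover have "(k' r - K * k r) * (norm e)\<^sup>2 / 2 = k' r * (norm e)\<^sup>2 / 2 - K * k r * (norm e)\<^sup>2 / 2"
      by (simp add: left_diff_distrib diff_divide_distrib)
    ultimately show "dt (y, r) + G y r (\<psi> y r) (dx (y, r)) \<ge> 0" by linarith
  next
    fix y assume "norm (y - \<xi> a) \<le> \<rho>"
    from init[OF this] show "f y a \<le> \<psi> y a" by (simp add: \<psi>_def power2_norm_eq_inner)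
  next
    fix y r assume "r \<in> {a..b}" "norm (y - \<xi> r) = \<rho>"
    from lat[OF this] this(2) show "f y r \<le> \<psi> y r" by (auto simp: \<psi>_def power2_norm_eq_inner)
  qed (use ab K \<rho> sub fc d\<psi> s \<eta> lip in auto)
  then show ?thesis by (simp add: \<psi>_def power2_norm_eq_inner)
qed

section \<open>The gradient of the Hamiltonian in the state variables\<close>

text \<open>At the times 0 and \<open>T\<close> the derivatives are only taken within the closed
  slab. With the time frozen, however, position, value and slope range over the whole space, so the
  restricted map has full derivatives. The local Lipschitz constant is a bound for the second
  derivative on a compact set.\<close>

lemma C2_on_state_gradient:
  fixes H :: "'a::euclidean_space \<Rightarrow> real \<Rightarrow> real \<Rightarrow> 'a \<Rightarrow> real"
  assumes "C2_on (\<lambda>(x, t, v, p). H x t v p) (UNIV \<times> {0..T} \<times> UNIV \<times> UNIV)"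
  obtains g :: "real \<Rightarrow> 'a \<times> real \<times> 'a \<Rightarrow> 'a \<times> real \<times> 'a" where
    "\<And>s Y. s \<in> {0..T} \<Longrightarrow> ((\<lambda>Y. H (fst Y) s (fst (snd Y)) (snd (snd Y))) has_derivative (\<lambda>d. g s Y \<bullet> d)) (at Y)"
    "continuous_on ({0..T} \<times> UNIV) (\<lambda>w. g (fst w) (snd w))"
    "continuous_on ({0..T} \<times> UNIV) (\<lambda>w. H (fst (snd w)) (fst w) (fst (snd (snd w))) (snd (snd (snd w))))"
    "\<And>s Y. s \<in> {0..T} \<Longrightarrow> g s differentiable (at Y)"
    "\<And>R. \<exists>L\<ge>0. \<forall>s\<in>{0..T}. \<forall>Y\<in>cball 0 R. \<forall>Z\<in>cball 0 R. norm (g s Y - g s Z) \<le> L * norm (Y - Z)"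
proof -
  define S where "S = (UNIV :: 'a set) \<times> {0..T} \<times> (UNIV :: (real \<times> 'a) set)"
  define h where "h = (\<lambda>(x, t, v, p). H x t v p)"
  have S: "S = UNIV \<times> {0..T} \<times> UNIV \<times> UNIV" by (auto simp: S_def)
  obtain D :: "'a \<times> real \<times> real \<times> 'a \<Rightarrow> ('a \<times> real \<times> real \<times> 'a) \<Rightarrow>\<^sub>L real" and D2
    where D2c: "continuous_on S D2"
      and D: "\<And>z. z \<in> S \<Longrightarrow> (h has_derivative blinfun_apply (D z)) (at z within S)"
      and D2: "\<And>z. z \<in> S \<Longrightarrow> (D has_derivative blinfun_apply (D2 z)) (at z within S)"
    using assms unfolding C2_on_def S h_def by blast
  have Dc: "continuous_on S D" using D2 by (meson continuous_on_eq_continuous_within has_derivative_continuous)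
  have hc: "continuous_on S h" using D by (meson continuous_on_eq_continuous_within has_derivative_continuous)
  define E where "E s Y = (fst Y, s, snd Y)" for s :: real and Y :: "'a \<times> real \<times> 'a"
  define e where "e d = (fst d, 0::real, snd d)" for d :: "'a \<times> real \<times> 'a"
  have ES: "E s Y \<in> S" if "s \<in> {0..T}" for s Y using that by (simp add: E_def S_def)
  have dE: "(E s has_derivative e) (at Y)" for s Y
    unfolding E_def e_def by (auto intro!: derivative_eq_intros)
  have le: "linear e" unfolding e_def by (auto intro!: linearI)
  have ne: "norm (e d) = norm d" for d by (simp add: e_def norm_prod_def)
  have Ec: "continuous_on ({0..T} \<times> UNIV) (\<lambda>w. E (fst w) (snd w))"
    unfolding E_def by (intro continuous_intros)
  have EI: "(\<lambda>w. E (fst w) (snd w)) ` ({0..T} \<times> UNIV) \<subseteq> S" by (auto simp: ES)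
  \<comment> \<open>The Riesz representative of the functional restricted to the directions without
    time component.\<close>
  define J :: "('a \<times> real \<times> real \<times> 'a) \<Rightarrow>\<^sub>L real \<Rightarrow> 'a \<times> real \<times> 'a"
    where "J A = (\<Sum>b\<in>Basis. blinfun_apply A (e b) *\<^sub>R b)" for A
  have bJ: "bounded_linear J" unfolding J_def
    by (intro bounded_linear_sum bounded_linear_scaleR_const blinfun.bounded_linear_left)
  have J: "J A \<bullet> d = A (e d)" for A d
  proof -
    have "e d = (\<Sum>b\<in>Basis. (d \<bullet> b) *\<^sub>R e b)"
      using linear_sum[OF le, of "\<lambda>b. (d \<bullet> b) *\<^sub>R b" Basis] linear_scale[OF le]
      by (simp add: euclidean_representation)
    then have "A (e d) = (\<Sum>b\<in>Basis. (d \<bullet> b) * A (e b))"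
      by (simp add: blinfun.sum_right blinfun.scaleR_right)
    then show ?thesis by (simp add: J_def inner_sum_right inner_commute[of _ d] mult.commute)
  qed
  define g where "g s Y = J (D (E s Y))" for s Y
  show thesis
  proof (rule that)
    fix s Y assume s: "s \<in> {0..T}"
    have "((\<lambda>Y. h (E s Y)) has_derivative (\<lambda>d. D (E s Y) (e d))) (at Y)"
      by (rule has_derivative_in_compose2[of S h "\<lambda>z. blinfun_apply (D z)" "E s" UNIV Y e, simplified])
        (use D dE ES[OF s] in auto)
    then show "((\<lambda>Y. H (fst Y) s (fst (snd Y)) (snd (snd Y))) has_derivative (\<lambda>d. g s Y \<bullet> d)) (at Y)"
      by (simp add: h_def E_def g_def J case_prod_beta)
  next
    show "continuous_on ({0..T} \<times> UNIV) (\<lambda>w. g (fst w) (snd w))"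
      unfolding g_def
      by (rule bounded_linear.continuous_on[OF bJ continuous_on_compose2[OF Dc Ec EI]])
    show "continuous_on ({0..T} \<times> UNIV) (\<lambda>w. H (fst (snd w)) (fst w) (fst (snd (snd w))) (snd (snd (snd w))))"
      using continuous_on_compose2[OF hc Ec EI] by (simp add: h_def E_def case_prod_beta)
  next
    have dg: "(g s has_derivative (\<lambda>d. J (D2 (E s Y) (e d)))) (at Y)" if s: "s \<in> {0..T}" for s Y
    proof -
      have "((\<lambda>Y. D (E s Y)) has_derivative (\<lambda>d. D2 (E s Y) (e d))) (at Y)"
        by (rule has_derivative_in_compose2[of S D "\<lambda>z. blinfun_apply (D2 z)" "E s" UNIV Y e, simplified])
          (use D2 dE ES[OF s] in auto)
      from bounded_linear.has_derivative[OF bJ this] show ?thesis by (simp add: g_def[abs_def])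
    qed
    then show "g s differentiable (at Y)" if "s \<in> {0..T}" for s Y
      using that unfolding differentiable_def by blast
    fix R :: real
    obtain BJ where BJ: "BJ > 0" "\<And>A. norm (J A) \<le> norm A * BJ"
      using bounded_linear.pos_bounded[OF bJ] by blast
    have "compact ((\<lambda>w. D2 (E (fst w) (snd w))) ` ({0..T} \<times> cball 0 R))"
      by (intro compact_continuous_image compact_Times compact_Icc compact_cball
          continuous_on_subset[OF continuous_on_compose2[OF D2c Ec EI]]) auto
    then have "bounded ((\<lambda>w. D2 (E (fst w) (snd w))) ` ({0..T} \<times> cball 0 R))" by (rule compact_imp_bounded)
    then obtain M where M: "M > 0" "\<And>s Y. s \<in> {0..T} \<Longrightarrow> Y \<in> cball 0 R \<Longrightarrow> norm (D2 (E s Y)) \<le> M"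
      unfolding bounded_pos by force
    have "norm (g s Y - g s Z) \<le> (M * BJ) * norm (Y - Z)"
      if "s \<in> {0..T}" "Y \<in> cball 0 R" "Z \<in> cball 0 R" for s Y Z
    proof (rule differentiable_bound[where S = "cball 0 R" and f' = "\<lambda>Y d. J (D2 (E s Y) (e d))"])
      fix Y :: "'a \<times> real \<times> 'a" assume Y: "Y \<in> cball 0 R"
      show "(g s has_derivative (\<lambda>d. J (D2 (E s Y) (e d)))) (at Y within cball 0 R)"
        using dg[OF that(1)] has_derivative_at_withinI by blast
      show "onorm (\<lambda>d. J (D2 (E s Y) (e d))) \<le> M * BJ"
      proof (rule onorm_le)
        fix d
        have "norm (J (D2 (E s Y) (e d))) \<le> norm (D2 (E s Y) (e d)) * BJ" by (rule BJ)
        also have "norm (D2 (E s Y) (e d)) \<le> norm (D2 (E s Y)) * norm (e d)" by (rule norm_blinfun)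
        also have "\<dots> \<le> M * norm d" using M(2)[OF that(1) Y] by (simp add: ne mult_right_mono)
        finally show "norm (J (D2 (E s Y) (e d))) \<le> M * BJ * norm d" using BJ(1) by (simp add: mult_ac)
      qed
    qed (use that in auto)
    then show "\<exists>L\<ge>0. \<forall>s\<in>{0..T}. \<forall>Y\<in>cball 0 R. \<forall>Z\<in>cball 0 R. norm (g s Y - g s Z) \<le> L * norm (Y - Z)"
      using M(1) BJ(1) by (intro exI[of _ "M * BJ"]) auto
  qed
qed

section \<open>Derivatives of the Hamiltonian\<close>

text \<open>Each of (H1) to (H3) varies a single argument, so it bounds a directional derivative.
  Taking \<open>d\<close> to be the corresponding component of the gradient turns this into a norm
  bound.\<close>

lemma inner_derivative_bound:
  fixes f :: "'z::real_inner \<Rightarrow> real"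
  assumes "(f has_derivative (\<lambda>d. q \<bullet> d)) (at Y)" and bd: "\<And>h. \<bar>f (Y + h *\<^sub>R d) - f Y\<bar> \<le> M * \<bar>h\<bar>"
  shows "\<bar>q \<bullet> d\<bar> \<le> M"
proof -
  have "((\<lambda>h. Y + h *\<^sub>R d) has_derivative (\<lambda>h. h *\<^sub>R d)) (at 0)"
    by (auto intro!: derivative_eq_intros)
  from has_derivative_compose[OF this, of f "\<lambda>d. q \<bullet> d"] assms(1)
  have "((\<lambda>h. f (Y + h *\<^sub>R d)) has_derivative (\<lambda>h. h * (q \<bullet> d))) (at 0)" by simp
  then have "((\<lambda>h. f (Y + h *\<^sub>R d)) has_real_derivative (q \<bullet> d)) (at 0)"
    by (simp add: has_field_derivative_def mult.commute[of _ "q \<bullet> d"])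
  then have "((\<lambda>h. (f (Y + h *\<^sub>R d) - f Y) / h) \<longlongrightarrow> q \<bullet> d) (at 0)" by (simp add: DERIV_def)
  then have lim: "((\<lambda>h. \<bar>(f (Y + h *\<^sub>R d) - f Y) / h\<bar>) \<longlongrightarrow> \<bar>q \<bullet> d\<bar>) (at 0)" by (rule tendsto_rabs)
  have "\<forall>\<^sub>F h in at 0. \<bar>(f (Y + h *\<^sub>R d) - f Y) / h\<bar> \<le> M"
    unfolding eventually_at_filter
    by (rule always_eventually) (use bd in \<open>auto simp: abs_divide field_simps\<close>)
  then show ?thesis using tendsto_upperbound[OF lim] by simp
qed

lemma norm_triple_components:
  fixes a :: "'a::real_normed_vector \<times> 'b::real_normed_vector \<times> 'c::real_normed_vector"
  shows "norm (fst a) \<le> norm a" "norm (fst (snd a)) \<le> norm a" "norm (snd (snd a)) \<le> norm a"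
  using norm_fst_le[of "fst a" "snd a"] norm_snd_le[of "snd a" "fst a"]
    norm_fst_le[of "fst (snd a)" "snd (snd a)"] norm_snd_le[of "snd (snd a)" "fst (snd a)"]
  by auto

lemma norm_triple_le:
  fixes a c :: "'a::real_normed_vector" and b :: real
  shows "norm (a, b, c) \<le> norm a + (\<bar>b\<bar> + norm c)"
  using norm_Pair_le[of a "(b, c)"] norm_Pair_le[of b c] by simp

locale hamiltonian =
  fixes H :: "'a::euclidean_space \<Rightarrow> real \<Rightarrow> real \<Rightarrow> 'a \<Rightarrow> real"
    and T C1 \<beta> A2 B2 K3 :: real
    and g :: "real \<Rightarrow> 'a \<times> real \<times> 'a \<Rightarrow> 'a \<times> real \<times> 'a"
  assumes T_pos: "T > 0"
    and C1_nn: "C1 \<ge> 0" and \<beta>_nn: "\<beta> \<ge> 0" and A2_nn: "A2 \<ge> 0" and B2_nn: "B2 \<ge> 0" and K3_nn: "K3 \<ge> 0"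
    and H1: "\<And>x y t v p. t \<in> {0..T} \<Longrightarrow> \<bar>H x t v p - H y t v p\<bar> \<le> C1 * (\<beta> + norm p) * norm (x - y)"
    and H2: "\<And>x t v p q. t \<in> {0..T} \<Longrightarrow> \<bar>H x t v p - H x t v q\<bar> \<le> (A2 * norm x + B2) * norm (p - q)"
    and H3: "\<And>x t v w p. t \<in> {0..T} \<Longrightarrow> \<bar>H x t v p - H x t w p\<bar> \<le> K3 * \<bar>v - w\<bar>"
    and H4: "\<And>x t v. t \<in> {0..T} \<Longrightarrow> convex_on UNIV (\<lambda>p. H x t v p)"
    and g_deriv: "\<And>s Y. s \<in> {0..T} \<Longrightarrow>
      ((\<lambda>Y. H (fst Y) s (fst (snd Y)) (snd (snd Y))) has_derivative (\<lambda>d. g s Y \<bullet> d)) (at Y)"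
    and g_cont: "continuous_on ({0..T} \<times> UNIV) (\<lambda>w. g (fst w) (snd w))"
    and H_cont: "continuous_on ({0..T} \<times> UNIV) (\<lambda>w. H (fst (snd w)) (fst w) (fst (snd (snd w))) (snd (snd (snd w))))"
    and g_lip: "\<And>R. \<exists>L\<ge>0. \<forall>s\<in>{0..T}. \<forall>Y\<in>cball 0 R. \<forall>Z\<in>cball 0 R. norm (g s Y - g s Z) \<le> L * norm (Y - Z)"
begin

abbreviation hh :: "real \<Rightarrow> 'a \<times> real \<times> 'a \<Rightarrow> real" where
  "hh s Y \<equiv> H (fst Y) s (fst (snd Y)) (snd (snd Y))"
abbreviation Hx :: "real \<Rightarrow> 'a \<times> real \<times> 'a \<Rightarrow> 'a" where "Hx s Y \<equiv> fst (g s Y)"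
abbreviation Hu :: "real \<Rightarrow> 'a \<times> real \<times> 'a \<Rightarrow> real" where "Hu s Y \<equiv> fst (snd (g s Y))"
abbreviation Hp :: "real \<Rightarrow> 'a \<times> real \<times> 'a \<Rightarrow> 'a" where "Hp s Y \<equiv> snd (snd (g s Y))"

lemma norm_Hx_le:
  assumes s: "s \<in> {0..T}" shows "norm (Hx s Y) \<le> C1 * (\<beta> + norm (snd (snd Y)))"
proof (cases "Hx s Y = 0")
  case True then show ?thesis using C1_nn \<beta>_nn by simp
next
  case False
  have "\<bar>g s Y \<bullet> (Hx s Y, 0)\<bar> \<le> C1 * (\<beta> + norm (snd (snd Y))) * norm (Hx s Y)"
  proof (rule inner_derivative_bound[OF g_deriv[OF s]])
    fix h
    show "\<bar>hh s (Y + h *\<^sub>R (Hx s Y, 0)) - hh s Y\<bar> \<le> C1 * (\<beta> + norm (snd (snd Y))) * norm (Hx s Y) * \<bar>h\<bar>"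
      using H1[OF s, of "fst Y + h *\<^sub>R Hx s Y" "fst (snd Y)" "snd (snd Y)" "fst Y"] by (simp add: mult_ac)
  qed
  then have "norm (Hx s Y) * norm (Hx s Y) \<le> C1 * (\<beta> + norm (snd (snd Y))) * norm (Hx s Y)"
    by (simp add: inner_prod_def dot_square_norm power2_eq_square)
  then show ?thesis using False by simp
qed

lemma norm_Hp_le:
  assumes s: "s \<in> {0..T}" shows "norm (Hp s Y) \<le> A2 * norm (fst Y) + B2"
proof (cases "Hp s Y = 0")
  case True then show ?thesis using A2_nn B2_nn by simp
next
  case False
  have "\<bar>g s Y \<bullet> (0, 0, Hp s Y)\<bar> \<le> (A2 * norm (fst Y) + B2) * norm (Hp s Y)"
  proof (rule inner_derivative_bound[OF g_deriv[OF s]])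
    fix h
    show "\<bar>hh s (Y + h *\<^sub>R (0, 0, Hp s Y)) - hh s Y\<bar> \<le> (A2 * norm (fst Y) + B2) * norm (Hp s Y) * \<bar>h\<bar>"
      using H2[OF s, of "fst Y" "fst (snd Y)" "snd (snd Y) + h *\<^sub>R Hp s Y" "snd (snd Y)"] by (simp add: mult_ac)
  qed
  then have "norm (Hp s Y) * norm (Hp s Y) \<le> (A2 * norm (fst Y) + B2) * norm (Hp s Y)"
    by (simp add: inner_prod_def dot_square_norm power2_eq_square)
  then show ?thesis using False by simp
qed

lemma abs_Hu_le:
  assumes s: "s \<in> {0..T}" shows "\<bar>Hu s Y\<bar> \<le> K3"
proof -
  have "\<bar>g s Y \<bullet> (0, 1, 0)\<bar> \<le> K3"
  proof (rule inner_derivative_bound[OF g_deriv[OF s]])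
    fix h
    show "\<bar>hh s (Y + h *\<^sub>R (0, 1, 0)) - hh s Y\<bar> \<le> K3 * \<bar>h\<bar>"
      using H3[OF s, of "fst Y" "fst (snd Y) + h" "snd (snd Y)" "fst (snd Y)"] by simp
  qed
  then show ?thesis by (simp add: inner_prod_def)
qed

lemma g_components:
  "norm (Hx s Y - Hx t Z) \<le> norm (g s Y - g t Z)" "\<bar>Hu s Y - Hu t Z\<bar> \<le> norm (g s Y - g t Z)"
  "norm (Hp s Y - Hp t Z) \<le> norm (g s Y - g t Z)"
  "norm (Hx s Y) \<le> norm (g s Y)" "\<bar>Hu s Y\<bar> \<le> norm (g s Y)" "norm (Hp s Y) \<le> norm (g s Y)"
  using norm_triple_components[of "g s Y - g t Z"] norm_triple_components[of "g s Y"] by simp_all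

lemma convex_tangent:
  assumes s: "s \<in> {0..T}" shows "H x s v (p + d) \<ge> H x s v p + Hp s (x, v, p) \<bullet> d"
proof -
  have "((\<lambda>r. (x, v, p + r *\<^sub>R d)) has_derivative (\<lambda>r. (0, 0, r *\<^sub>R d))) (at 0)"
    by (auto intro!: derivative_eq_intros)
  from has_derivative_compose[OF this, of "hh s" "\<lambda>d. g s (x, v, p) \<bullet> d"] g_deriv[OF s]
  have "((\<lambda>r. H x s v (p + r *\<^sub>R d)) has_real_derivative (Hp s (x, v, p) \<bullet> d)) (at 0)"
    by (simp add: has_field_derivative_def inner_prod_def mult.commute[of _ "Hp s (x, v, p) \<bullet> d"])
  moreover have "convex_on UNIV (\<lambda>r. H x s v (p + r *\<^sub>R d))"
  proof (rule convex_onI)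
    fix t r q :: real assume t: "0 < t" "t < 1"
    have e: "p + ((1 - t) *\<^sub>R r + t *\<^sub>R q) *\<^sub>R d = (1 - t) *\<^sub>R (p + r *\<^sub>R d) + t *\<^sub>R (p + q *\<^sub>R d)"
      by (simp add: algebra_simps)
    show "H x s v (p + ((1 - t) *\<^sub>R r + t *\<^sub>R q) *\<^sub>R d) \<le> (1 - t) * H x s v (p + r *\<^sub>R d) + t * H x s v (p + q *\<^sub>R d)"
      unfolding e using convex_onD[OF H4[OF s, of x v], of t "p + r *\<^sub>R d" "p + q *\<^sub>R d"] t by simp
  qed simp
  ultimately have "H x s v (p + 1 *\<^sub>R d) - H x s v (p + 0 *\<^sub>R d) \<ge> (Hp s (x, v, p) \<bullet> d) * (1 - 0)"
    by (intro convex_on_imp_above_tangent[where A = UNIV and f = "\<lambda>r. H x s v (p + r *\<^sub>R d)"]) auto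
  then show ?thesis by simp
qed

lemma taylor_bound:
  assumes s: "s \<in> {0..T}" and L: "\<forall>Y\<in>cball 0 R. \<forall>Z\<in>cball 0 R. norm (g s Y - g s Z) \<le> L * norm (Y - Z)" "L \<ge> 0"
    and YZ: "Y \<in> cball 0 R" "Z \<in> cball 0 R"
  shows "\<bar>hh s Z - hh s Y - g s Y \<bullet> (Z - Y)\<bar> \<le> L * (norm (Z - Y))\<^sup>2"
proof -
  have seg: "closed_segment Y Z \<subseteq> cball 0 R" using YZ by (simp add: closed_segment_subset)
  have "norm (hh s Z - hh s Y - g s Y \<bullet> (Z - Y)) \<le> norm (Z - Y) * (L * norm (Z - Y))"
  proof (rule differentiable_bound_linearization[where S = "closed_segment Y Z" and f' = "\<lambda>X d. g s X \<bullet> d"])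
    fix t :: real assume "t \<in> {0..1}"
    then show "Y + t *\<^sub>R (Z - Y) \<in> closed_segment Y Z"
      unfolding in_segment by (intro exI[of _ t]) (auto simp: algebra_simps)
  next
    fix X assume X: "X \<in> closed_segment Y Z"
    show "(hh s has_derivative (\<lambda>d. g s X \<bullet> d)) (at X within closed_segment Y Z)"
      using g_deriv[OF s] has_derivative_at_withinI by blast
    have XY: "norm (X - Y) \<le> norm (Z - Y)"
      using segment_bound(1)[OF X] by (simp add: norm_minus_commute)
    have "norm (g s X - g s Y) \<le> L * norm (X - Y)" using L(1) seg X YZ by blast
    also have "\<dots> \<le> L * norm (Z - Y)" using XY L(2) by (rule mult_left_mono)
    finally have "norm (g s X - g s Y) \<le> L * norm (Z - Y)" .
    then have le: "norm (g s X - g s Y) * norm d \<le> L * norm (Z - Y) * norm d" for d :: "'a \<times> real \<times> 'a"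
      by (rule mult_right_mono) simp
    show "onorm ((\<lambda>d. g s X \<bullet> d) - (\<lambda>d. g s Y \<bullet> d)) \<le> L * norm (Z - Y)"
      by (rule onorm_le) (use order_trans[OF Cauchy_Schwarz_ineq2 le] in \<open>simp add: inner_diff_left[symmetric]\<close>)
  qed auto
  then show ?thesis by (simp add: power2_eq_square mult_ac)
qed

text \<open>The lower bound uses convexity and is linear in \<open>K\<close>, so paraboloids of arbitrary curvature survive
  for all time; without convexity the bound is quadratic and curvature is controlled for a short time only.\<close>

lemma expansion_along_paraboloid:
  obtains C where "C \<ge> 0"
    "\<And>s x v p \<eta> K. s \<in> {0..T} \<Longrightarrow> norm x \<le> RX \<Longrightarrow> \<bar>v\<bar> \<le> RZ \<Longrightarrow> norm p \<le> RP \<Longrightarrow> norm \<eta> \<le> 1 \<Longrightarrow>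
      H (x + \<eta>) s (v + p \<bullet> \<eta>) (p + K *\<^sub>R \<eta>) - H x s v p - (Hx s (x, v, p) + Hu s (x, v, p) *\<^sub>R p) \<bullet> \<eta>
        - K * (Hp s (x, v, p) \<bullet> \<eta>) \<ge> - (C * (1 + \<bar>K\<bar>) * (norm \<eta>)\<^sup>2)"
    "\<And>s x v p \<eta> K. s \<in> {0..T} \<Longrightarrow> norm x \<le> RX \<Longrightarrow> \<bar>v\<bar> \<le> RZ \<Longrightarrow> norm p \<le> RP \<Longrightarrow> norm \<eta> \<le> 1 \<Longrightarrow> \<bar>K\<bar> * norm \<eta> \<le> 1 \<Longrightarrow>
      H (x + \<eta>) s (v + p \<bullet> \<eta>) (p + K *\<^sub>R \<eta>) - H x s v p - (Hx s (x, v, p) + Hu s (x, v, p) *\<^sub>R p) \<bullet> \<eta>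
        - K * (Hp s (x, v, p) \<bullet> \<eta>) \<le> C * (1 + \<bar>K\<bar>)\<^sup>2 * (norm \<eta>)\<^sup>2"
proof -
  define R where "R = (\<bar>RX\<bar> + 1) + ((\<bar>RZ\<bar> + \<bar>RP\<bar>) + (\<bar>RP\<bar> + 1))"
  obtain L where L: "L \<ge> 0" "\<forall>s\<in>{0..T}. \<forall>Y\<in>cball 0 R. \<forall>Z\<in>cball 0 R. norm (g s Y - g s Z) \<le> L * norm (Y - Z)"
    using g_lip by blast
  define C where "C = L * (1 + \<bar>RP\<bar>)\<^sup>2"
  have C0: "C \<ge> 0" using L by (simp add: C_def)
  have base: "(x, v, p) \<in> cball 0 R"
    "(x + \<eta>, v + p \<bullet> \<eta>, p) \<in> cball 0 R"
    "\<bar>K\<bar> * norm \<eta> \<le> 1 \<Longrightarrow> (x + \<eta>, v + p \<bullet> \<eta>, p + K *\<^sub>R \<eta>) \<in> cball 0 R"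
    "\<bar>p \<bullet> \<eta>\<bar> \<le> \<bar>RP\<bar> * norm \<eta>"
    if A: "norm x \<le> RX" "\<bar>v\<bar> \<le> RZ" "norm p \<le> RP" "norm \<eta> \<le> 1" for x p \<eta> :: 'a and v K
  proof -
    have "\<bar>p \<bullet> \<eta>\<bar> \<le> norm p * norm \<eta>" by (rule Cauchy_Schwarz_ineq2)
    also have "\<dots> \<le> \<bar>RP\<bar> * norm \<eta>" using A by (intro mult_right_mono) auto
    finally show pe: "\<bar>p \<bullet> \<eta>\<bar> \<le> \<bar>RP\<bar> * norm \<eta>" .
    have "\<bar>RP\<bar> * norm \<eta> \<le> \<bar>RP\<bar>" using A(4) by (simp add: mult_left_le)
    with pe have pe1: "\<bar>p \<bullet> \<eta>\<bar> \<le> \<bar>RP\<bar>" by simp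
    have xe: "norm (x + \<eta>) \<le> \<bar>RX\<bar> + 1" using norm_triangle_ineq[of x \<eta>] A by simp
    show "(x, v, p) \<in> cball 0 R" using norm_triple_le[of x v p] A by (simp add: R_def)
    show "(x + \<eta>, v + p \<bullet> \<eta>, p) \<in> cball 0 R" using norm_triple_le[of "x + \<eta>" "v + p \<bullet> \<eta>" p] A xe pe1 by (simp add: R_def)
    show "(x + \<eta>, v + p \<bullet> \<eta>, p + K *\<^sub>R \<eta>) \<in> cball 0 R" if "\<bar>K\<bar> * norm \<eta> \<le> 1"
      using norm_triple_le[of "x + \<eta>" "v + p \<bullet> \<eta>" "p + K *\<^sub>R \<eta>"] norm_triangle_ineq[of p "K *\<^sub>R \<eta>"] A xe pe1 that
      by (simp add: R_def)
  qed
  show thesis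
  proof (rule that[OF C0])
    fix s v and x p \<eta> :: 'a and K :: real
    assume s: "s \<in> {0..T}" and A: "norm x \<le> RX" "\<bar>v\<bar> \<le> RZ" "norm p \<le> RP" "norm \<eta> \<le> 1"
    note bs = base(1)[OF A] base(2)[OF A] base(3)[OF A, of K] base(4)[OF A]
    note Ls = bspec[OF L(2) s]
    define Y where "Y = (x, v, p)"
    \<comment> \<open>Only position and value are shifted here. The slope increment
      \<open>K *\<^sub>R \<eta>\<close> is added by the tangent inequality at \<open>Z\<close>,
      which holds however large it is; this is what makes the error linear in
      \<open>K\<close>.\<close>
    define Z where "Z = (x + \<eta>, v + p \<bullet> \<eta>, p)"
    have ZY: "Z - Y = (\<eta>, p \<bullet> \<eta>, 0)" by (simp add: Z_def Y_def)
    have nZY: "norm (Z - Y) \<le> (1 + \<bar>RP\<bar>) * norm \<eta>"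
      unfolding ZY using norm_triple_le[of \<eta> "p \<bullet> \<eta>" 0] bs(4) by (simp add: algebra_simps)
    have t: "\<bar>hh s Z - hh s Y - g s Y \<bullet> (Z - Y)\<bar> \<le> L * (norm (Z - Y))\<^sup>2"
      by (rule taylor_bound[OF s Ls L(1)]) (use bs in \<open>simp_all add: Y_def Z_def\<close>)
    also have "\<dots> \<le> L * ((1 + \<bar>RP\<bar>) * norm \<eta>)\<^sup>2"
      using nZY L(1) by (intro mult_left_mono power_mono) auto
    finally have t: "\<bar>hh s Z - hh s Y - g s Y \<bullet> (Z - Y)\<bar> \<le> C * (norm \<eta>)\<^sup>2"
      by (simp add: C_def power_mult_distrib)
    have "norm (Hp s Z - Hp s Y) \<le> norm (g s Z - g s Y)"
      by (rule g_components)
    also have "\<dots> \<le> L * norm (Z - Y)"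
      by (rule Ls[rule_format]) (use bs in \<open>simp_all add: Y_def Z_def\<close>)
    also have "\<dots> \<le> L * ((1 + \<bar>RP\<bar>) * norm \<eta>)" using nZY L(1) by (rule mult_left_mono)
    also have "\<dots> \<le> L * ((1 + \<bar>RP\<bar>)\<^sup>2 * norm \<eta>)"
      using L(1) by (intro mult_left_mono mult_right_mono self_le_power) auto
    finally have h: "norm (Hp s Z - Hp s Y) \<le> C * norm \<eta>" by (simp add: C_def mult.assoc)
    have "\<bar>K * ((Hp s Z - Hp s Y) \<bullet> \<eta>)\<bar> \<le> \<bar>K\<bar> * (norm (Hp s Z - Hp s Y) * norm \<eta>)"
      unfolding abs_mult by (intro mult_left_mono Cauchy_Schwarz_ineq2) auto
    also have "\<dots> \<le> \<bar>K\<bar> * (C * norm \<eta> * norm \<eta>)" using h by (intro mult_left_mono mult_right_mono) auto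
    finally have k: "\<bar>K * (Hp s Z \<bullet> \<eta>) - K * (Hp s Y \<bullet> \<eta>)\<bar> \<le> C * \<bar>K\<bar> * (norm \<eta>)\<^sup>2"
      by (simp add: inner_diff_left right_diff_distrib power2_eq_square mult_ac)
    have "H (x + \<eta>) s (v + p \<bullet> \<eta>) (p + K *\<^sub>R \<eta>) \<ge> hh s Z + Hp s Z \<bullet> (K *\<^sub>R \<eta>)"
      using convex_tangent[OF s, of "x + \<eta>" "v + p \<bullet> \<eta>" p "K *\<^sub>R \<eta>"] by (simp add: Z_def)
    moreover have "g s Y \<bullet> (Z - Y) = (Hx s Y + Hu s Y *\<^sub>R p) \<bullet> \<eta>"
      unfolding ZY by (simp add: inner_prod_def inner_add_left)
    moreover have "C * (1 + \<bar>K\<bar>) * (norm \<eta>)\<^sup>2 = C * (norm \<eta>)\<^sup>2 + C * \<bar>K\<bar> * (norm \<eta>)\<^sup>2"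
      by (simp add: algebra_simps)
    moreover have "hh s Y = H x s v p" by (simp add: Y_def)
    ultimately show "H (x + \<eta>) s (v + p \<bullet> \<eta>) (p + K *\<^sub>R \<eta>) - H x s v p - (Hx s (x, v, p) + Hu s (x, v, p) *\<^sub>R p) \<bullet> \<eta>
        - K * (Hp s (x, v, p) \<bullet> \<eta>) \<ge> - (C * (1 + \<bar>K\<bar>) * (norm \<eta>)\<^sup>2)"
      using t k unfolding Y_def[symmetric] by (simp only: inner_scaleR_right)
  next
    fix s v and x p \<eta> :: 'a and K :: real
    assume s: "s \<in> {0..T}" and A: "norm x \<le> RX" "\<bar>v\<bar> \<le> RZ" "norm p \<le> RP" "norm \<eta> \<le> 1" and K: "\<bar>K\<bar> * norm \<eta> \<le> 1"
    note bs = base(1)[OF A] base(2)[OF A] base(3)[OF A, of K] base(4)[OF A]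
    note Ls = bspec[OF L(2) s]
    define Y where "Y = (x, v, p)"
    \<comment> \<open>For an upper bound all three arguments enter the Taylor estimate, and
      \<open>\<bar>K\<bar> * norm \<eta> \<le> 1\<close> keeps \<open>Z\<close> in the ball on which
      \<open>g\<close> is Lipschitz.\<close>
    define Z where "Z = (x + \<eta>, v + p \<bullet> \<eta>, p + K *\<^sub>R \<eta>)"
    have ZY: "Z - Y = (\<eta>, p \<bullet> \<eta>, K *\<^sub>R \<eta>)" by (simp add: Z_def Y_def)
    have "norm (Z - Y) \<le> (1 + \<bar>RP\<bar> + \<bar>K\<bar>) * norm \<eta>"
      unfolding ZY using norm_triple_le[of \<eta> "p \<bullet> \<eta>" "K *\<^sub>R \<eta>"] bs(4) by (simp add: algebra_simps)
    also have "\<dots> \<le> ((1 + \<bar>RP\<bar>) * (1 + \<bar>K\<bar>)) * norm \<eta>"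
      by (intro mult_right_mono) (auto simp: algebra_simps)
    finally have nZY: "norm (Z - Y) \<le> ((1 + \<bar>RP\<bar>) * (1 + \<bar>K\<bar>)) * norm \<eta>" .
    have "\<bar>hh s Z - hh s Y - g s Y \<bullet> (Z - Y)\<bar> \<le> L * (norm (Z - Y))\<^sup>2"
      by (rule taylor_bound[OF s Ls L(1)]) (use bs K in \<open>simp_all add: Y_def Z_def\<close>)
    also have "\<dots> \<le> L * (((1 + \<bar>RP\<bar>) * (1 + \<bar>K\<bar>)) * norm \<eta>)\<^sup>2"
      using nZY L(1) by (intro mult_left_mono power_mono) auto
    finally have "hh s Z - hh s Y - g s Y \<bullet> (Z - Y) \<le> C * (1 + \<bar>K\<bar>)\<^sup>2 * (norm \<eta>)\<^sup>2"
      by (simp add: C_def power_mult_distrib mult.assoc)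
    moreover have "g s Y \<bullet> (Z - Y) = (Hx s Y + Hu s Y *\<^sub>R p) \<bullet> \<eta> + K * (Hp s Y \<bullet> \<eta>)"
      unfolding ZY by (simp add: inner_prod_def inner_add_left)
    ultimately show "H (x + \<eta>) s (v + p \<bullet> \<eta>) (p + K *\<^sub>R \<eta>) - H x s v p - (Hx s (x, v, p) + Hu s (x, v, p) *\<^sub>R p) \<bullet> \<eta>
        - K * (Hp s (x, v, p) \<bullet> \<eta>) \<le> C * (1 + \<bar>K\<bar>)\<^sup>2 * (norm \<eta>)\<^sup>2"
      by (simp add: Y_def Z_def)
  qed
qed

end

section \<open>Characteristics\<close>

text \<open>The projection that serves as truncation. It is 1-Lipschitz and fixes 0, hence never
  increases norms; for this reason linear growth bounds pass to the truncated field.\<close>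

lemma closest_point_cball_0:
  fixes x y :: "'b::euclidean_space"
  assumes "r \<ge> 0"
  shows "norm (closest_point (cball 0 r) x) \<le> r"
    and "norm (closest_point (cball 0 r) x) \<le> norm x"
    and "norm (closest_point (cball 0 r) x - closest_point (cball 0 r) y) \<le> norm (x - y)"
    and "norm x \<le> r \<Longrightarrow> closest_point (cball 0 r) x = x"
    and "continuous_on UNIV (closest_point (cball (0::'b) r))"
proof -
  show "norm (closest_point (cball 0 r) x) \<le> r"
    using closest_point_in_set[of "cball 0 r" x] assms by auto
  have l: "norm (closest_point (cball 0 r) x - closest_point (cball 0 r) y) \<le> norm (x - y)" for x y :: 'b
    using closest_point_lipschitz[of "cball 0 r" x y] assms by (auto simp: dist_norm)
  show "norm (closest_point (cball 0 r) x - closest_point (cball 0 r) y) \<le> norm (x - y)" by (rule l)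
  have "closest_point (cball 0 r) (0::'b) = 0" using assms by (intro closest_point_self) auto
  then show "norm (closest_point (cball 0 r) x) \<le> norm x" using l[of x 0] by simp
  show "norm x \<le> r \<Longrightarrow> closest_point (cball 0 r) x = x" by (intro closest_point_self) auto
  show "continuous_on UNIV (closest_point (cball (0::'b) r))"
    using assms by (intro continuous_on_closest_point) auto
qed

context hamiltonian begin

text \<open>The classical characteristic system of the equation. The dependence of \<open>H\<close>
  on the unknown adds the term with \<open>Hu\<close> to the equation of the slope.\<close>

definition field :: "real \<Rightarrow> 'a \<times> real \<times> 'a \<Rightarrow> 'a \<times> real \<times> 'a" where
  "field s Y = (Hp s Y, snd (snd Y) \<bullet> Hp s Y - hh s Y, - (Hx s Y + Hu s Y *\<^sub>R snd (snd Y)))"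

text \<open>The curves are C1 on the whole real line, so that the paraboloids along them are
  differentiable also at the end times; the characteristic system holds on \<open>{0..T}\<close>
  only. The radii belong to the predicate because all later constants depend on nothing else and are
  thus common to a family of characteristics.\<close>

definition characteristic where
  "characteristic RX RZ RP \<xi> z p \<xi>' z' p' \<longleftrightarrow>
     (\<forall>s. (\<xi> has_vector_derivative \<xi>' s) (at s)) \<and> continuous_on UNIV \<xi>' \<and>
     (\<forall>s. (z has_real_derivative z' s) (at s)) \<and> continuous_on UNIV z' \<and>
     (\<forall>s. (p has_vector_derivative p' s) (at s)) \<and> continuous_on UNIV p' \<and>
     (\<forall>s\<in>{0..T}. norm (\<xi> s) \<le> RX \<and> \<bar>z s\<bar> \<le> RZ \<and> norm (p s) \<le> RP \<and>
        (\<xi>' s, z' s, p' s) = field s (\<xi> s, z s, p s))"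

lemma field_continuous: "continuous_on ({0..T} \<times> UNIV) (\<lambda>w. field (fst w) (snd w))"
  unfolding field_def by (intro continuous_intros g_cont H_cont)

lemma g_bounded:
  obtains M where "M \<ge> 0" "\<And>s Y. s \<in> {0..T} \<Longrightarrow> Y \<in> cball 0 R \<Longrightarrow> norm (g s Y) \<le> M"
proof -
  have "compact ((\<lambda>w. g (fst w) (snd w)) ` ({0..T} \<times> cball 0 R))"
    by (intro compact_continuous_image compact_Times compact_Icc compact_cball
        continuous_on_subset[OF g_cont]) auto
  then have "bounded ((\<lambda>w. g (fst w) (snd w)) ` ({0..T} \<times> cball 0 R))" by (rule compact_imp_bounded)
  then obtain M where "M > 0" "\<And>s Y. s \<in> {0..T} \<Longrightarrow> Y \<in> cball 0 R \<Longrightarrow> norm (g s Y) \<le> M"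
    unfolding bounded_pos by force
  then show thesis using that[of M] by simp
qed

lemma field_lipschitz:
  obtains L where "\<And>s Y Z. s \<in> {0..T} \<Longrightarrow> Y \<in> cball 0 R \<Longrightarrow> Z \<in> cball 0 R \<Longrightarrow>
    norm (field s Y - field s Z) \<le> L * norm (Y - Z)"
proof -
  obtain L where L: "L \<ge> 0" "\<forall>s\<in>{0..T}. \<forall>Y\<in>cball 0 R. \<forall>Z\<in>cball 0 R. norm (g s Y - g s Z) \<le> L * norm (Y - Z)"
    using g_lip by blast
  obtain M where M: "M \<ge> 0" "\<And>s Y. s \<in> {0..T} \<Longrightarrow> Y \<in> cball 0 R \<Longrightarrow> norm (g s Y) \<le> M"
    using g_bounded by blast
  show thesis
  proof (rule that)
    fix s and Y Z :: "'a \<times> real \<times> 'a" assume s: "s \<in> {0..T}" and YZ: "Y \<in> cball 0 R" "Z \<in> cball (0::'a \<times> real \<times> 'a) R"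
    define d where "d = norm (Y - Z)"
    have d0: "d \<ge> 0" by (simp add: d_def)
    define p q where "p = snd (snd Y)" and "q = snd (snd Z)"
    have pq: "norm (p - q) \<le> d" and pR: "norm p \<le> \<bar>R\<bar>"
      using norm_triple_components(3)[of "Y - Z"] norm_triple_components(3)[of Y] YZ
      by (auto simp: p_def q_def d_def)
    have G: "norm (g s Y - g s Z) \<le> L * d" using L(2) s YZ by (simp add: d_def)
    have GM: "norm (g s Y) \<le> M" "norm (g s Z) \<le> M" using M(2) s YZ by auto
    note gc = order_trans[OF g_components(1) G] order_trans[OF g_components(2) G] order_trans[OF g_components(3) G]
      order_trans[OF g_components(5) GM(2)] order_trans[OF g_components(6) GM(2)]
    have hd: "\<bar>hh s Y - hh s Z\<bar> \<le> M * d"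
      unfolding d_def real_norm_def[symmetric]
    proof (rule differentiable_bound[where S = "cball 0 R" and f' = "\<lambda>X d. g s X \<bullet> d"])
      fix X :: "'a \<times> real \<times> 'a" assume X: "X \<in> cball 0 R"
      show "(hh s has_derivative (\<lambda>d. g s X \<bullet> d)) (at X within cball 0 R)"
        using g_deriv[OF s] has_derivative_at_withinI by blast
      have le: "norm (g s X) * norm d \<le> M * norm d" for d :: "'a \<times> real \<times> 'a"
        using M(2)[OF s X] by (rule mult_right_mono) simp
      show "onorm (\<lambda>d. g s X \<bullet> d) \<le> M"
        by (rule onorm_le) (use order_trans[OF Cauchy_Schwarz_ineq2 le] in simp)
    qed (use YZ in auto)
    have ph: "\<bar>p \<bullet> Hp s Y - q \<bullet> Hp s Z\<bar> \<le> \<bar>R\<bar> * (L * d) + d * M"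
    proof -
      have "p \<bullet> Hp s Y - q \<bullet> Hp s Z = p \<bullet> (Hp s Y - Hp s Z) + (p - q) \<bullet> Hp s Z"
        by (simp add: inner_diff)
      moreover have "\<bar>p \<bullet> (Hp s Y - Hp s Z)\<bar> \<le> \<bar>R\<bar> * (L * d)"
        using order_trans[OF Cauchy_Schwarz_ineq2 mult_mono[OF pR gc(3)]] by simp
      moreover have "\<bar>(p - q) \<bullet> Hp s Z\<bar> \<le> d * M"
        using order_trans[OF Cauchy_Schwarz_ineq2 mult_mono[OF pq gc(5)]] d0 by simp
      ultimately show ?thesis by linarith
    qed
    have up: "norm (Hu s Y *\<^sub>R p - Hu s Z *\<^sub>R q) \<le> (L * d) * \<bar>R\<bar> + M * d"
    proof -
      have "Hu s Y *\<^sub>R p - Hu s Z *\<^sub>R q = (Hu s Y - Hu s Z) *\<^sub>R p + Hu s Z *\<^sub>R (p - q)"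
        by (simp add: algebra_simps)
      moreover have "norm ((Hu s Y - Hu s Z) *\<^sub>R p) \<le> (L * d) * \<bar>R\<bar>"
        using mult_mono[OF gc(2) pR] L(1) d0 by simp
      moreover have "norm (Hu s Z *\<^sub>R (p - q)) \<le> M * d"
        using mult_mono[OF gc(4) pq] M(1) by simp
      ultimately show ?thesis by (metis add_mono norm_triangle_le)
    qed
    have eq: "field s Y - field s Z = (Hp s Y - Hp s Z, (p \<bullet> Hp s Y - q \<bullet> Hp s Z) - (hh s Y - hh s Z),
        - ((Hx s Y - Hx s Z) + (Hu s Y *\<^sub>R p - Hu s Z *\<^sub>R q)))"
      by (simp add: field_def p_def q_def algebra_simps)
    have "norm (field s Y - field s Z) \<le> norm (Hp s Y - Hp s Z) + (\<bar>(p \<bullet> Hp s Y - q \<bullet> Hp s Z) - (hh s Y - hh s Z)\<bar>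
       + norm ((Hx s Y - Hx s Z) + (Hu s Y *\<^sub>R p - Hu s Z *\<^sub>R q)))"
      unfolding eq by (rule order_trans[OF norm_triple_le]) (simp only: norm_minus_cancel order_refl)
    also have "\<dots> \<le> L * d + ((\<bar>R\<bar> * (L * d) + d * M + M * d) + (L * d + ((L * d) * \<bar>R\<bar> + M * d)))"
      by (intro add_mono norm_triangle_mono order_trans[OF abs_triangle_ineq4] gc ph up hd)
    also have "\<dots> = (2 * L + 2 * L * \<bar>R\<bar> + 3 * M) * norm (Y - Z)" by (simp add: d_def algebra_simps)
    finally show "norm (field s Y - field s Z) \<le> (2 * L + 2 * L * \<bar>R\<bar> + 3 * M) * norm (Y - Z)" .
  qed
qed

text \<open>The field is truncated to a box, which makes it bounded and Lipschitz; the growth bounds on the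
  derivatives of \<open>H\<close> survive truncation and show that the solution never leaves the box.\<close>

lemma characteristics_exist:
  assumes nn: "X0 \<ge> 0" "Z0 \<ge> 0" "P0 \<ge> 0"
  obtains RX RZ RP where "\<And>t0 x0 v0 p0. t0 \<in> {0..T} \<Longrightarrow> norm x0 \<le> X0 \<Longrightarrow> \<bar>v0\<bar> \<le> Z0 \<Longrightarrow> norm p0 \<le> P0 \<Longrightarrow>
    \<exists>\<xi> z p \<xi>' z' p'. characteristic RX RZ RP \<xi> z p \<xi>' z' p' \<and> \<xi> t0 = x0 \<and> z t0 = v0 \<and> p t0 = p0"
proof -
  define c where "c = C1 + K3"
  have c0: "c \<ge> 0" using C1_nn K3_nn by (simp add: c_def)
  \<comment> \<open>\<open>RX\<close> and \<open>RP\<close> are the Gronwall bounds over a time of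
    length at most \<open>T\<close> for speeds bounded by \<open>A2 * norm \<xi> + B2\<close> and by
    \<open>c * norm p + C1 * \<beta>\<close>.\<close>
  define RX where "RX = X0 * exp (A2 * T) + B2 * exp_int A2 T"
  define RP where "RP = P0 * exp (c * T) + C1 * \<beta> * exp_int c T"
  have R0: "RX \<ge> 0" "RP \<ge> 0"
    using nn T_pos B2_nn C1_nn \<beta>_nn by (auto simp: RX_def RP_def exp_int_nonneg)
  have "compact ((\<lambda>w. hh (fst w) (snd w)) ` ({0..T} \<times> (cball 0 RX \<times> {0} \<times> cball 0 RP)))"
    by (intro compact_continuous_image compact_Times compact_Icc compact_cball
        continuous_on_subset[OF H_cont]) auto
  then have "bounded ((\<lambda>w. hh (fst w) (snd w)) ` ({0..T} \<times> (cball 0 RX \<times> {0} \<times> cball 0 RP)))"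
    by (rule compact_imp_bounded)
  then obtain M0 where M0: "M0 > 0" "\<And>s x p. s \<in> {0..T} \<Longrightarrow> norm x \<le> RX \<Longrightarrow> norm p \<le> RP \<Longrightarrow> \<bar>H x s 0 p\<bar> \<le> M0"
    unfolding bounded_pos by force
  \<comment> \<open>The growth of \<open>z\<close> involves \<open>H\<close> at the value 0 and the
    product of slope and speed, so its bound can be fixed only after \<open>RX\<close> and
    \<open>RP\<close>.\<close>
  define BZ where "BZ = RP * (A2 * RX + B2) + M0"
  have BZ0: "BZ \<ge> 0" using R0 M0 A2_nn B2_nn by (simp add: BZ_def)
  define RZ where "RZ = Z0 * exp (K3 * T) + BZ * exp_int K3 T"
  have RZ0: "RZ \<ge> 0" using nn BZ0 T_pos by (simp add: RZ_def exp_int_nonneg)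
  \<comment> \<open>Clamping the time extends the field to all real times, as
    \<open>picard_global\<close> requires.\<close>
  define cl where "cl s = max 0 (min T s)" for s
  have cl: "cl s \<in> {0..T}" for s using T_pos by (auto simp: cl_def)
  have cl_id: "cl s = s" if "s \<in> {0..T}" for s using that by (auto simp: cl_def)
  define \<pi> where "\<pi> Y = (closest_point (cball 0 RX) (fst Y), closest_point (cball 0 RZ) (fst (snd Y)),
     closest_point (cball 0 RP) (snd (snd Y)))" for Y :: "'a \<times> real \<times> 'a"
  define R where "R = RX + (RZ + RP)"
  have \<pi>R: "\<pi> Y \<in> cball 0 R" for Y
  proof -
    have "norm (\<pi> Y) \<le> RX + (RZ + RP)"
      unfolding \<pi>_def
      by (rule order_trans[OF norm_triple_le])
         (use closest_point_cball_0(1)[OF R0(1), of "fst Y"] closest_point_cball_0(1)[OF RZ0, of "fst (snd Y)"]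
           closest_point_cball_0(1)[OF R0(2), of "snd (snd Y)"] in auto)
    then show ?thesis by (simp add: R_def)
  qed
  have \<pi>L: "norm (\<pi> Y - \<pi> Z) \<le> norm (Y - Z)" for Y Z
  proof -
    have "(norm (\<pi> Y - \<pi> Z))\<^sup>2 \<le> (norm (Y - Z))\<^sup>2"
      unfolding \<pi>_def norm_prod_def
      using power_mono[OF closest_point_cball_0(3)[OF R0(1), of "fst Y" "fst Z"] norm_ge_zero, of 2]
        power_mono[OF closest_point_cball_0(3)[OF R0(2), of "snd (snd Y)" "snd (snd Z)"] norm_ge_zero, of 2]
        power_mono[OF closest_point_cball_0(3)[OF RZ0, of "fst (snd Y)" "fst (snd Z)"] norm_ge_zero, of 2]
      by (simp add: add_mono power_mono)
    then show ?thesis by (rule power2_le_imp_le) simp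
  qed
  have \<pi>c: "continuous_on UNIV \<pi>"
    using \<pi>L by (intro lipschitz_on_continuous_on[of 1] lipschitz_onI) (auto simp: dist_norm)
  define F where "F s Y = field (cl s) (\<pi> Y)" for s Y
  have Fc: "continuous_on UNIV (\<lambda>w. F (fst w) (snd w))"
  proof -
    have "continuous_on UNIV (\<lambda>w::real \<times> ('a \<times> real \<times> 'a). (cl (fst w), \<pi> (snd w)))"
      unfolding cl_def by (intro continuous_intros continuous_on_compose2[OF \<pi>c]) auto
    moreover have "range (\<lambda>w::real \<times> ('a \<times> real \<times> 'a). (cl (fst w), \<pi> (snd w))) \<subseteq> {0..T} \<times> UNIV"
      using cl by blast
    ultimately have "continuous_on UNIV (\<lambda>w::real \<times> ('a \<times> real \<times> 'a).
        field (fst (cl (fst w), \<pi> (snd w))) (snd (cl (fst w), \<pi> (snd w))))"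
      by (rule continuous_on_compose2[OF field_continuous])
    then show ?thesis by (simp add: F_def)
  qed
  obtain L where L: "\<And>s Y Z. s \<in> {0..T} \<Longrightarrow> Y \<in> cball 0 R \<Longrightarrow> Z \<in> cball 0 R \<Longrightarrow>
    norm (field s Y - field s Z) \<le> L * norm (Y - Z)" using field_lipschitz by blast
  have FL: "norm (F s Y - F s Z) \<le> \<bar>L\<bar> * norm (Y - Z)" for s Y Z
  proof -
    have "norm (F s Y - F s Z) \<le> L * norm (\<pi> Y - \<pi> Z)" unfolding F_def using L[OF cl \<pi>R \<pi>R] .
    also have "\<dots> \<le> \<bar>L\<bar> * norm (Y - Z)" by (intro mult_mono \<pi>L) auto
    finally show ?thesis .
  qed
  have "compact ((\<lambda>w. field (fst w) (snd w)) ` ({0..T} \<times> cball 0 R))"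
    by (intro compact_continuous_image compact_Times compact_Icc compact_cball
        continuous_on_subset[OF field_continuous]) auto
  then have "bounded ((\<lambda>w. field (fst w) (snd w)) ` ({0..T} \<times> cball 0 R))" by (rule compact_imp_bounded)
  then obtain M where "\<And>s Y. s \<in> {0..T} \<Longrightarrow> Y \<in> cball 0 R \<Longrightarrow> norm (field s Y) \<le> M"
    unfolding bounded_iff by force
  then have FM: "norm (F s Y) \<le> M" for s Y unfolding F_def using cl \<pi>R by blast
  show thesis
  proof (rule that)
    fix t0 v0 and x0 p0 :: 'a assume t0: "t0 \<in> {0..T}" and i: "norm x0 \<le> X0" "\<bar>v0\<bar> \<le> Z0" "norm p0 \<le> P0"
    have "\<exists>Y. Y t0 = (x0, v0, p0) \<and> (\<forall>s. (Y has_vector_derivative F s (Y s)) (at s))"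
      using Fc by (intro picard_global[where L = "\<bar>L\<bar>" and M = M] FL FM) (simp add: case_prod_beta)
    then obtain Y where Y0: "Y t0 = (x0, v0, p0)" and Y: "\<And>s. (Y has_vector_derivative F s (Y s)) (at s)" by blast
    define \<xi> z p where "\<xi> s = fst (Y s)" and "z s = fst (snd (Y s))" and "p s = snd (snd (Y s))" for s
    define \<xi>' z' p' where "\<xi>' s = fst (F s (Y s))" and "z' s = fst (snd (F s (Y s)))" and "p' s = snd (snd (F s (Y s)))" for s
    have Yc: "continuous_on UNIV Y" using Y by (meson continuous_at_imp_continuous_on has_vector_derivative_continuous)
    have FYc: "continuous_on UNIV (\<lambda>s. F s (Y s))"
      using continuous_on_compose2[OF Fc continuous_on_Pair[OF continuous_on_id Yc]] by simp
    have d\<xi>: "(\<xi> has_vector_derivative \<xi>' s) (at s)" for s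
      using bounded_linear.has_vector_derivative[OF bounded_linear_fst Y[of s]] by (simp add: \<xi>_def[abs_def] \<xi>'_def)
    have d2: "((\<lambda>s. snd (Y s)) has_vector_derivative snd (F s (Y s))) (at s)" for s
      using bounded_linear.has_vector_derivative[OF bounded_linear_snd Y[of s]] by simp
    have dz: "(z has_vector_derivative z' s) (at s)" for s
      using bounded_linear.has_vector_derivative[OF bounded_linear_fst d2[of s]] by (simp add: z_def[abs_def] z'_def)
    have dp: "(p has_vector_derivative p' s) (at s)" for s
      using bounded_linear.has_vector_derivative[OF bounded_linear_snd d2[of s]] by (simp add: p_def[abs_def] p'_def)
    have st: "\<bar>s - t0\<bar> \<le> T" if "s \<in> {0..T}" for s using that t0 by auto
    have gb: "norm (X s) \<le> m * exp (A * T) + B * exp_int A T"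
      if X: "\<And>s. (X has_vector_derivative X' s) (at s)" "\<And>s. s \<in> {0..T} \<Longrightarrow> norm (X' s) \<le> A * norm (X s) + B"
        "A \<ge> 0" "B \<ge> 0" "norm (X t0) \<le> m" "s \<in> {0..T}"
      for X X' :: "real \<Rightarrow> 'c::real_inner" and A B m s
    proof -
      have "norm (X s) \<le> norm (X t0) * exp (A * \<bar>s - t0\<bar>) + B * exp_int A \<bar>s - t0\<bar>"
        by (rule gronwall[where a = 0 and b = T and X' = X']) (use X t0 in auto)
      also have "\<dots> \<le> m * exp (A * T) + B * exp_int A T"
        using X st[OF X(6)] order_trans[OF norm_ge_zero X(5)]
        by (intro add_mono mult_mono exp_int_mono exp_int_nonneg) (auto intro: mult_left_mono)
      finally show ?thesis .
    qed
    define Y' where "Y' s = \<pi> (Y s)" for s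
    have Y': "norm (fst (Y' s)) \<le> norm (\<xi> s)" "norm (fst (Y' s)) \<le> RX"
      "\<bar>fst (snd (Y' s))\<bar> \<le> \<bar>z s\<bar>"
      "norm (snd (snd (Y' s))) \<le> norm (p s)" "norm (snd (snd (Y' s))) \<le> RP" for s
      using closest_point_cball_0(1,2)[OF R0(1), of "fst (Y s)"] closest_point_cball_0(1,2)[OF RZ0, of "fst (snd (Y s))"]
        closest_point_cball_0(1,2)[OF R0(2), of "snd (snd (Y s))"]
      by (auto simp: Y'_def \<pi>_def \<xi>_def z_def p_def)
    have f': "\<xi>' s = Hp s (Y' s)" "z' s = snd (snd (Y' s)) \<bullet> Hp s (Y' s) - hh s (Y' s)"
      "p' s = - (Hx s (Y' s) + Hu s (Y' s) *\<^sub>R snd (snd (Y' s)))" if "s \<in> {0..T}" for s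
      by (auto simp: \<xi>'_def z'_def p'_def F_def cl_id[OF that] field_def Y'_def)
    have b\<xi>: "norm (\<xi> s) \<le> RX" if "s \<in> {0..T}" for s
      unfolding RX_def
    proof (rule gb[OF d\<xi>])
      fix s assume s: "s \<in> {0..T}"
      show "norm (\<xi>' s) \<le> A2 * norm (\<xi> s) + B2"
        using norm_Hp_le[OF s, of "Y' s"] mult_left_mono[OF Y'(1)[of s] A2_nn] by (simp add: f'[OF s])
    qed (use A2_nn B2_nn i that Y0 in \<open>auto simp: \<xi>_def\<close>)
    have bp: "norm (p s) \<le> RP" if "s \<in> {0..T}" for s
      unfolding RP_def
    proof (rule gb[OF dp])
      fix s assume s: "s \<in> {0..T}"
      have "norm (p' s) \<le> C1 * (\<beta> + norm (snd (snd (Y' s)))) + K3 * norm (snd (snd (Y' s)))"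
        unfolding f'[OF s] norm_minus_cancel
        using norm_Hx_le[OF s, of "Y' s"] mult_right_mono[OF abs_Hu_le[OF s, of "Y' s"], of "norm (snd (snd (Y' s)))"]
        by (intro norm_triangle_mono) auto
      also have "\<dots> = c * norm (snd (snd (Y' s))) + C1 * \<beta>" by (simp add: c_def algebra_simps)
      also have "\<dots> \<le> c * norm (p s) + C1 * \<beta>" using mult_left_mono[OF Y'(4)[of s] c0] by simp
      finally show "norm (p' s) \<le> c * norm (p s) + C1 * \<beta>" .
    qed (use c0 C1_nn \<beta>_nn i that Y0 in \<open>auto simp: p_def\<close>)
    have bz: "\<bar>z s\<bar> \<le> RZ" if "s \<in> {0..T}" for s
      unfolding RZ_def real_norm_def[symmetric]
    proof (rule gb[OF dz])
      fix s assume s: "s \<in> {0..T}"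
      have "\<bar>snd (snd (Y' s)) \<bullet> Hp s (Y' s)\<bar> \<le> norm (snd (snd (Y' s))) * norm (Hp s (Y' s))"
        by (rule Cauchy_Schwarz_ineq2)
      also have "\<dots> \<le> RP * (A2 * RX + B2)"
        using norm_Hp_le[OF s, of "Y' s"] mult_left_mono[OF Y'(2)[of s] A2_nn] Y'(5)[of s] R0 by (intro mult_mono) auto
      finally have 1: "\<bar>snd (snd (Y' s)) \<bullet> Hp s (Y' s)\<bar> \<le> RP * (A2 * RX + B2)" .
      have "\<bar>hh s (Y' s) - H (fst (Y' s)) s 0 (snd (snd (Y' s)))\<bar> \<le> K3 * \<bar>fst (snd (Y' s)) - 0\<bar>" by (rule H3[OF s])
      also have "\<dots> \<le> K3 * \<bar>z s\<bar>" using mult_left_mono[OF Y'(3)[of s] K3_nn] by simp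
      finally have "\<bar>hh s (Y' s)\<bar> \<le> K3 * \<bar>z s\<bar> + M0" using M0(2)[OF s Y'(2)[of s] Y'(5)[of s]] by linarith
      with 1 show "norm (z' s) \<le> K3 * norm (z s) + BZ" unfolding f'(2)[OF s] BZ_def by simp
    qed (use K3_nn BZ0 i that Y0 in \<open>auto simp: z_def\<close>)
    have YY: "Y' s = (\<xi> s, z s, p s)" if "s \<in> {0..T}" for s
      using b\<xi>[OF that] bp[OF that] bz[OF that] R0 RZ0
      by (auto simp: Y'_def \<pi>_def \<xi>_def z_def p_def closest_point_cball_0(4))
    have "characteristic RX RZ RP \<xi> z p \<xi>' z' p'"
      unfolding characteristic_def
    proof (intro conjI allI ballI)
      fix s assume s: "s \<in> {0..T}"
      show "(\<xi>' s, z' s, p' s) = field s (\<xi> s, z s, p s)"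
        using f'[OF s] unfolding YY[OF s] by (simp add: field_def)
    qed (use d\<xi> dz dp FYc b\<xi> bz bp in \<open>auto simp: has_real_derivative_iff_has_vector_derivative
        \<xi>'_def z'_def p'_def intro!: continuous_on_fst continuous_on_snd\<close>)
    then show "\<exists>\<xi> z p \<xi>' z' p'. characteristic RX RZ RP \<xi> z p \<xi>' z' p' \<and> \<xi> t0 = x0 \<and> z t0 = v0 \<and> p t0 = p0"
      using Y0 by (intro exI[of _ \<xi>] exI[of _ z] exI[of _ p] exI[of _ \<xi>'] exI[of _ z'] exI[of _ p'])
        (simp add: \<xi>_def z_def p_def)
  qed
qed

end

section \<open>Propagation along characteristics\<close>

lemma C1_on_uminus: "C1_on f S \<Longrightarrow> C1_on (\<lambda>w. - f w) S"
  unfolding C1_on_def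
proof (elim exE conjE)
  fix D :: "'a \<Rightarrow> 'a \<Rightarrow>\<^sub>L real" assume D: "continuous_on S D"
    "\<forall>z\<in>S. (f has_derivative blinfun_apply (D z)) (at z within S)"
  have "continuous_on S (\<lambda>z. - D z)" using D(1) by (rule continuous_on_minus)
  moreover have "\<forall>z\<in>S. ((\<lambda>w. - f w) has_derivative blinfun_apply (- D z)) (at z within S)"
    using D(2) has_derivative_minus[of f] by (auto simp: uminus_blinfun.rep_eq)
  ultimately show "\<exists>D. continuous_on S D \<and> (\<forall>z\<in>S. ((\<lambda>w. - f w) has_derivative blinfun_apply (D z)) (at z within S))"
    by blast
qed

context hamiltonian begin

text \<open>The expression is the residual of the equation for a paraboloid of constant curvature
  \<open>K\<close>, with the Hamiltonian taken at the affine value. By the characteristic system its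
  terms of order zero and one in \<open>\<eta>\<close> cancel, and the second-order remainder of
  \<open>expansion_along_paraboloid\<close> is left.\<close>

lemma characteristic_expansion:
  obtains C where "C \<ge> 0"
    "\<And>\<xi> z p \<xi>' z' p' s \<eta> K. characteristic RX RZ RP \<xi> z p \<xi>' z' p' \<Longrightarrow> s \<in> {0..T} \<Longrightarrow> norm \<eta> \<le> 1 \<Longrightarrow>
      - (C * (1 + \<bar>K\<bar>) * (norm \<eta>)\<^sup>2) \<le> z' s + p' s \<bullet> \<eta> - p s \<bullet> \<xi>' s - K * (\<eta> \<bullet> \<xi>' s)
         + H (\<xi> s + \<eta>) s (z s + p s \<bullet> \<eta>) (p s + K *\<^sub>R \<eta>)"
    "\<And>\<xi> z p \<xi>' z' p' s \<eta> K. characteristic RX RZ RP \<xi> z p \<xi>' z' p' \<Longrightarrow> s \<in> {0..T} \<Longrightarrow> norm \<eta> \<le> 1 \<Longrightarrow>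
      \<bar>K\<bar> * norm \<eta> \<le> 1 \<Longrightarrow> z' s + p' s \<bullet> \<eta> - p s \<bullet> \<xi>' s - K * (\<eta> \<bullet> \<xi>' s)
         + H (\<xi> s + \<eta>) s (z s + p s \<bullet> \<eta>) (p s + K *\<^sub>R \<eta>) \<le> C * (1 + \<bar>K\<bar>)\<^sup>2 * (norm \<eta>)\<^sup>2"
proof -
  obtain C where C: "C \<ge> 0"
    "\<And>s x v p \<eta> K. s \<in> {0..T} \<Longrightarrow> norm x \<le> RX \<Longrightarrow> \<bar>v\<bar> \<le> RZ \<Longrightarrow> norm p \<le> RP \<Longrightarrow> norm \<eta> \<le> 1 \<Longrightarrow>
      H (x + \<eta>) s (v + p \<bullet> \<eta>) (p + K *\<^sub>R \<eta>) - H x s v p - (Hx s (x, v, p) + Hu s (x, v, p) *\<^sub>R p) \<bullet> \<eta>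
        - K * (Hp s (x, v, p) \<bullet> \<eta>) \<ge> - (C * (1 + \<bar>K\<bar>) * (norm \<eta>)\<^sup>2)"
    "\<And>s x v p \<eta> K. s \<in> {0..T} \<Longrightarrow> norm x \<le> RX \<Longrightarrow> \<bar>v\<bar> \<le> RZ \<Longrightarrow> norm p \<le> RP \<Longrightarrow> norm \<eta> \<le> 1 \<Longrightarrow> \<bar>K\<bar> * norm \<eta> \<le> 1 \<Longrightarrow>
      H (x + \<eta>) s (v + p \<bullet> \<eta>) (p + K *\<^sub>R \<eta>) - H x s v p - (Hx s (x, v, p) + Hu s (x, v, p) *\<^sub>R p) \<bullet> \<eta>
        - K * (Hp s (x, v, p) \<bullet> \<eta>) \<le> C * (1 + \<bar>K\<bar>)\<^sup>2 * (norm \<eta>)\<^sup>2"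
    using expansion_along_paraboloid[of RX RZ RP] by metis
  have eq: "z' s + p' s \<bullet> \<eta> - p s \<bullet> \<xi>' s - K * (\<eta> \<bullet> \<xi>' s) + H (\<xi> s + \<eta>) s (z s + p s \<bullet> \<eta>) (p s + K *\<^sub>R \<eta>)
     = H (\<xi> s + \<eta>) s (z s + p s \<bullet> \<eta>) (p s + K *\<^sub>R \<eta>) - H (\<xi> s) s (z s) (p s)
       - (Hx s (\<xi> s, z s, p s) + Hu s (\<xi> s, z s, p s) *\<^sub>R p s) \<bullet> \<eta> - K * (Hp s (\<xi> s, z s, p s) \<bullet> \<eta>)"
    if "characteristic RX RZ RP \<xi> z p \<xi>' z' p'" "s \<in> {0..T}" for \<xi> z p \<xi>' z' p' s \<eta> K
    using that by (auto simp: characteristic_def field_def inner_diff_left inner_add_left inner_commute[of \<eta>])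
  show thesis
  proof (rule that[OF C(1)])
    fix \<xi> z p \<xi>' z' p' s \<eta> K
    assume c: "characteristic RX RZ RP \<xi> z p \<xi>' z' p'" and s: "s \<in> {0..T}" and e: "norm (\<eta>::'a) \<le> 1"
    have b: "norm (\<xi> s) \<le> RX" "\<bar>z s\<bar> \<le> RZ" "norm (p s) \<le> RP" using c s by (auto simp: characteristic_def)
    show "- (C * (1 + \<bar>K\<bar>) * (norm \<eta>)\<^sup>2) \<le> z' s + p' s \<bullet> \<eta> - p s \<bullet> \<xi>' s - K * (\<eta> \<bullet> \<xi>' s)
         + H (\<xi> s + \<eta>) s (z s + p s \<bullet> \<eta>) (p s + K *\<^sub>R \<eta>)"
      unfolding eq[OF c s] by (rule C(2)[OF s b e])
    show "z' s + p' s \<bullet> \<eta> - p s \<bullet> \<xi>' s - K * (\<eta> \<bullet> \<xi>' s)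
         + H (\<xi> s + \<eta>) s (z s + p s \<bullet> \<eta>) (p s + K *\<^sub>R \<eta>) \<le> C * (1 + \<bar>K\<bar>)\<^sup>2 * (norm \<eta>)\<^sup>2" if "\<bar>K\<bar> * norm \<eta> \<le> 1"
      unfolding eq[OF c s] by (rule C(3)[OF s b e that])
  qed
qed

lemma characteristicD:
  assumes "characteristic RX RZ RP \<xi> z p \<xi>' z' p'"
  shows "\<And>s. (\<xi> has_vector_derivative \<xi>' s) (at s)" "continuous_on UNIV \<xi>'"
    "\<And>s. (z has_real_derivative z' s) (at s)" "continuous_on UNIV z'"
    "\<And>s. (p has_vector_derivative p' s) (at s)" "continuous_on UNIV p'"
    "\<And>s. s \<in> {0..T} \<Longrightarrow> norm (\<xi> s) \<le> RX" "\<And>s. s \<in> {0..T} \<Longrightarrow> \<bar>z s\<bar> \<le> RZ" "\<And>s. s \<in> {0..T} \<Longrightarrow> norm (p s) \<le> RP"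
    "continuous_on UNIV \<xi>" "continuous_on UNIV z" "continuous_on UNIV p"
  using assms unfolding characteristic_def
  by (auto intro!: continuous_at_imp_continuous_on intro: has_vector_derivative_continuous DERIV_isCont)

end

section \<open>Forward characteristics and the Barron-Jensen inequality\<close>

locale hj_solution = hamiltonian +
  fixes u0 :: "'a \<Rightarrow> real" and u :: "'a \<Rightarrow> real \<Rightarrow> real"
  assumes visc: "viscosity_solution H u0 T u"
begin

lemma u_init: "u x 0 = u0 x"
  using visc by (simp add: viscosity_solution_def)

lemma u_cont: "continuous_on (UNIV \<times> {0..<T}) (\<lambda>w. u (fst w) (snd w))"
  using visc by (simp add: viscosity_solution_def case_prod_beta)

lemma u_subsolution: "visc_sub T H u"
  unfolding visc_sub_def
proof (intro allI impI)
  fix \<phi> :: "'a \<times> real \<Rightarrow> real" and x t q \<tau>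
  assume "C1_on \<phi> (UNIV \<times> {0<..<T})" "t \<in> {0<..<T}" "(\<phi> has_derivative (\<lambda>v. (q, \<tau>) \<bullet> v)) (at (x, t))"
    "local_max_within (\<lambda>w. u (fst w) (snd w) - \<phi> w) (UNIV \<times> {0<..<T}) (x, t)"
  then show "\<tau> + H x t (u x t) q \<le> 0"
    using visc[unfolded viscosity_solution_def, THEN conjunct2, THEN conjunct2, rule_format,
        where \<phi> = "\<lambda>y s. \<phi> (y, s)" and x = x and t = t and q = q and \<tau> = \<tau>]
    by (simp add: case_prod_unfold inner_prod_def)
qed

lemma u_supersolution: "visc_sub T (\<lambda>x t v q. - H x t (- v) (- q)) (\<lambda>x t. - u x t)"
  unfolding visc_sub_def
proof (intro allI impI)
  fix \<phi> :: "'a \<times> real \<Rightarrow> real" and x t q \<tau>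
  assume A: "C1_on \<phi> (UNIV \<times> {0<..<T})" "t \<in> {0<..<T}" "(\<phi> has_derivative (\<lambda>v. (q, \<tau>) \<bullet> v)) (at (x, t))"
    "local_max_within (\<lambda>w. - u (fst w) (snd w) - \<phi> w) (UNIV \<times> {0<..<T}) (x, t)"
  have "local_min_within (\<lambda>w. u (fst w) (snd w) - - \<phi> w) (UNIV \<times> {0<..<T}) (x, t)"
    using A(4) unfolding local_min_within_def local_max_within_def by force
  then show "\<tau> + - H x t (- (- u x t)) (- q) \<le> 0"
    using visc[unfolded viscosity_solution_def, THEN conjunct2, THEN conjunct2, rule_format,
        where \<phi> = "\<lambda>y s. - \<phi> (y, s)" and x = x and t = t and q = "- q" and \<tau> = "- \<tau>"]
      C1_on_uminus[OF A(1)] A(2) has_derivative_minus[OF A(3)]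
    by (simp add: case_prod_unfold inner_prod_def)
qed

lemma tube_bound:
  assumes "continuous_on UNIV \<xi>" "0 \<le> a" "b < T"
  obtains N where "N \<ge> 0" "\<And>s \<eta>. s \<in> {a..b} \<Longrightarrow> norm \<eta> \<le> 1 \<Longrightarrow> \<bar>u (\<xi> s + \<eta>) s\<bar> \<le> N"
proof -
  have c: "continuous_on ({a..b} \<times> cball 0 1) (\<lambda>w. (\<xi> (fst w) + snd w, fst w))"
    by (intro continuous_intros continuous_on_compose2[OF assms(1)]) auto
  have "compact ((\<lambda>w. u (\<xi> (fst w) + snd w) (fst w)) ` ({a..b} \<times> cball 0 1))"
  proof (rule compact_continuous_image[OF _ compact_Times[OF compact_Icc compact_cball]])
    have "(\<lambda>w. (\<xi> (fst w) + snd w, fst w)) ` ({a..b} \<times> cball 0 1) \<subseteq> UNIV \<times> {0..<T}"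
      using assms(2,3) by auto
    from continuous_on_compose2[OF u_cont c this]
    show "continuous_on ({a..b} \<times> cball 0 1) (\<lambda>w. u (\<xi> (fst w) + snd w) (fst w))" by simp
  qed
  then have "bounded ((\<lambda>w. u (\<xi> (fst w) + snd w) (fst w)) ` ({a..b} \<times> cball 0 1))" by (rule compact_imp_bounded)
  then obtain N where N: "N > 0" "\<And>s \<eta>. s \<in> {a..b} \<Longrightarrow> norm \<eta> \<le> 1 \<Longrightarrow> \<bar>u (\<xi> s + \<eta>) s\<bar> \<le> N"
    unfolding bounded_pos by force
  show thesis by (rule that[of N]) (use N in auto)
qed

lemma u_slice_cont: "s \<in> {0..<T} \<Longrightarrow> continuous_on UNIV (\<lambda>y. u y s)"
proof -
  assume "s \<in> {0..<T}"
  then have "(\<lambda>y. (y, s)) ` UNIV \<subseteq> UNIV \<times> {0..<T}" by auto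
  from continuous_on_compose2[OF u_cont continuous_on_Pair[OF continuous_on_id continuous_on_const] this]
  show ?thesis by simp
qed

text \<open>By continuity, at time \<open>t0\<close> a very steep paraboloid raised by
  \<open>\<sigma>\<close> lies above \<open>u\<close> on the unit ball, whatever the slope
  \<open>p t0\<close>. Its required curvature blows up as \<open>\<sigma>\<close> tends to 0, but on
  the axis the curvature does not count and only \<open>\<sigma>\<close> remains.\<close>

lemma below_characteristic:
  assumes ch: "characteristic RX RZ RP \<xi> z p \<xi>' z' p'" and t0: "t0 \<in> {0<..<T}" and z0: "z t0 = u (\<xi> t0) t0"
    and s: "s \<in> {t0..<T}"
  shows "u (\<xi> s) s \<le> z s"
proof -
  note c = characteristicD[OF ch]
  obtain C where C0: "C \<ge> 0" and C: "\<And>s \<eta> K. s \<in> {0..T} \<Longrightarrow> norm \<eta> \<le> 1 \<Longrightarrow>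
      - (C * (1 + \<bar>K\<bar>) * (norm \<eta>)\<^sup>2) \<le> z' s + p' s \<bullet> \<eta> - p s \<bullet> \<xi>' s - K * (\<eta> \<bullet> \<xi>' s)
         + H (\<xi> s + \<eta>) s (z s + p s \<bullet> \<eta>) (p s + K *\<^sub>R \<eta>)"
    using characteristic_expansion[of RX RZ RP] ch by metis
  define b where "b = (s + T) / 2"
  have b: "t0 < b" "b < T" "s < b" using s t0 by (auto simp: b_def)
  obtain N where N: "N \<ge> 0" "\<And>s \<eta>. s \<in> {t0..b} \<Longrightarrow> norm \<eta> \<le> 1 \<Longrightarrow> \<bar>u (\<xi> s + \<eta>) s\<bar> \<le> N"
    using tube_bound[OF c(10), of t0 b] t0 b by auto
  \<comment> \<open>Makes \<open>(l * k - K3 * k) / 2\<close> equal to \<open>2 * C * k\<close>,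
    which dominates the expansion error \<open>C * (1 + k)\<close> as soon as
    \<open>k \<ge> 1\<close>.\<close>
  define l where "l = 4 * C + K3"
  have l0: "l \<ge> 0" using C0 K3_nn by (simp add: l_def)
  have R0: "RZ \<ge> 0" "RP \<ge> 0" using c(8,9)[of 0] T_pos norm_ge_zero[of "p 0"] by (auto simp del: norm_ge_zero)
  have lowz: "N \<le> z s + p s \<bullet> \<eta> + (N + RZ + RP)" if "s \<in> {0..T}" "norm \<eta> \<le> 1" for s \<eta>
  proof -
    have "\<bar>p s \<bullet> \<eta>\<bar> \<le> norm (p s) * norm \<eta>" by (rule Cauchy_Schwarz_ineq2)
    also have "\<dots> \<le> RP * 1" using c(9)[OF that(1)] that(2) R0 by (intro mult_mono) auto
    finally show ?thesis using c(8)[OF that(1)] by linarith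
  qed
  have main: "u (\<xi> s) s \<le> z s + \<sigma> * exp (K3 * (s - t0))" if "\<sigma> > 0" for \<sigma>
  proof -
    have "isCont (\<lambda>y. u y t0) (\<xi> t0)"
      using u_slice_cont[of t0] t0 by (auto simp: continuous_on_eq_continuous_at)
    then have "isCont (\<lambda>y. u y t0 - p t0 \<bullet> (y - \<xi> t0)) (\<xi> t0)" by (intro continuous_intros)
    then obtain r0 where r0: "r0 > 0"
      "\<And>y. dist y (\<xi> t0) < r0 \<Longrightarrow> dist (u y t0 - p t0 \<bullet> (y - \<xi> t0)) (u (\<xi> t0) t0 - p t0 \<bullet> (\<xi> t0 - \<xi> t0)) < \<sigma>"
      unfolding continuous_at_eps_delta using \<open>\<sigma> > 0\<close> by blast
    define r where "r = min r0 1"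
    have r: "r > 0" "r \<le> 1" using r0 by (auto simp: r_def)
    have near: "u (\<xi> t0 + \<eta>) t0 \<le> z t0 + p t0 \<bullet> \<eta> + \<sigma>" if "norm \<eta> < r" for \<eta>
      using r0(2)[of "\<xi> t0 + \<eta>"] that by (auto simp: r_def dist_norm z0)
    \<comment> \<open>Beyond distance \<open>r\<close> the quadratic term makes up for the bound
      \<open>N\<close> on \<open>u\<close> and for the size of the affine part. Since
      \<open>r \<le> 1\<close>, this also settles the lateral boundary.\<close>
    define k0 where "k0 = max 1 (2 * (N + RZ + RP) / r\<^sup>2)"
    have k0: "k0 \<ge> 1" by (simp add: k0_def)
    have far: "N + RZ + RP \<le> k0 * d\<^sup>2 / 2" if "d \<ge> r" for d
    proof -
      have "2 * (N + RZ + RP) / r\<^sup>2 * r\<^sup>2 \<le> k0 * d\<^sup>2"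
        using that r k0 by (intro mult_mono power_mono) (auto simp: k0_def)
      then show ?thesis using r by simp
    qed
    define k where "k s = k0 * exp (l * (s - t0))" for s
    have kk: "k s \<ge> k0" if "s \<ge> t0" for s
      using that l0 k0 mult_left_mono[of 1 "exp (l * (s - t0))" k0] by (simp add: k_def)
    have "u (\<xi> s + 0) s \<le> z s + p s \<bullet> 0 + k s * (norm (0::'a))\<^sup>2 / 2 + \<sigma> * exp (K3 * (s - t0))"
    proof (rule paraboloid_comparison[where f = u and G = H and K = K3 and \<rho> = 1 and a = t0 and b = b and T = T
          and \<xi>' = \<xi>' and p' = p' and z' = z' and k' = "\<lambda>s. l * k s" and \<theta>' = "\<lambda>s. K3 * (\<sigma> * exp (K3 * (s - t0)))"])
      show "continuous_on (UNIV \<times> {t0..b}) (\<lambda>w. u (fst w) (snd w))"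
        by (rule continuous_on_subset[OF u_cont]) (use t0 b in auto)
      show "(k has_real_derivative l * k s) (at s)" for s
        unfolding k_def by (auto intro!: derivative_eq_intros)
      show "((\<lambda>s. \<sigma> * exp (K3 * (s - t0))) has_real_derivative K3 * (\<sigma> * exp (K3 * (s - t0)))) (at s)" for s
        by (auto intro!: derivative_eq_intros)
      show "continuous_on UNIV (\<lambda>s. l * k s)" unfolding k_def by (intro continuous_intros)
      show "continuous_on UNIV (\<lambda>s. K3 * (\<sigma> * exp (K3 * (s - t0))))" by (intro continuous_intros)
      show "K3 * \<bar>\<sigma> * exp (K3 * (s - t0))\<bar> \<le> K3 * (\<sigma> * exp (K3 * (s - t0)))" for s
        using \<open>\<sigma> > 0\<close> by simp
      show "0 \<le> k s" if "s \<in> {t0..b}" for s using kk[of s] k0 that by simp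
    next
      fix s and \<eta> :: 'a assume s: "s \<in> {t0<..<b}" and e: "norm \<eta> < 1"
      have k1: "k s \<ge> 1" using kk[of s] s k0 by simp
      have "C * (1 + \<bar>k s\<bar>) * (norm \<eta>)\<^sup>2 \<le> C * (2 * k s) * (norm \<eta>)\<^sup>2"
        using k1 C0 by (intro mult_right_mono mult_left_mono) auto
      moreover have "(l * k s - K3 * k s) * (norm \<eta>)\<^sup>2 / 2 = C * (2 * k s) * (norm \<eta>)\<^sup>2"
        by (simp add: l_def algebra_simps)
      ultimately show "0 \<le> z' s + p' s \<bullet> \<eta> - p s \<bullet> \<xi>' s - k s * (\<eta> \<bullet> \<xi>' s) + (l * k s - K3 * k s) * (norm \<eta>)\<^sup>2 / 2
          + H (\<xi> s + \<eta>) s (z s + p s \<bullet> \<eta>) (p s + k s *\<^sub>R \<eta>)"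
        using C[of s \<eta> "k s"] s e t0 b by auto
    next
      fix \<eta> :: 'a assume e: "norm \<eta> \<le> 1"
      show "u (\<xi> t0 + \<eta>) t0 \<le> z t0 + p t0 \<bullet> \<eta> + k t0 * (norm \<eta>)\<^sup>2 / 2 + \<sigma> * exp (K3 * (t0 - t0))"
      proof (cases "norm \<eta> < r")
        case True
        have "0 \<le> k0 * (norm \<eta>)\<^sup>2 / 2" using k0 by simp
        then show ?thesis using near[OF True] by (simp add: k_def)
      next
        case False
        then show ?thesis
          using far[of "norm \<eta>"] N(2)[of t0 \<eta>] lowz[of t0 \<eta>] e b t0 \<open>\<sigma> > 0\<close> by (simp add: k_def)
      qed
    next
      fix s and \<eta> :: 'a assume s: "s \<in> {t0..b}" and e: "norm \<eta> = 1"
      have "k0 \<le> k s" using kk s by simp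
      moreover have "0 \<le> \<sigma> * exp (K3 * (s - t0))" using \<open>\<sigma> > 0\<close> by simp
      ultimately show "u (\<xi> s + \<eta>) s \<le> z s + p s \<bullet> \<eta> + k s * 1\<^sup>2 / 2 + \<sigma> * exp (K3 * (s - t0))"
        using far[of 1] r N(2)[OF s, of \<eta>] lowz[of s \<eta>] e s b t0 by simp
    qed (use b t0 s K3_nn u_subsolution H3 c in auto)
    then show ?thesis by simp
  qed
  show ?thesis
  proof (rule field_le_epsilon)
    fix e :: real assume "e > 0"
    then show "u (\<xi> s) s \<le> z s + e"
      using main[of "e * exp (- (K3 * (s - t0)))"] by (simp add: mult.assoc flip: exp_add)
  qed
qed

text \<open>On the forward characteristic starting at the contact point with slope \<open>q\<close>, \<open>\<phi>\<close> lies below \<open>u\<close> and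
  \<open>u\<close> lies below \<open>z\<close>; the claim compares their derivatives at the contact time.\<close>

lemma barron_jensen:
  assumes t0: "t0 \<in> {0<..<T}" and \<phi>: "(\<phi> has_derivative (\<lambda>v. (q, \<tau>) \<bullet> v)) (at (x0, t0))"
    and mn: "local_min_within (\<lambda>w. u (fst w) (snd w) - \<phi> w) (UNIV \<times> {0<..<T}) (x0, t0)"
  shows "\<tau> + H x0 t0 (u x0 t0) q \<le> 0"
proof -
  obtain RX RZ RP where "\<And>t x v p. t \<in> {0..T} \<Longrightarrow> norm x \<le> norm x0 \<Longrightarrow> \<bar>v\<bar> \<le> \<bar>u x0 t0\<bar> \<Longrightarrow> norm p \<le> norm q \<Longrightarrow>
      \<exists>\<xi> z p' \<xi>' z' p''. characteristic RX RZ RP \<xi> z p' \<xi>' z' p'' \<and> \<xi> t = x \<and> z t = v \<and> p' t = p"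
    using characteristics_exist[OF norm_ge_zero[of x0] abs_ge_zero[of "u x0 t0"] norm_ge_zero[of q]] by blast
  from this[of t0 x0 "u x0 t0" q] t0
  obtain \<xi> z p \<xi>' z' p' where ch: "characteristic RX RZ RP \<xi> z p \<xi>' z' p'"
    and i: "\<xi> t0 = x0" "z t0 = u x0 t0" "p t0 = q" by auto
  note c = characteristicD[OF ch]
  have "(\<xi>' t0, z' t0, p' t0) = field t0 (\<xi> t0, z t0, p t0)" using ch t0 by (auto simp: characteristic_def)
  then have z': "z' t0 = q \<bullet> \<xi>' t0 - H x0 t0 (u x0 t0) q" by (simp add: field_def i)
  obtain e where e: "e > 0" "\<And>w. w \<in> ball (x0, t0) e \<inter> UNIV \<times> {0<..<T} \<Longrightarrow> u x0 t0 - \<phi> (x0, t0) \<le> u (fst w) (snd w) - \<phi> w"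
    using mn unfolding local_min_within_def fst_conv snd_conv by blast
  define d where "d s = z s - \<phi> (\<xi> s, s)" for s
  have "((\<lambda>s. (\<xi> s, s)) has_derivative (\<lambda>r. (r *\<^sub>R \<xi>' t0, r))) (at t0)"
    using c(1)[of t0] by (auto simp: has_vector_derivative_def intro!: derivative_eq_intros)
  from has_derivative_compose[OF this, of \<phi> "\<lambda>v. (q, \<tau>) \<bullet> v"] \<phi>
  have "((\<lambda>s. \<phi> (\<xi> s, s)) has_derivative (\<lambda>r. (q, \<tau>) \<bullet> (r *\<^sub>R \<xi>' t0, r))) (at t0)"
    by (simp add: i)
  then have "((\<lambda>s. \<phi> (\<xi> s, s)) has_real_derivative (q \<bullet> \<xi>' t0 + \<tau>)) (at t0)"
    unfolding has_field_derivative_def by (rule has_derivative_eq_rhs) (auto simp: inner_prod_def algebra_simps)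
  \<comment> \<open>By the equation for \<open>z\<close> this derivative is
    \<open>- (\<tau> + H x0 t0 (u x0 t0) q)\<close>, so the claim is that it is nonnegative.\<close>
  then have dd: "(d has_real_derivative (z' t0 - (q \<bullet> \<xi>' t0 + \<tau>))) (at t0)"
    unfolding d_def using c(3) by (auto intro!: derivative_intros)
  have "isCont (\<lambda>s. (\<xi> s, s)) t0"
    using c(10) by (intro continuous_intros) (auto simp: continuous_on_eq_continuous_at)
  then obtain r where r: "r > 0" "\<And>s. dist s t0 < r \<Longrightarrow> dist (\<xi> s, s) (\<xi> t0, t0) < e"
    unfolding continuous_at_eps_delta using e(1) by blast
  have up: "d t0 \<le> d s" if "t0 < s" "s < T" "s < t0 + r" for s
  proof -
    have "(\<xi> s, s) \<in> ball (x0, t0) e \<inter> UNIV \<times> {0<..<T}"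
      using r(2)[of s] that t0 by (auto simp: i dist_commute dist_real_def)
    from e(2)[OF this] have "u x0 t0 - \<phi> (x0, t0) \<le> u (\<xi> s) s - \<phi> (\<xi> s, s)" by simp
    moreover have "u (\<xi> s) s \<le> z s"
      by (rule below_characteristic[OF ch t0]) (use i that in auto)
    ultimately show ?thesis by (simp add: d_def i)
  qed
  have "z' t0 - (q \<bullet> \<xi>' t0 + \<tau>) \<ge> 0"
  proof (rule ccontr)
    assume "\<not> ?thesis"
    then obtain h where h: "h > 0" "\<And>k. 0 < k \<Longrightarrow> k < h \<Longrightarrow> d t0 > d (t0 + k)"
      using DERIV_neg_dec_right[OF dd] by force
    define k where "k = min (h / 2) (min (r / 2) ((T - t0) / 2))"
    have "0 < k" "k < h" "k < r" "t0 + k < T" using h(1) r(1) t0 by (auto simp: k_def min_def field_simps)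
    then show False using h(2)[of k] up[of "t0 + k"] by auto
  qed
  then show ?thesis by (simp add: z')
qed

text \<open>Negation and time reversal each change the sign of the time derivative and so cancel,
  while the slope changes sign once. What has to be shown is therefore \<open>barron_jensen\<close>
  at \<open>(x, T - t)\<close> with slope \<open>- q\<close>.\<close>

lemma u_reversed_subsolution: "visc_sub T (\<lambda>x t v q. H x (T - t) (- v) (- q)) (\<lambda>x t. - u x (T - t))"
  unfolding visc_sub_def
proof (intro allI impI)
  fix \<phi> :: "'a \<times> real \<Rightarrow> real" and x t q \<tau>
  assume t: "t \<in> {0<..<T}" and d: "(\<phi> has_derivative (\<lambda>v. (q, \<tau>) \<bullet> v)) (at (x, t))"
    and m: "local_max_within (\<lambda>w. - u (fst w) (T - snd w) - \<phi> w) (UNIV \<times> {0<..<T}) (x, t)"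
  have "((\<lambda>w::'a \<times> real. (fst w, T - snd w)) has_derivative (\<lambda>v. (fst v, - snd v))) (at (x, T - t))"
    by (auto intro!: derivative_eq_intros)
  from has_derivative_minus[OF has_derivative_compose[OF this, of \<phi> "\<lambda>v. (q, \<tau>) \<bullet> v"]] d
  have "((\<lambda>w. - \<phi> (fst w, T - snd w)) has_derivative (\<lambda>v. (- q, \<tau>) \<bullet> v)) (at (x, T - t))"
    by (simp add: inner_prod_def)
  moreover have "local_min_within (\<lambda>w. u (fst w) (snd w) - - \<phi> (fst w, T - snd w)) (UNIV \<times> {0<..<T}) (x, T - t)"
  proof -
    obtain e where e: "e > 0" "\<And>w. w \<in> ball (x, t) e \<inter> UNIV \<times> {0<..<T} \<Longrightarrow>
        - u (fst w) (T - snd w) - \<phi> w \<le> - u x (T - t) - \<phi> (x, t)"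
      using m unfolding local_max_within_def fst_conv snd_conv by blast
    have "u x (T - t) - - \<phi> (x, T - (T - t)) \<le> u (fst w) (snd w) - - \<phi> (fst w, T - snd w)"
      if "w \<in> ball (x, T - t) e \<inter> UNIV \<times> {0<..<T}" for w
    proof -
      have "dist (x, t) (fst w, T - snd w) = dist (x, T - t) w"
        by (cases w) (simp add: dist_prod_def dist_real_def abs_minus_commute algebra_simps)
      then have "(fst w, T - snd w) \<in> ball (x, t) e \<inter> UNIV \<times> {0<..<T}" using that by auto
      from e(2)[OF this] show ?thesis by simp
    qed
    then show ?thesis unfolding local_min_within_def using t e(1) by auto
  qed
  ultimately show "\<tau> + H x (T - t) (- (- u x (T - t))) (- q) \<le> 0"
    using barron_jensen[of "T - t" "\<lambda>w. - \<phi> (fst w, T - snd w)" "- q" \<tau> x] t by simp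
qed

end

section \<open>Persistence of contact down to time 0\<close>

context hj_solution begin

text \<open>The reversed Hamiltonian is again convex in the slope, so the error linear in the
  curvature is the relevant one. The curvature grows at most exponentially and stays bounded by one
  \<open>Km\<close> on all of \<open>{0..t0}\<close>.\<close>

lemma paraboloid_below_backward:
  assumes ch: "characteristic RX RZ RP \<xi> z p \<xi>' z' p'" and t0: "t0 \<in> {0<..<T}"
    and \<rho>: "0 < \<rho>" "\<rho> \<le> 1"
    and low: "\<And>\<eta>. norm \<eta> \<le> \<rho> \<Longrightarrow> z t0 + p t0 \<bullet> \<eta> - K0 * (norm \<eta>)\<^sup>2 / 2 \<le> u (\<xi> t0 + \<eta>) t0"
  obtains Km where "Km \<ge> 1"
    "\<And>s \<eta>. s \<in> {0..t0} \<Longrightarrow> norm \<eta> \<le> \<rho> \<Longrightarrow> z s + p s \<bullet> \<eta> - Km * (norm \<eta>)\<^sup>2 / 2 \<le> u (\<xi> s + \<eta>) s"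
proof -
  note c = characteristicD[OF ch]
  obtain C where C0: "C \<ge> 0" and C: "\<And>s \<eta> K. s \<in> {0..T} \<Longrightarrow> norm \<eta> \<le> 1 \<Longrightarrow>
      - (C * (1 + \<bar>K\<bar>) * (norm \<eta>)\<^sup>2) \<le> z' s + p' s \<bullet> \<eta> - p s \<bullet> \<xi>' s - K * (\<eta> \<bullet> \<xi>' s)
         + H (\<xi> s + \<eta>) s (z s + p s \<bullet> \<eta>) (p s + K *\<^sub>R \<eta>)"
    using characteristic_expansion[of RX RZ RP] ch by metis
  obtain N where N: "N \<ge> 0" "\<And>s \<eta>. s \<in> {0..t0} \<Longrightarrow> norm \<eta> \<le> 1 \<Longrightarrow> \<bar>u (\<xi> s + \<eta>) s\<bar> \<le> N"
    using tube_bound[OF c(10), of 0 t0] t0 by auto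
  define l where "l = 4 * C + K3"
  have l0: "l \<ge> 0" using C0 K3_nn by (simp add: l_def)
  \<comment> \<open>At least \<open>K0\<close> for the comparison at \<open>t0\<close>, and so large
    that on the lateral boundary the paraboloid falls below \<open>- N\<close>, hence below
    \<open>u\<close>.\<close>
  define k0 where "k0 = max (max 1 K0) (2 * (N + RZ + RP) / \<rho>\<^sup>2)"
  have k0: "k0 \<ge> 1" "k0 \<ge> K0" "2 * (N + RZ + RP) / \<rho>\<^sup>2 \<le> k0" by (simp_all add: k0_def)
  \<comment> \<open>The reversed clock starts at \<open>a\<close>, which is the time
    \<open>t0\<close>, and ends at \<open>T\<close>, which is the time 0.\<close>
  define a where "a = T - t0"
  define k where "k s = k0 * exp (l * (s - a))" for s
  have kk: "k s \<ge> k0" if "s \<ge> a" for s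
    using that l0 k0 mult_left_mono[of 1 "exp (l * (s - a))" k0] by (simp add: k_def)
  have k_le: "k s \<le> k0 * exp (l * t0)" if "s \<le> T" for s
    using that l0 k0 by (auto simp: k_def a_def intro!: mult_left_mono)
  have cmp: "- u (\<xi> (T - s) + \<eta>) (T - s) \<le> - z (T - s) + (- p (T - s)) \<bullet> \<eta> + k s * (norm \<eta>)\<^sup>2 / 2 + 0"
    if "s \<in> {a..T}" "norm \<eta> \<le> \<rho>" for s \<eta>
  proof (rule paraboloid_comparison[where f = "\<lambda>x t. - u x (T - t)" and G = "\<lambda>x t v q. H x (T - t) (- v) (- q)"
        and K = K3 and \<rho> = \<rho> and a = a and b = T and T = T and \<xi> = "\<lambda>s. \<xi> (T - s)" and \<xi>' = "\<lambda>s. - \<xi>' (T - s)"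
        and z = "\<lambda>s. - z (T - s)" and z' = "\<lambda>s. z' (T - s)" and p = "\<lambda>s. - p (T - s)" and p' = "\<lambda>s. p' (T - s)"
        and k' = "\<lambda>s. l * k s" and \<theta> = "\<lambda>s. 0" and \<theta>' = "\<lambda>s. 0"])
    show "continuous_on (UNIV \<times> {a..T}) (\<lambda>w. - u (fst w) (T - snd w))"
    proof -
      have "continuous_on (UNIV \<times> {a..T}) (\<lambda>w::'a \<times> real. (fst w, T - snd w))" by (intro continuous_intros)
      moreover have "(\<lambda>w::'a \<times> real. (fst w, T - snd w)) ` (UNIV \<times> {a..T}) \<subseteq> UNIV \<times> {0..<T}"
        using t0 by (auto simp: a_def)
      ultimately show ?thesis
        using continuous_on_compose2[OF u_cont, of _ "\<lambda>w. (fst w, T - snd w)"] by (auto intro: continuous_on_minus)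
    qed
    have refl: "((\<lambda>s. - X (T - s)) has_vector_derivative X' (T - s)) (at s)"
      if "\<And>s. (X has_vector_derivative X' s) (at s)" for X X' :: "real \<Rightarrow> 'c::real_normed_vector" and s
      using has_vector_derivative_minus[OF has_vector_derivative_reflect[OF that]] by simp
    show "((\<lambda>s. \<xi> (T - s)) has_vector_derivative - \<xi>' (T - s)) (at s)" for s
      by (rule has_vector_derivative_reflect[OF c(1)])
    show "((\<lambda>s. - p (T - s)) has_vector_derivative p' (T - s)) (at s)" for s
      by (rule refl[OF c(5)])
    show "((\<lambda>s. - z (T - s)) has_real_derivative z' (T - s)) (at s)" for s
      using refl[of z z'] c(3) by (simp add: has_real_derivative_iff_has_vector_derivative)
    have cr: "continuous_on UNIV (\<lambda>s. X (T - s))" if "continuous_on UNIV X" for X :: "real \<Rightarrow> 'c::topological_space"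
      by (rule continuous_on_compose2[OF that]) (auto intro!: continuous_intros)
    show "continuous_on UNIV (\<lambda>s. - \<xi>' (T - s))" "continuous_on UNIV (\<lambda>s. p' (T - s))" "continuous_on UNIV (\<lambda>s. z' (T - s))"
      by (intro continuous_intros cr c)+
    show "(k has_real_derivative l * k s) (at s)" for s
      unfolding k_def by (auto intro!: derivative_eq_intros)
    show "continuous_on UNIV (\<lambda>s. l * k s)" unfolding k_def by (intro continuous_intros)
    show "0 \<le> k s" if "s \<in> {a..T}" for s using kk[of s] k0 that by simp
    show "\<bar>H x (T - t) (- v) (- q) - H x (T - t) (- w) (- q)\<bar> \<le> K3 * \<bar>v - w\<bar>" if "t \<in> {0<..<T}" for x t v w q
      using H3[of "T - t" x "- v" "- q" "- w"] that by (auto simp: abs_minus_commute)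
  next
    fix s and \<eta> :: 'a assume s: "s \<in> {a<..<T}" and e: "norm \<eta> < \<rho>"
    have k1: "k s \<ge> 1" using kk[of s] s k0 by simp
    have "C * (1 + \<bar>- k s\<bar>) * (norm \<eta>)\<^sup>2 \<le> C * (2 * k s) * (norm \<eta>)\<^sup>2"
      using k1 C0 by (intro mult_right_mono mult_left_mono) auto
    moreover have "(l * k s - K3 * k s) * (norm \<eta>)\<^sup>2 / 2 = C * (2 * k s) * (norm \<eta>)\<^sup>2"
      by (simp add: l_def algebra_simps)
    moreover have "- (C * (1 + \<bar>- k s\<bar>) * (norm \<eta>)\<^sup>2) \<le> z' (T - s) + p' (T - s) \<bullet> \<eta> - p (T - s) \<bullet> \<xi>' (T - s)
        - (- k s) * (\<eta> \<bullet> \<xi>' (T - s)) + H (\<xi> (T - s) + \<eta>) (T - s) (z (T - s) + p (T - s) \<bullet> \<eta>) (p (T - s) + (- k s) *\<^sub>R \<eta>)"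
      using s e \<rho> t0 by (intro C) (auto simp: a_def)
    ultimately show "0 \<le> z' (T - s) + p' (T - s) \<bullet> \<eta> - (- p (T - s)) \<bullet> (- \<xi>' (T - s)) - k s * (\<eta> \<bullet> (- \<xi>' (T - s)))
        + (l * k s - K3 * k s) * (norm \<eta>)\<^sup>2 / 2
        + H (\<xi> (T - s) + \<eta>) (T - s) (- (- z (T - s) + (- p (T - s)) \<bullet> \<eta>)) (- (- p (T - s) + k s *\<^sub>R \<eta>))"
    proof -
      have "- (- z (T - s) + (- p (T - s)) \<bullet> \<eta>) = z (T - s) + p (T - s) \<bullet> \<eta>"
        "- (- p (T - s) + k s *\<^sub>R \<eta>) = p (T - s) + (- k s) *\<^sub>R \<eta>"
        "(- p (T - s)) \<bullet> (- \<xi>' (T - s)) = p (T - s) \<bullet> \<xi>' (T - s)"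
        "k s * (\<eta> \<bullet> (- \<xi>' (T - s))) = (- k s) * (\<eta> \<bullet> \<xi>' (T - s))" by simp_all
      note eqs = this
      assume "C * (1 + \<bar>- k s\<bar>) * (norm \<eta>)\<^sup>2 \<le> C * (2 * k s) * (norm \<eta>)\<^sup>2"
        "(l * k s - K3 * k s) * (norm \<eta>)\<^sup>2 / 2 = C * (2 * k s) * (norm \<eta>)\<^sup>2"
        "- (C * (1 + \<bar>- k s\<bar>) * (norm \<eta>)\<^sup>2) \<le> z' (T - s) + p' (T - s) \<bullet> \<eta> - p (T - s) \<bullet> \<xi>' (T - s)
        - (- k s) * (\<eta> \<bullet> \<xi>' (T - s)) + H (\<xi> (T - s) + \<eta>) (T - s) (z (T - s) + p (T - s) \<bullet> \<eta>) (p (T - s) + (- k s) *\<^sub>R \<eta>)"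
      then show ?thesis unfolding eqs by linarith
    qed
  next
    fix \<eta> :: 'a assume e: "norm \<eta> \<le> \<rho>"
    have "K0 * (norm \<eta>)\<^sup>2 / 2 \<le> k0 * (norm \<eta>)\<^sup>2 / 2" using k0 by (intro divide_right_mono mult_right_mono) auto
    then show "- u (\<xi> (T - a) + \<eta>) (T - a) \<le> - z (T - a) + (- p (T - a)) \<bullet> \<eta> + k a * (norm \<eta>)\<^sup>2 / 2 + 0"
      using low[OF e] by (simp add: a_def k_def)
  next
    fix s and \<eta> :: 'a assume s: "s \<in> {a..T}" and e: "norm \<eta> = \<rho>"
    have st: "T - s \<in> {0..t0}" "T - s \<in> {0..T}" using s t0 by (auto simp: a_def)
    have "p (T - s) \<bullet> \<eta> \<le> norm (p (T - s)) * norm \<eta>" by (rule norm_cauchy_schwarz)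
    also have "\<dots> \<le> RP * 1" using c(9)[OF st(2)] e \<rho> order_trans[OF norm_ge_zero c(9)[OF st(2)]] by (intro mult_mono) auto
    finally have 1: "p (T - s) \<bullet> \<eta> \<le> RP" by simp
    have "2 * (N + RZ + RP) / \<rho>\<^sup>2 * \<rho>\<^sup>2 \<le> k s * \<rho>\<^sup>2"
      using k0(3) kk[of s] s by (intro mult_right_mono) auto
    then have "N + RZ + RP \<le> k s * \<rho>\<^sup>2 / 2" using \<rho> by simp
    with 1 show "- u (\<xi> (T - s) + \<eta>) (T - s) \<le> - z (T - s) + (- p (T - s)) \<bullet> \<eta> + k s * \<rho>\<^sup>2 / 2 + 0"
      using N(2)[OF st(1), of \<eta>] c(8)[OF st(2)] e \<rho> by simp
  qed (use t0 K3_nn \<rho> u_reversed_subsolution that in \<open>auto simp: a_def\<close>)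
  show thesis
  proof (rule that)
    show "1 \<le> k0 * exp (l * t0)" using kk[of T] k_le[of T] k0 t0 by (simp add: a_def)
    fix s and \<eta> :: 'a assume s: "s \<in> {0..t0}" and e: "norm \<eta> \<le> \<rho>"
    have "k (T - s) * (norm \<eta>)\<^sup>2 / 2 \<le> k0 * exp (l * t0) * (norm \<eta>)\<^sup>2 / 2"
      using k_le[of "T - s"] s by (intro divide_right_mono mult_right_mono) auto
    moreover have "- u (\<xi> s + \<eta>) s \<le> - z s + (- p s) \<bullet> \<eta> + k (T - s) * (norm \<eta>)\<^sup>2 / 2"
      using cmp[of "T - s" \<eta>] s e t0 by (simp add: a_def)
    ultimately show "z s + p s \<bullet> \<eta> - k0 * exp (l * t0) * (norm \<eta>)\<^sup>2 / 2 \<le> u (\<xi> s + \<eta>) s" by simp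
  qed
qed

text \<open>A strict gap at \<open>s1\<close> is transported forward by the supersolution property.
  The transported paraboloid has curvature at least \<open>2 * Km\<close> instead of
  \<open>Km\<close>: the spare amount turns the given bound \<open>low\<close> into a strict one
  away from the axis, where the gap at the centre says nothing. As \<open>Km\<close> does not depend
  on the time, neither does the step length.\<close>

lemma touching_step:
  assumes ch: "characteristic RX RZ RP \<xi> z p \<xi>' z' p'" and t0: "t0 \<in> {0<..<T}"
    and \<rho>: "0 < \<rho>" "\<rho> \<le> 1" and Km: "Km \<ge> 1"
    and low: "\<And>s \<eta>. s \<in> {0..t0} \<Longrightarrow> norm \<eta> \<le> \<rho> \<Longrightarrow> z s + p s \<bullet> \<eta> - Km * (norm \<eta>)\<^sup>2 / 2 \<le> u (\<xi> s + \<eta>) s"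
  obtains \<delta> where "\<delta> > 0" "\<And>s1 s2. 0 \<le> s1 \<Longrightarrow> s1 < s2 \<Longrightarrow> s2 \<le> t0 \<Longrightarrow> s2 - s1 \<le> \<delta> \<Longrightarrow> u (\<xi> s2) s2 = z s2 \<Longrightarrow> u (\<xi> s1) s1 = z s1"
proof -
  note c = characteristicD[OF ch]
  obtain C where C0: "C \<ge> 0" and C: "\<And>s \<eta> K. s \<in> {0..T} \<Longrightarrow> norm \<eta> \<le> 1 \<Longrightarrow> \<bar>K\<bar> * norm \<eta> \<le> 1 \<Longrightarrow>
      z' s + p' s \<bullet> \<eta> - p s \<bullet> \<xi>' s - K * (\<eta> \<bullet> \<xi>' s)
         + H (\<xi> s + \<eta>) s (z s + p s \<bullet> \<eta>) (p s + K *\<^sub>R \<eta>) \<le> C * (1 + \<bar>K\<bar>)\<^sup>2 * (norm \<eta>)\<^sup>2"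
    using characteristic_expansion[of RX RZ RP] ch by metis
  \<comment> \<open>For every curvature \<open>k\<close> up to \<open>3 * Km\<close> this ensures
    \<open>C * (1 + k)\<^sup>2 \<le> (\<kappa> - K3 * k) / 2\<close>. The step length
    \<open>Km / \<kappa>\<close> is the time in which a curvature growing at rate
    \<open>\<kappa>\<close> rises from \<open>2 * Km\<close> to \<open>3 * Km\<close>.\<close>
  define \<kappa> where "\<kappa> = 2 * C * (1 + 3 * Km)\<^sup>2 + 3 * K3 * Km + 1"
  have \<kappa>0: "\<kappa> > 0" using C0 K3_nn Km by (simp add: \<kappa>_def add_nonneg_pos)
  \<comment> \<open>Keeps curvature times radius at most 1, as the upper expansion bound
    demands.\<close>
  define \<rho>' where "\<rho>' = min \<rho> (1 / (3 * Km))"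
  have \<rho>': "\<rho>' > 0" "\<rho>' \<le> \<rho>" "3 * Km * \<rho>' \<le> 1"
    using \<rho> Km by (auto simp: \<rho>'_def min_def field_simps)
  show thesis
  proof (rule that)
    show "Km / \<kappa> > 0" using Km \<kappa>0 by simp
    fix s1 s2 assume s: "0 \<le> s1" "s1 < s2" "s2 \<le> t0" "s2 - s1 \<le> Km / \<kappa>" and z2: "u (\<xi> s2) s2 = z s2"
    show "u (\<xi> s1) s1 = z s1"
    proof (rule ccontr)
      assume "u (\<xi> s1) s1 \<noteq> z s1"
      moreover have "z s1 \<le> u (\<xi> s1) s1" using low[of s1 0] s \<rho> by simp
      ultimately have gt: "z s1 < u (\<xi> s1) s1" by simp
      define e where "e = (u (\<xi> s1) s1 - z s1) / 2"
      have e0: "e > 0" using gt by (simp add: e_def)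
      have "isCont (\<lambda>y. u y s1) (\<xi> s1)"
        using u_slice_cont[of s1] s t0 by (auto simp: continuous_on_eq_continuous_at)
      then have "isCont (\<lambda>y. u y s1 - p s1 \<bullet> (y - \<xi> s1)) (\<xi> s1)" by (intro continuous_intros)
      then obtain r where r: "r > 0"
        "\<And>y. dist y (\<xi> s1) < r \<Longrightarrow> dist (u y s1 - p s1 \<bullet> (y - \<xi> s1)) (u (\<xi> s1) s1 - p s1 \<bullet> (\<xi> s1 - \<xi> s1)) < e"
        unfolding continuous_at_eps_delta using e0 by blast
      have near: "z s1 + p s1 \<bullet> \<eta> + e \<le> u (\<xi> s1 + \<eta>) s1" if "norm \<eta> < r" for \<eta>
      proof -
        have "\<bar>u (\<xi> s1 + \<eta>) s1 - p s1 \<bullet> \<eta> - u (\<xi> s1) s1\<bar> < e"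
          using r(2)[of "\<xi> s1 + \<eta>"] that by (simp add: dist_norm)
        moreover have "u (\<xi> s1) s1 = z s1 + 2 * e" by (simp add: e_def field_simps)
        ultimately show ?thesis by linarith
      qed
      \<comment> \<open>The three bounds serve the points near the axis, the points at distance at
        least \<open>r\<close> at time \<open>s1\<close>, and the lateral boundary; the last two use
        the spare curvature.\<close>
      define m where "m = min e (min (Km * r\<^sup>2 / 2) (Km * \<rho>'\<^sup>2 / 2))"
      have m: "m > 0" "m \<le> e" "m \<le> Km * r\<^sup>2 / 2" "m \<le> Km * \<rho>'\<^sup>2 / 2"
        using e0 Km r \<rho>' by (auto simp: m_def)
      define k where "k s = 2 * Km + \<kappa> * (s - s1)" for s
      have k: "2 * Km \<le> k s" "k s \<le> 3 * Km" if "s \<in> {s1..s2}" for s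
      proof -
        show "2 * Km \<le> k s" using that \<kappa>0 by (simp add: k_def)
        have "\<kappa> * (s - s1) \<le> \<kappa> * (Km / \<kappa>)" using that s \<kappa>0 by (intro mult_left_mono) auto
        then show "k s \<le> 3 * Km" using \<kappa>0 by (simp add: k_def)
      qed
      \<comment> \<open>Only the axis matters in the end: linear and quadratic terms vanish there,
        and the offset, though decaying, is still strictly negative at \<open>s2\<close>.\<close>
      have "- u (\<xi> s2 + 0) s2 \<le> - z s2 + (- p s2) \<bullet> 0 + k s2 * (norm (0::'a))\<^sup>2 / 2 + - m * exp (- K3 * (s2 - s1))"
      proof (rule paraboloid_comparison[where f = "\<lambda>x t. - u x t" and G = "\<lambda>x t v q. - H x t (- v) (- q)"
            and K = K3 and \<rho> = \<rho>' and a = s1 and b = s2 and T = T and \<xi> = \<xi> and \<xi>' = \<xi>' and z = "\<lambda>s. - z s" and z' = "\<lambda>s. - z' s"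
            and p = "\<lambda>s. - p s" and p' = "\<lambda>s. - p' s" and k' = "\<lambda>s. \<kappa>" and \<theta> = "\<lambda>s. - m * exp (- K3 * (s - s1))"
            and \<theta>' = "\<lambda>s. K3 * (m * exp (- K3 * (s - s1)))"])
        show "continuous_on (UNIV \<times> {s1..s2}) (\<lambda>w. - u (fst w) (snd w))"
          by (intro continuous_on_minus continuous_on_subset[OF u_cont]) (use s t0 in auto)
        show "((\<lambda>s. - p s) has_vector_derivative - p' s) (at s)" for s
          by (rule has_vector_derivative_minus[OF c(5)])
        show "((\<lambda>s. - z s) has_real_derivative - z' s) (at s)" for s by (rule DERIV_minus[OF c(3)])
        show "(k has_real_derivative \<kappa>) (at s)" for s unfolding k_def by (auto intro!: derivative_eq_intros)
        show "((\<lambda>s. - m * exp (- K3 * (s - s1))) has_real_derivative K3 * (m * exp (- K3 * (s - s1)))) (at s)" for s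
          by (auto intro!: derivative_eq_intros)
        show "continuous_on UNIV (\<lambda>s. K3 * (m * exp (- K3 * (s - s1))))" by (intro continuous_intros)
        show "K3 * \<bar>- m * exp (- K3 * (s - s1))\<bar> \<le> K3 * (m * exp (- K3 * (s - s1)))" for s
          using m by (simp add: abs_mult)
        show "0 \<le> k s" if "s \<in> {s1..s2}" for s using k(1)[OF that] Km by simp
        show "\<bar>- H x t (- v) (- q) - - H x t (- w) (- q)\<bar> \<le> K3 * \<bar>v - w\<bar>" if "t \<in> {0<..<T}" for x t v w q
          using H3[of t x "- v" "- q" "- w"] that by (auto simp: abs_minus_commute)
      next
        fix r and \<eta> :: 'a assume r: "r \<in> {s1<..<s2}" and e: "norm \<eta> < \<rho>'"
        have eqs: "- (- z r + - p r \<bullet> \<eta>) = z r + p r \<bullet> \<eta>" "- (- p r + k r *\<^sub>R \<eta>) = p r + (- k r) *\<^sub>R \<eta>"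
          by simp_all
        have kr: "2 * Km \<le> k r" "k r \<le> 3 * Km" using k[of r] r by auto
        have "\<bar>- k r\<bar> * norm \<eta> \<le> (3 * Km) * \<rho>'" using kr Km e by (intro mult_mono) auto
        then have "z' r + p' r \<bullet> \<eta> - p r \<bullet> \<xi>' r - (- k r) * (\<eta> \<bullet> \<xi>' r)
             + H (\<xi> r + \<eta>) r (z r + p r \<bullet> \<eta>) (p r + (- k r) *\<^sub>R \<eta>) \<le> C * (1 + \<bar>- k r\<bar>)\<^sup>2 * (norm \<eta>)\<^sup>2"
          using r e \<rho> \<rho>' s t0 by (intro C) auto
        moreover have "C * (1 + \<bar>- k r\<bar>)\<^sup>2 * (norm \<eta>)\<^sup>2 \<le> (\<kappa> - K3 * k r) * (norm \<eta>)\<^sup>2 / 2"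
        proof -
          have "C * (1 + \<bar>- k r\<bar>)\<^sup>2 \<le> C * (1 + 3 * Km)\<^sup>2"
            using kr Km C0 by (intro mult_left_mono power_mono) auto
          moreover have "K3 * k r \<le> K3 * (3 * Km)" using kr K3_nn by (intro mult_left_mono) auto
          ultimately have "C * (1 + \<bar>- k r\<bar>)\<^sup>2 \<le> (\<kappa> - K3 * k r) / 2" by (simp add: \<kappa>_def)
          from mult_right_mono[OF this, of "(norm \<eta>)\<^sup>2"] show ?thesis by simp
        qed
        ultimately show "0 \<le> - z' r + - p' r \<bullet> \<eta> - - p r \<bullet> \<xi>' r - k r * (\<eta> \<bullet> \<xi>' r) + (\<kappa> - K3 * k r) * (norm \<eta>)\<^sup>2 / 2
            + - H (\<xi> r + \<eta>) r (- (- z r + - p r \<bullet> \<eta>)) (- (- p r + k r *\<^sub>R \<eta>))"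
          unfolding eqs by simp
      next
        fix \<eta> :: 'a assume e: "norm \<eta> \<le> \<rho>'"
        have "z s1 + p s1 \<bullet> \<eta> - k s1 * (norm \<eta>)\<^sup>2 / 2 + m \<le> u (\<xi> s1 + \<eta>) s1"
        proof (cases "norm \<eta> < r")
          case True
          have "0 \<le> k s1 * (norm \<eta>)\<^sup>2 / 2" using Km by (simp add: k_def)
          then show ?thesis using near[OF True] m by linarith
        next
          case False
          have "Km * r\<^sup>2 \<le> Km * (norm \<eta>)\<^sup>2" using False r Km by (intro mult_left_mono power_mono) auto
          moreover have "k s1 * (norm \<eta>)\<^sup>2 / 2 = Km * (norm \<eta>)\<^sup>2" by (simp add: k_def)
          moreover have "z s1 + p s1 \<bullet> \<eta> - Km * (norm \<eta>)\<^sup>2 / 2 \<le> u (\<xi> s1 + \<eta>) s1"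
            using low[of s1 \<eta>] s e \<rho>' by simp
          ultimately show ?thesis using m(3) by linarith
        qed
        then show "- u (\<xi> s1 + \<eta>) s1 \<le> - z s1 + - p s1 \<bullet> \<eta> + k s1 * (norm \<eta>)\<^sup>2 / 2 + - m * exp (- K3 * (s1 - s1))"
          by simp
      next
        fix s and \<eta> :: 'a assume r: "s \<in> {s1..s2}" and e: "norm \<eta> = \<rho>'"
        have "m * exp (- K3 * (s - s1)) \<le> m * 1" using m K3_nn r by (intro mult_left_mono) auto
        moreover have "2 * Km * \<rho>'\<^sup>2 \<le> k s * \<rho>'\<^sup>2" using k(1)[OF r] by (rule mult_right_mono) simp
        moreover have "z s + p s \<bullet> \<eta> - Km * \<rho>'\<^sup>2 / 2 \<le> u (\<xi> s + \<eta>) s" using low[of s \<eta>] r s e \<rho>' by simp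
        ultimately show "- u (\<xi> s + \<eta>) s \<le> - z s + - p s \<bullet> \<eta> + k s * \<rho>'\<^sup>2 / 2 + - m * exp (- K3 * (s - s1))"
          using m(4) by simp
      qed (use s t0 K3_nn \<rho>' u_supersolution c in \<open>auto intro: continuous_on_minus\<close>)
      moreover have "m * exp (- K3 * (s2 - s1)) > 0" using m by simp
      ultimately show False using z2 by simp
    qed
  qed
qed

text \<open>The step length is the same at all times, so finitely many steps lead from
  \<open>t0\<close> to 0; the maximum with 0 shortens the last one.\<close>

lemma touching:
  assumes ch: "characteristic RX RZ RP \<xi> z p \<xi>' z' p'" and t0: "t0 \<in> {0<..<T}" and z0: "z t0 = u (\<xi> t0) t0"
    and \<rho>: "0 < \<rho>" "\<rho> \<le> 1" and Km: "Km \<ge> 1"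
    and low: "\<And>s \<eta>. s \<in> {0..t0} \<Longrightarrow> norm \<eta> \<le> \<rho> \<Longrightarrow> z s + p s \<bullet> \<eta> - Km * (norm \<eta>)\<^sup>2 / 2 \<le> u (\<xi> s + \<eta>) s"
  shows "u (\<xi> 0) 0 = z 0"
proof -
  obtain \<delta> where \<delta>: "\<delta> > 0" "\<And>s1 s2. 0 \<le> s1 \<Longrightarrow> s1 < s2 \<Longrightarrow> s2 \<le> t0 \<Longrightarrow> s2 - s1 \<le> \<delta> \<Longrightarrow> u (\<xi> s2) s2 = z s2 \<Longrightarrow> u (\<xi> s1) s1 = z s1"
    using touching_step[OF ch t0 \<rho> Km low] by metis
  have ind: "u (\<xi> (max 0 (t0 - real n * \<delta>))) (max 0 (t0 - real n * \<delta>)) = z (max 0 (t0 - real n * \<delta>))" for n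
  proof (induction n)
    case 0
    then show ?case using z0 t0 by simp
  next
    case (Suc n)
    show ?case
    proof (cases "t0 - real n * \<delta> \<le> 0")
      case True
      then have "t0 - real (Suc n) * \<delta> \<le> 0" using \<delta>(1) by (simp add: algebra_simps)
      then show ?thesis using Suc True by (simp add: max_def split: if_splits)
    next
      case False
      have "real n * \<delta> \<ge> 0" using \<delta>(1) by simp
      then show ?thesis
        by (intro \<delta>(2)[OF _ _ _ _ Suc]) (use False \<delta>(1) in \<open>auto simp: max_def algebra_simps\<close>)
    qed
  qed
  obtain n where "t0 < real n * \<delta>" using reals_Archimedean3[OF \<delta>(1)] by blast
  then show ?thesis using ind[of n] by (simp add: max_def split: if_splits)
qed

text \<open>Once contact has reached time 0, the paraboloid at that time is itself a smooth test
  function touching \<open>u0\<close> from below at the foot.\<close>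

lemma proximal_subgradient_propagates:
  assumes ch: "characteristic RX RZ RP \<xi> z p \<xi>' z' p'" and t0: "t0 \<in> {0<..<T}" and z0: "z t0 = u (\<xi> t0) t0"
    and \<rho>: "0 < \<rho>" "\<rho> \<le> 1"
    and low: "\<And>\<eta>. norm \<eta> \<le> \<rho> \<Longrightarrow> z t0 + p t0 \<bullet> \<eta> - K0 * (norm \<eta>)\<^sup>2 / 2 \<le> u (\<xi> t0 + \<eta>) t0"
  shows "p 0 \<in> subdiff u0 UNIV (\<xi> 0)"
proof -
  obtain Km where Km: "Km \<ge> 1"
    "\<And>s \<eta>. s \<in> {0..t0} \<Longrightarrow> norm \<eta> \<le> \<rho> \<Longrightarrow> z s + p s \<bullet> \<eta> - Km * (norm \<eta>)\<^sup>2 / 2 \<le> u (\<xi> s + \<eta>) s"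
    using paraboloid_below_backward[OF ch t0 \<rho> low] by metis
  have z00: "u0 (\<xi> 0) = z 0" using touching[OF ch t0 z0 \<rho> Km] by (simp add: u_init)
  define \<phi> where "\<phi> y = p 0 \<bullet> (y - \<xi> 0) - Km * ((y - \<xi> 0) \<bullet> (y - \<xi> 0)) / 2" for y
  have d: "(\<phi> has_derivative (\<lambda>v. (p 0 - Km *\<^sub>R (y - \<xi> 0)) \<bullet> v)) (at y)" for y
    unfolding \<phi>_def
    by (rule has_derivative_eq_rhs, (rule derivative_intros | simp)+)
       (auto simp: inner_diff_left inner_diff_right inner_commute algebra_simps diff_divide_distrib)
  have "C1_on \<phi> UNIV"
    by (rule C1_on_gradient[OF _ d]) (intro continuous_intros)
  moreover have "(\<phi> has_derivative (\<lambda>v. p 0 \<bullet> v)) (at (\<xi> 0))" using d[of "\<xi> 0"] by simp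
  moreover have "local_min_within (\<lambda>w. u0 w - \<phi> w) UNIV (\<xi> 0)"
    unfolding local_min_within_def
  proof (intro conjI exI[of _ \<rho>] ballI)
    fix w assume "w \<in> ball (\<xi> 0) \<rho> \<inter> UNIV"
    then have "norm (w - \<xi> 0) \<le> \<rho>" by (simp add: dist_norm norm_minus_commute)
    from Km(2)[OF _ this, of 0] show "u0 (\<xi> 0) - \<phi> (\<xi> 0) \<le> u0 w - \<phi> w"
      using t0 z00 by (simp add: u_init \<phi>_def power2_norm_eq_inner)
  qed (use \<rho> in auto)
  ultimately show ?thesis unfolding subdiff_def by blast
qed

end

section \<open>Proximal subgradients and strict speed bounds\<close>

text \<open>Doubling of variables: minimise
  \<open>f w - h w' + n / 2 * (norm (w - w'))\<^sup>2\<close>, where \<open>h\<close> is the test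
  function made strict. Minimality in \<open>w\<close> puts a paraboloid with slope
  \<open>n *\<^sub>R (w' - w)\<close> below \<open>f\<close>, and minimality in \<open>w'\<close>
  identifies this slope with the gradient of \<open>h\<close> at \<open>w'\<close>, which is close
  to \<open>q\<close>.\<close>

lemma proximal_approximation:
  fixes f :: "'z::euclidean_space \<Rightarrow> real"
  assumes "open S" and fc: "continuous_on S f" and q: "q \<in> subdiff f S z" and \<epsilon>: "\<epsilon> > 0"
  obtains z1 q1 K \<rho> where "z1 \<in> S" "dist z1 z < \<epsilon>" "norm (q1 - q) < \<epsilon>" "\<rho> > 0"
    "\<And>w. norm (w - z1) \<le> \<rho> \<Longrightarrow> f z1 + q1 \<bullet> (w - z1) - K * (norm (w - z1))\<^sup>2 / 2 \<le> f w"
proof -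
  obtain \<phi> where C1: "C1_on \<phi> S" and d\<phi>: "(\<phi> has_derivative (\<lambda>v. q \<bullet> v)) (at z)"
    and mn: "local_min_within (\<lambda>w. f w - \<phi> w) S z" using q by (auto simp: subdiff_def)
  obtain e0 where zS: "z \<in> S" and e0: "e0 > 0" "\<And>w. w \<in> ball z e0 \<inter> S \<Longrightarrow> f z - \<phi> z \<le> f w - \<phi> w"
    using mn by (auto simp: local_min_within_def)
  obtain D :: "'z \<Rightarrow> 'z \<Rightarrow>\<^sub>L real" where Dc: "continuous_on S D"
    and D: "\<And>w. w \<in> S \<Longrightarrow> (\<phi> has_derivative blinfun_apply (D w)) (at w)"
    using C1 \<open>open S\<close> unfolding C1_on_def by (metis at_within_open)
  have Dz: "blinfun_apply (D z) = (\<lambda>v. q \<bullet> v)" using has_derivative_unique[OF D[OF zS] d\<phi>] .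
  obtain e1 where e1: "e1 > 0" "\<And>w. w \<in> S \<Longrightarrow> dist w z < e1 \<Longrightarrow> dist (D w) (D z) < \<epsilon> / 2"
    using Dc zS \<epsilon> unfolding continuous_on_iff by (meson half_gt_zero)
  obtain e2 where e2: "e2 > 0" "ball z e2 \<subseteq> S" using \<open>open S\<close> zS open_contains_ball by blast
  define r where "r = min (min (e0 / 2) (e1 / 2)) (min (e2 / 2) (\<epsilon> / 4))"
  have r: "r > 0" "r < e0" "r < e1" "r < e2" "r < \<epsilon> / 2" using e0 e1 e2 \<epsilon> by (auto simp: r_def)
  define B where "B = cball z r"
  have BS: "B \<subseteq> S" using e2(2) r(4) by (auto simp: B_def)
  \<comment> \<open>Subtracting the square makes the minimum at \<open>z\<close> strict without
    changing the gradient there; this localises the minimisers.\<close>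
  define h where "h w = \<phi> w - (norm (w - z))\<^sup>2" for w
  have \<phi>c: "continuous_on S \<phi>" using D by (meson continuous_at_imp_continuous_on has_derivative_continuous)
  have hc: "continuous_on B h" unfolding h_def by (intro continuous_intros continuous_on_subset[OF \<phi>c BS])
  have fB: "continuous_on B f" by (rule continuous_on_subset[OF fc BS])
  have cB: "compact B" by (simp add: B_def)
  have zB: "z \<in> B" using r by (simp add: B_def)
  have fh: "f z - h z + (norm (w - z))\<^sup>2 \<le> f w - h w" if "w \<in> B" for w
  proof -
    have "w \<in> ball z e0 \<inter> S" using that BS r(2) by (auto simp: B_def)
    from e0(2)[OF this] show ?thesis by (simp add: h_def)
  qed
  \<comment> \<open>The tolerance \<open>(r / 4)\<^sup>2\<close> matches the quadratic growth in
    \<open>fh\<close>: values of \<open>h\<close> this close at \<open>w\<close> and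
    \<open>w'\<close> force \<open>norm (w - z) < r / 4\<close>.\<close>
  have "uniformly_continuous_on B h" by (rule compact_uniformly_continuous[OF hc cB])
  moreover have "(r / 4)\<^sup>2 > 0" using r(1) by simp
  ultimately obtain d0 where d0: "d0 > 0" "\<And>w w'. w \<in> B \<Longrightarrow> w' \<in> B \<Longrightarrow> dist w' w < d0 \<Longrightarrow> dist (h w') (h w) < (r / 4)\<^sup>2"
    unfolding uniformly_continuous_on_def by blast
  define d where "d = min d0 (r / 4)"
  have d: "d > 0" using d0 r by (simp add: d_def)
  have "bounded (f ` B)" "bounded (h ` B)"
    using compact_continuous_image[OF fB cB] compact_continuous_image[OF hc cB] compact_imp_bounded by blast+
  then obtain M1 M2 where M: "\<And>w. w \<in> B \<Longrightarrow> \<bar>f w\<bar> \<le> M1" "\<And>w. w \<in> B \<Longrightarrow> \<bar>h w\<bar> \<le> M2"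
    unfolding bounded_iff by (metis imageI real_norm_def)
  define M where "M = 2 * (M1 + M2)"
  \<comment> \<open>At the minimum the penalty is at most the oscillation bound \<open>M\<close>, so
    this weight forces \<open>norm (w - w') < d\<close>.\<close>
  define n where "n = 2 * (M + 1) / d\<^sup>2"
  have M0: "M \<ge> 0" using M[OF zB] by (simp add: M_def)
  have n: "n > 0" using M0 d by (simp add: n_def)
  define \<Psi> where "\<Psi> W = f (fst W) - h (snd W) + n / 2 * (norm (fst W - snd W))\<^sup>2" for W
  have "continuous_on (B \<times> B) \<Psi>"
    unfolding \<Psi>_def by (intro continuous_intros continuous_on_compose2[OF fB] continuous_on_compose2[OF hc]) auto
  then obtain W where W: "W \<in> B \<times> B" "\<And>V. V \<in> B \<times> B \<Longrightarrow> \<Psi> W \<le> \<Psi> V"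
    using continuous_attains_inf[of "B \<times> B" \<Psi>] compact_Times[OF cB cB] zB by blast
  obtain w w' where ww: "W = (w, w')" "w \<in> B" "w' \<in> B" using W(1) by auto
  have min: "f w - h w' + n / 2 * (norm (w - w'))\<^sup>2 \<le> f v - h v' + n / 2 * (norm (v - v'))\<^sup>2" if "v \<in> B" "v' \<in> B" for v v'
    using W(2)[of "(v, v')"] that by (simp add: \<Psi>_def ww)
  have m0: "f w - h w' + n / 2 * (norm (w - w'))\<^sup>2 \<le> f z - h z" using min[OF zB zB] by simp
  have "n / 2 * (norm (w - w'))\<^sup>2 \<le> M"
    using m0 M(1)[OF ww(2)] M(2)[OF ww(3)] M(1)[OF zB] M(2)[OF zB] by (simp add: M_def)
  also have "\<dots> < n / 2 * d\<^sup>2" using d by (simp add: n_def)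
  finally have "(norm (w - w'))\<^sup>2 < d\<^sup>2" using n by simp
  then have wd: "norm (w - w') < d" using d power_less_imp_less_base[of "norm (w - w')" 2 d] by simp
  have "dist (h w') (h w) < (r / 4)\<^sup>2"
    using wd ww by (intro d0(2)) (auto simp: d_def dist_norm norm_minus_commute)
  moreover have "0 \<le> n / 2 * (norm (w - w'))\<^sup>2" using n by simp
  ultimately have "(norm (w - z))\<^sup>2 < (r / 4)\<^sup>2" using fh[OF ww(2)] m0 by (simp add: dist_real_def)
  then have wz: "norm (w - z) < r / 4" using r power_less_imp_less_base[of "norm (w - z)" 2 "r / 4"] by simp
  have "norm (w' - z) \<le> norm (w - w') + norm (w - z)"
    using norm_triangle_ineq[of "w' - w" "w - z"] by (simp add: norm_minus_commute)
  then have w'z: "norm (w' - z) < r / 2" using wd wz by (simp add: d_def)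
  define q1 where "q1 = n *\<^sub>R (w' - w)"
  \<comment> \<open>First-order condition in the second variable; \<open>w'\<close> is an interior
    point of \<open>B\<close>.\<close>
  have q1: "q1 \<bullet> v = D w' v - 2 * ((w' - z) \<bullet> v)" for v
  proof -
    define k where "k y = - h y + n / 2 * ((w - y) \<bullet> (w - y))" for y
    have w'S: "w' \<in> S" using ww BS by auto
    have "(k has_derivative (\<lambda>v. - (D w' v - 2 * ((w' - z) \<bullet> v)) + n * ((w' - w) \<bullet> v))) (at w')"
      unfolding k_def h_def power2_norm_eq_inner
      by (rule has_derivative_eq_rhs, (rule derivative_intros D[OF w'S] | simp)+)
         (auto simp: fun_eq_iff inner_diff_left inner_diff_right inner_commute algebra_simps diff_divide_distrib)
    moreover have "\<forall>y\<in>ball z r. k w' \<le> k y"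
    proof
      fix y assume "y \<in> ball z r"
      then have "y \<in> B" by (auto simp: B_def)
      from min[OF ww(2) this] show "k w' \<le> k y" by (simp add: k_def power2_norm_eq_inner)
    qed
    moreover have "w' \<in> ball z r" using w'z r by (simp add: dist_norm norm_minus_commute)
    ultimately have "(\<lambda>v. - (D w' v - 2 * ((w' - z) \<bullet> v)) + n * ((w' - w) \<bullet> v)) = (\<lambda>v. 0)"
      using differential_zero_maxmin[of w' "ball z r" k] by auto
    from fun_cong[OF this, of v] show ?thesis by (simp add: q1_def)
  qed
  show thesis
  proof (rule that)
    show "w \<in> S" using ww BS by auto
    show "dist w z < \<epsilon>" using wz r by (simp add: dist_norm)
    show "r / 2 > 0" using r by simp
    show "norm (q1 - q) < \<epsilon>"
    proof -
      define v where "v = q1 - q"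
      have "norm v * norm v = (D w' - D z) v - 2 * ((w' - z) \<bullet> v)"
      proof -
        have "norm v * norm v = q1 \<bullet> v - q \<bullet> v"
          by (simp add: v_def inner_diff_left dot_square_norm[symmetric] power2_eq_square[symmetric] flip: power2_norm_eq_inner)
            (simp add: power2_norm_eq_inner inner_diff_left inner_diff_right)
        then show ?thesis by (simp add: q1 Dz blinfun.diff_left)
      qed
      also have "\<dots> \<le> norm (D w' - D z) * norm v + 2 * (norm (w' - z) * norm v)"
        using norm_blinfun[of "D w' - D z" v] Cauchy_Schwarz_ineq2[of "w' - z" v] by (auto simp: abs_le_iff)
      finally have "norm v * norm v \<le> (norm (D w' - D z) + 2 * norm (w' - z)) * norm v" by (simp add: algebra_simps)
      then have "norm v \<le> norm (D w' - D z) + 2 * norm (w' - z)" by (cases "v = 0") auto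
      also have "norm (D w' - D z) < \<epsilon> / 2"
        using e1(2)[of w'] ww BS w'z r by (auto simp: dist_norm)
      finally show ?thesis using w'z r by (simp add: v_def)
    qed
    fix y assume y: "norm (y - w) \<le> r / 2"
    have "norm (y - z) \<le> norm (y - w) + norm (w - z)" using norm_triangle_ineq[of "y - w" "w - z"] by simp
    then have "y \<in> B" using y wz r by (simp add: B_def dist_norm norm_minus_commute)
    from min[OF this ww(3)]
    have m1: "f w + n / 2 * ((w - w') \<bullet> (w - w')) \<le> f y + n / 2 * ((y - w') \<bullet> (y - w'))" by (simp add: power2_norm_eq_inner)
    \<comment> \<open>With \<open>w'\<close> frozen, expanding the square about \<open>w\<close>
      turns minimality in the first variable into the paraboloid of slope \<open>q1\<close> and
      curvature \<open>n\<close>.\<close>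
    have "y - w' = (y - w) + (w - w')" by simp
    then have m2: "(y - w') \<bullet> (y - w') = (y - w) \<bullet> (y - w) + 2 * ((w - w') \<bullet> (y - w)) + (w - w') \<bullet> (w - w')"
      by (metis (no_types, lifting) inner_add_left inner_add_right inner_commute add.assoc mult_2)
    have m3: "n / 2 * ((y - w) \<bullet> (y - w) + 2 * ((w - w') \<bullet> (y - w)) + (w - w') \<bullet> (w - w'))
        = n * ((y - w) \<bullet> (y - w)) / 2 + n * ((w - w') \<bullet> (y - w)) + n / 2 * ((w - w') \<bullet> (w - w'))"
      by (simp add: distrib_left)
    have m4: "q1 \<bullet> (y - w) = - (n * ((w - w') \<bullet> (y - w)))"
      by (simp add: q1_def inner_diff_left right_diff_distrib)
    show "f w + q1 \<bullet> (y - w) - n * (norm (y - w))\<^sup>2 / 2 \<le> f y"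
      using m1[unfolded m2 m3] m4 unfolding power2_norm_eq_inner by linarith
  qed
qed

text \<open>Tested in the direction of \<open>q\<close> itself. The bound makes the set in
  \<open>S_fun\<close> bounded above, so that its \<open>Sup\<close> is a genuine supremum.\<close>

lemma lipschitz_subdiff_bound:
  fixes f :: "'z::real_inner \<Rightarrow> real"
  assumes lip: "L-lipschitz_on UNIV f" and q: "q \<in> subdiff f UNIV y"
  shows "norm q \<le> L"
proof (cases "q = 0")
  case True
  then show ?thesis using lipschitz_on_nonneg[OF lip] by simp
next
  case False
  obtain \<phi> e where d: "(\<phi> has_derivative (\<lambda>v. q \<bullet> v)) (at y)"
    and e: "e > 0" "\<And>w. w \<in> ball y e \<Longrightarrow> f y - \<phi> y \<le> f w - \<phi> w"
    using q unfolding subdiff_def local_min_within_def by auto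
  have "((\<lambda>h. y + h *\<^sub>R q) has_derivative (\<lambda>h. h *\<^sub>R q)) (at 0)" by (auto intro!: derivative_eq_intros)
  from has_derivative_compose[OF this, of \<phi> "\<lambda>v. q \<bullet> v"] d
  have "((\<lambda>h. \<phi> (y + h *\<^sub>R q)) has_real_derivative (q \<bullet> q)) (at 0)"
    by (simp add: has_field_derivative_def mult.commute[of _ "q \<bullet> q"])
  then have "((\<lambda>h. (\<phi> (y + h *\<^sub>R q) - \<phi> y) / h) \<longlongrightarrow> q \<bullet> q) (at 0)" by (simp add: DERIV_def)
  then have lim: "((\<lambda>h. (\<phi> (y + h *\<^sub>R q) - \<phi> y) / h) \<longlongrightarrow> q \<bullet> q) (at_right 0)"
    by (rule filterlim_mono) (auto simp: at_within_le_at)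
  have "\<forall>\<^sub>F h in at_right 0. (\<phi> (y + h *\<^sub>R q) - \<phi> y) / h \<le> L * norm q"
    unfolding eventually_at_right_field
  proof (intro exI[of _ "e / norm q"] conjI allI impI)
    show "0 < e / norm q" using e False by simp
    fix h :: real assume h: "0 < h" "h < e / norm q"
    then have "y + h *\<^sub>R q \<in> ball y e" using False by (simp add: dist_norm field_simps)
    from e(2)[OF this] have "\<phi> (y + h *\<^sub>R q) - \<phi> y \<le> f (y + h *\<^sub>R q) - f y" by simp
    also have "\<dots> \<le> L * (h * norm q)"
      using lipschitz_onD[OF lip, of "y + h *\<^sub>R q" y] h by (simp add: dist_norm)
    finally show "(\<phi> (y + h *\<^sub>R q) - \<phi> y) / h \<le> L * norm q" using h by (simp add: field_simps)
  qed
  from tendsto_upperbound[OF lim this] have "norm q * norm q \<le> L * norm q"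
    by (simp add: dot_square_norm power2_eq_square)
  then show ?thesis using False by simp
qed

section \<open>Strict convexity and the speed gap\<close>

locale strict_hj_solution = hj_solution +
  assumes g_diff: "\<And>s Y. s \<in> {0..T} \<Longrightarrow> g s differentiable (at Y)"
    and H4st: "\<And>x t v p \<xi>. t \<in> {0..T} \<Longrightarrow> \<xi> \<noteq> 0 \<Longrightarrow> hess_p H x t v p \<xi> \<xi> > 0"
begin

text \<open>\<open>H\<close> is Lipschitz in \<open>p\<close>, so a maximal speed could not increase any further in the direction of \<open>p\<close>
  in which strict convexity makes it increase.\<close>

lemma norm_Hp_less:
  assumes s: "s \<in> {0..T}" shows "norm (Hp s Y) < A2 * norm (fst Y) + B2"
proof (rule ccontr)
  assume not: "\<not> ?thesis"
  obtain x v p where Y: "Y = (x, v, p)" by (cases Y)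
  \<comment> \<open>The direction of the speed. If the speed vanishes, any unit vector serves, so
    the degenerate case in which the bound itself is 0 is refuted as well.\<close>
  obtain e :: 'a where e: "norm e = 1" "Hp s Y \<bullet> e = norm (Hp s Y)"
  proof (cases "Hp s Y = 0")
    case True
    obtain b :: 'a where "b \<in> Basis" using nonempty_Basis by blast
    then show ?thesis using that[of b] True by simp
  next
    case False
    have "Hp s Y \<bullet> sgn (Hp s Y) = norm (Hp s Y)"
      using False by (simp add: sgn_div_norm dot_square_norm power2_eq_square)
    then show ?thesis using that[of "sgn (Hp s Y)"] False by (simp add: norm_sgn)
  qed
  define \<gamma> where "\<gamma> a = Hp s (x, v, p + a *\<^sub>R e) \<bullet> e" for a
  have "((\<lambda>r. H x s v (p + a *\<^sub>R e + r *\<^sub>R e)) has_real_derivative \<gamma> a) (at 0)" for a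
  proof -
    have "((\<lambda>r. (x, v, p + a *\<^sub>R e + r *\<^sub>R e)) has_derivative (\<lambda>r. (0, 0, r *\<^sub>R e))) (at 0)"
      by (auto intro!: derivative_eq_intros)
    from has_derivative_compose[OF this, of "hh s" "\<lambda>d. g s (x, v, p + a *\<^sub>R e) \<bullet> d"] g_deriv[OF s]
    show ?thesis by (simp add: has_field_derivative_def inner_prod_def \<gamma>_def mult.commute[of _ "_ \<bullet> e"])
  qed
  then have "deriv (\<lambda>r. H x s v (p + a *\<^sub>R e + r *\<^sub>R e)) 0 = \<gamma> a" for a by (rule DERIV_imp_deriv)
  moreover have "e \<noteq> 0" using e(1) by auto
  ultimately have "deriv \<gamma> 0 > 0"
    using H4st[OF s, of e x v p] by (simp add: hess_p_def)
  \<comment> \<open>\<open>deriv\<close> carries information only where a derivative exists; the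
    differentiability of \<open>g s\<close> makes the positive number in \<open>hess_p\<close> a
    genuine slope.\<close>
  moreover have "(\<gamma> has_real_derivative deriv \<gamma> 0) (at 0)"
  proof -
    have "(\<lambda>a. (x, v, p + a *\<^sub>R e)) differentiable (at 0)"
      by (rule differentiableI[where f' = "\<lambda>r. (0, 0, r *\<^sub>R e)"]) (auto intro!: derivative_eq_intros)
    from differentiable_chain_at[OF this g_diff[OF s]]
    have "(\<lambda>a. g s (x, v, p + a *\<^sub>R e)) differentiable (at 0)" by (simp add: o_def)
    then obtain G where "((\<lambda>a. g s (x, v, p + a *\<^sub>R e)) has_derivative G) (at 0)" unfolding differentiable_def by blast
    then have "(\<gamma> has_derivative (\<lambda>r. snd (snd (G r)) \<bullet> e)) (at 0)"
      unfolding \<gamma>_def by (auto intro!: derivative_intros)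
    then have "\<gamma> differentiable (at 0)" unfolding differentiable_def by blast
    then show ?thesis using DERIV_deriv_iff_real_differentiable by blast
  qed
  ultimately obtain d where d: "d > 0" "\<And>h. 0 < h \<Longrightarrow> h < d \<Longrightarrow> \<gamma> 0 < \<gamma> (0 + h)"
    using DERIV_pos_inc_right[of \<gamma> "deriv \<gamma> 0" 0] by blast
  have "\<gamma> (d / 2) \<le> norm (Hp s (x, v, p + (d / 2) *\<^sub>R e)) * norm e"
    unfolding \<gamma>_def by (rule norm_cauchy_schwarz)
  also have "\<dots> \<le> A2 * norm x + B2"
    using norm_Hp_le[OF s, of "(x, v, p + (d / 2) *\<^sub>R e)"] e(1) by simp
  finally show False using d(2)[of "d / 2"] d(1) not e(2) by (simp add: \<gamma>_def Y)
qed

text \<open>Compactness makes the strict inequality uniform. The gap depends only on the box, hence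
  is common to all characteristics in it.\<close>

lemma speed_gap:
  obtains \<delta> where "\<delta> > 0" "\<And>s x v p. s \<in> {0..T} \<Longrightarrow> norm x \<le> RX \<Longrightarrow> \<bar>v\<bar> \<le> RZ \<Longrightarrow> norm p \<le> RP \<Longrightarrow>
    norm (Hp s (x, v, p)) \<le> A2 * norm x + B2 - \<delta>"
proof -
  define Q where "Q = {0..T} \<times> (cball (0::'a) RX \<times> cball (0::real) RZ \<times> cball (0::'a) RP)"
  have cQ: "compact Q" unfolding Q_def by (intro compact_Times compact_Icc compact_cball)
  define k where "k w = A2 * norm (fst (snd w)) + B2 - norm (Hp (fst w) (snd w))" for w
  have "continuous_on Q k" unfolding k_def
    by (intro continuous_intros continuous_on_subset[OF g_cont]) (auto simp: Q_def)
  then obtain \<delta> where "\<delta> > 0" "\<And>w. w \<in> Q \<Longrightarrow> \<delta> \<le> k w"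
  proof (cases "Q = {}")
    case False
    assume th: "\<And>\<delta>. \<delta> > 0 \<Longrightarrow> (\<And>w. w \<in> Q \<Longrightarrow> \<delta> \<le> k w) \<Longrightarrow> thesis" and c: "continuous_on Q k"
    obtain w0 where w0: "w0 \<in> Q" "\<And>w. w \<in> Q \<Longrightarrow> k w0 \<le> k w"
      using continuous_attains_inf[OF cQ False c] by blast
    have "k w0 > 0" using norm_Hp_less[of "fst w0" "snd w0"] w0(1) by (auto simp: k_def Q_def)
    then show thesis using th w0 by blast
  qed (use zero_less_one in blast)
  then show thesis by (intro that[of \<delta>]) (force simp: k_def Q_def)+
qed

end

section \<open>Feet of characteristics and passage to the limit\<close>

text \<open>In this form the radius is the Gronwall bound for the displacement of a curve through
  \<open>x\<close> whose speed at \<open>y\<close> is at most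
  \<open>A2 * norm y + B2\<close>.\<close>

lemma R_fun_eq: "A2 \<ge> 0 \<Longrightarrow> R_fun A2 B2 x t = (A2 * norm x + B2) * exp_int A2 t"
  by (auto simp: R_fun_def exp_int_def field_simps)

lemma continuous_on_exp_int: "A \<ge> 0 \<Longrightarrow> continuous_on UNIV (exp_int A)"
  using exp_int_deriv by (meson DERIV_isCont continuous_at_imp_continuous_on)

context strict_hj_solution begin

text \<open>Gronwall's inequality is applied to the displacement \<open>\<xi> s - \<xi> t0\<close>,
  not to \<open>\<xi>\<close>; this yields the radius of \<open>R_fun\<close>, shortened by
  \<open>\<delta> * exp_int A2 t0\<close>. For the slope it is applied in both time
  directions.\<close>

lemma foot_estimates:
  assumes ch: "characteristic RX RZ RP \<xi> z p \<xi>' z' p'" and t0: "t0 \<in> {0..T}"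
    and gap: "\<And>s x v p. s \<in> {0..T} \<Longrightarrow> norm x \<le> RX \<Longrightarrow> \<bar>v\<bar> \<le> RZ \<Longrightarrow> norm p \<le> RP \<Longrightarrow>
      norm (Hp s (x, v, p)) \<le> A2 * norm x + B2 - \<delta>"
  shows "norm (\<xi> 0 - \<xi> t0) \<le> (A2 * norm (\<xi> t0) + B2 - \<delta>) * exp_int A2 t0"
    and "norm (p t0) \<le> norm (p 0) * exp ((C1 + K3) * t0) + C1 * \<beta> * exp_int (C1 + K3) t0"
    and "norm (p 0) \<le> norm (p t0) * exp ((C1 + K3) * t0) + C1 * \<beta> * exp_int (C1 + K3) t0"
proof -
  note c = characteristicD[OF ch]
  have f: "\<xi>' s = Hp s (\<xi> s, z s, p s)" "p' s = - (Hx s (\<xi> s, z s, p s) + Hu s (\<xi> s, z s, p s) *\<^sub>R p s)"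
    if "s \<in> {0..T}" for s using ch that by (auto simp: characteristic_def field_def)
  have \<xi>'_le: "norm (\<xi>' s) \<le> A2 * norm (\<xi> s) + B2 - \<delta>" if "s \<in> {0..T}" for s
    unfolding f(1)[OF that] by (rule gap[OF that c(7)[OF that] c(8)[OF that] c(9)[OF that]])
  have "norm (\<xi> 0 - \<xi> t0) \<le> norm (\<xi> t0 - \<xi> t0) * exp (A2 * \<bar>0 - t0\<bar>) + (A2 * norm (\<xi> t0) + B2 - \<delta>) * exp_int A2 \<bar>0 - t0\<bar>"
  proof (rule gronwall[where a = 0 and b = T and X = "\<lambda>s. \<xi> s - \<xi> t0" and X' = \<xi>'])
    fix s assume s: "s \<in> {0..T}"
    show "((\<lambda>s. \<xi> s - \<xi> t0) has_vector_derivative \<xi>' s) (at s)"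
      using c(1) by (auto intro!: derivative_eq_intros)
    have "norm (\<xi> s) \<le> norm (\<xi> s - \<xi> t0) + norm (\<xi> t0)"
      using norm_triangle_ineq[of "\<xi> s - \<xi> t0" "\<xi> t0"] by simp
    from mult_left_mono[OF this A2_nn] \<xi>'_le[OF s]
    show "norm (\<xi>' s) \<le> A2 * norm (\<xi> s - \<xi> t0) + (A2 * norm (\<xi> t0) + B2 - \<delta>)"
      by (simp add: distrib_left)
  next
    show "0 \<le> A2 * norm (\<xi> t0) + B2 - \<delta>" using order_trans[OF norm_ge_zero \<xi>'_le[OF t0]] .
  qed (use A2_nn t0 T_pos in auto)
  then show "norm (\<xi> 0 - \<xi> t0) \<le> (A2 * norm (\<xi> t0) + B2 - \<delta>) * exp_int A2 t0" using t0 by simp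
  have p'_le: "norm (p' s) \<le> (C1 + K3) * norm (p s) + C1 * \<beta>" if s: "s \<in> {0..T}" for s
  proof -
    have "norm (p' s) \<le> C1 * (\<beta> + norm (p s)) + K3 * norm (p s)"
      unfolding f(2)[OF s] norm_minus_cancel
      using norm_Hx_le[OF s, of "(\<xi> s, z s, p s)"]
        mult_right_mono[OF abs_Hu_le[OF s, of "(\<xi> s, z s, p s)"], of "norm (p s)"]
      by (intro norm_triangle_mono) auto
    then show ?thesis by (simp add: algebra_simps)
  qed
  have g: "norm (p s) \<le> norm (p t) * exp ((C1 + K3) * \<bar>s - t\<bar>) + C1 * \<beta> * exp_int (C1 + K3) \<bar>s - t\<bar>"
    if "s \<in> {0..T}" "t \<in> {0..T}" for s t
    by (rule gronwall[OF c(5) p'_le _ _ that]) (use C1_nn K3_nn \<beta>_nn in auto)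
  show "norm (p t0) \<le> norm (p 0) * exp ((C1 + K3) * t0) + C1 * \<beta> * exp_int (C1 + K3) t0"
    "norm (p 0) \<le> norm (p t0) * exp ((C1 + K3) * t0) + C1 * \<beta> * exp_int (C1 + K3) t0"
    using g[of t0 0] g[of 0 t0] t0 T_pos by auto
qed

text \<open>The characteristic starts at a point near \<open>(x, t)\<close>, yet its foot lies in
  the ball belonging to \<open>(x, t)\<close>: the amount by which the gap shortens the displacement
  absorbs the shift of the starting point.\<close>

lemma approximate_gradient_bounds:
  assumes t: "t \<in> {0<..<T}" and p: "p \<in> subdiff_x u T x t" and \<epsilon>: "\<epsilon> > 0"
  obtains s q P y where "\<bar>s - t\<bar> < \<epsilon>" "norm (q - p) < \<epsilon>" "y \<in> cball x (R_fun A2 B2 x t)" "P \<in> subdiff u0 UNIV y"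
    "norm q \<le> norm P * exp ((C1 + K3) * s) + C1 * \<beta> * exp_int (C1 + K3) s"
    "norm P \<le> norm q * exp ((C1 + K3) * s) + C1 * \<beta> * exp_int (C1 + K3) s"
proof -
  define S where "S = (UNIV :: 'a set) \<times> {0<..<T}"
  have oS: "open S" by (auto simp: S_def intro: open_Times)
  have uS: "continuous_on S (\<lambda>w. u (fst w) (snd w))"
    by (rule continuous_on_subset[OF u_cont]) (auto simp: S_def)
  obtain \<tau> where \<tau>: "(p, \<tau>) \<in> subdiff (\<lambda>w. u (fst w) (snd w)) S (x, t)"
    using p by (auto simp: subdiff_x_def S_def case_prod_unfold)
  \<comment> \<open>The box is fixed for data up to one unit larger in norm, and with it the gap,
    before the proximal point is chosen; how near that point must be depends on the gap.\<close>
  obtain RX RZ RP where R: "\<And>t0 x0 v0 p0. t0 \<in> {0..T} \<Longrightarrow> norm x0 \<le> norm x + 1 \<Longrightarrow> \<bar>v0\<bar> \<le> \<bar>u x t\<bar> + 1 \<Longrightarrow> norm p0 \<le> norm p + 1 \<Longrightarrow>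
      \<exists>\<xi> z p \<xi>' z' p'. characteristic RX RZ RP \<xi> z p \<xi>' z' p' \<and> \<xi> t0 = x0 \<and> z t0 = v0 \<and> p t0 = p0"
    by (rule characteristics_exist[of "norm x + 1" "\<bar>u x t\<bar> + 1" "norm p + 1"]) (simp_all, blast)
  obtain \<delta> where \<delta>: "\<delta> > 0" "\<And>s x v p. s \<in> {0..T} \<Longrightarrow> norm x \<le> RX \<Longrightarrow> \<bar>v\<bar> \<le> RZ \<Longrightarrow> norm p \<le> RP \<Longrightarrow>
      norm (Hp s (x, v, p)) \<le> A2 * norm x + B2 - \<delta>" using speed_gap[of RX RZ RP] by blast
  have "isCont (\<lambda>w. u (fst w) (snd w)) (x, t)"
    using uS oS t by (auto simp: S_def continuous_on_eq_continuous_at)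
  then obtain e1 where e1: "e1 > 0" "\<And>w. dist w (x, t) < e1 \<Longrightarrow> dist (u (fst w) (snd w)) (u x t) < 1"
    unfolding continuous_at_eps_delta fst_conv snd_conv using zero_less_one by blast
  \<comment> \<open>Bounds the distance from \<open>x\<close> to the foot of a characteristic
    through the point \<open>w\<close>. At \<open>(x, t)\<close> it is
    \<open>R_fun A2 B2 x t\<close> less \<open>\<delta> * exp_int A2 t\<close>, so by continuity it
    stays below the radius nearby.\<close>
  define k where "k w = norm (fst w - x) + (A2 * norm (fst w) + B2 - \<delta>) * exp_int A2 (snd w)" for w
  have "continuous_on UNIV k" unfolding k_def
    by (intro continuous_intros continuous_on_compose2[OF continuous_on_exp_int[OF A2_nn]]) auto
  then have kc: "isCont k (x, t)" by (simp add: continuous_on_eq_continuous_at)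
  have "\<delta> * exp_int A2 t > 0" using \<delta>(1) t exp_int_pos[of t A2] by simp
  then obtain e2 where e2: "e2 > 0" "\<And>w. dist w (x, t) < e2 \<Longrightarrow> dist (k w) (k (x, t)) < \<delta> * exp_int A2 t"
    using kc unfolding continuous_at_eps_delta by blast
  define e where "e = min (min \<epsilon> 1) (min e1 e2)"
  have e: "e > 0" "e \<le> \<epsilon>" "e \<le> 1" "e \<le> e1" "e \<le> e2" using \<epsilon> e1 e2 by (auto simp: e_def)
  obtain w1 q1 K \<rho> where w1: "w1 \<in> S" "dist w1 (x, t) < e" "norm (q1 - (p, \<tau>)) < e" "\<rho> > 0"
    and low: "\<And>w. norm (w - w1) \<le> \<rho> \<Longrightarrow> u (fst w1) (snd w1) + q1 \<bullet> (w - w1) - K * (norm (w - w1))\<^sup>2 / 2 \<le> u (fst w) (snd w)"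
    using proximal_approximation[OF oS uS \<tau> e(1)] by metis
  obtain x1 s where ws: "w1 = (x1, s)" by force
  obtain q \<tau>1 where qs: "q1 = (q, \<tau>1)" by force
  have s: "s \<in> {0<..<T}" using w1(1) by (simp add: S_def ws)
  have x1: "norm (x1 - x) < e" and st: "\<bar>s - t\<bar> < e"
    using w1(2) dist_fst_le[of w1 "(x, t)"] dist_snd_le[of w1 "(x, t)"] by (auto simp: ws dist_norm)
  have q: "norm (q - p) < e"
    using w1(3) norm_fst_le[of "q - p" "\<tau>1 - \<tau>"] by (simp add: qs)
  have "norm x1 \<le> norm x + 1" using x1 e(3) norm_triangle_ineq2[of x1 x] by simp
  moreover have "\<bar>u x1 s\<bar> \<le> \<bar>u x t\<bar> + 1" using e1(2)[of w1] w1(2) e(4) by (simp add: ws dist_real_def)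
  moreover have "norm q \<le> norm p + 1" using q e(3) norm_triangle_ineq2[of q p] by simp
  ultimately obtain \<xi> z P \<xi>' z' P' where ch: "characteristic RX RZ RP \<xi> z P \<xi>' z' P'"
    and i: "\<xi> s = x1" "z s = u x1 s" "P s = q"
    using R[of s x1 "u x1 s" q] s by auto
  have low': "z s + P s \<bullet> \<eta> - K * (norm \<eta>)\<^sup>2 / 2 \<le> u (\<xi> s + \<eta>) s" if "norm \<eta> \<le> min \<rho> 1" for \<eta>
    using low[of "(x1 + \<eta>, s)"] that by (simp add: ws qs i inner_prod_def norm_prod_def)
  have P: "P 0 \<in> subdiff u0 UNIV (\<xi> 0)"
    by (rule proximal_subgradient_propagates[OF ch s, where \<rho> = "min \<rho> 1"]) (use i w1(4) low' in auto)
  have s': "s \<in> {0..T}" using s by auto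
  note ft = foot_estimates[OF ch s' \<delta>(2), unfolded i]
  show thesis
  proof (rule that[of s q "\<xi> 0" "P 0"])
    show "\<bar>s - t\<bar> < \<epsilon>" "norm (q - p) < \<epsilon>" using st q e by auto
    have "norm (\<xi> 0 - x) \<le> norm (\<xi> 0 - x1) + norm (x1 - x)"
      using norm_triangle_ineq[of "\<xi> 0 - x1" "x1 - x"] by simp
    also have "\<dots> \<le> k w1" using ft(1) by (simp add: k_def ws)
    also have "\<dots> \<le> k (x, t) + \<delta> * exp_int A2 t"
      using e2(2)[of w1] w1(2) e(5) by (simp add: dist_real_def)
    also have "\<dots> = R_fun A2 B2 x t" by (simp add: k_def R_fun_eq[OF A2_nn] algebra_simps)
    finally show "\<xi> 0 \<in> cball x (R_fun A2 B2 x t)" by (simp add: dist_norm norm_minus_commute)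
  qed (use P ft(2,3) in auto)
qed

text \<open>Supremum and infimum range over a set determined by \<open>(x, t)\<close> alone, so in
  the limit only the slope and the factors depending on time vary. The lower estimate is kept
  multiplied by the exponential, which makes both parts instances of the same inequality.\<close>

theorem gradient_bounds:
  assumes t: "t \<in> {0<..<T}" and p: "p \<in> subdiff_x u T x t" and lip: "L-lipschitz_on UNIV u0"
  shows "norm p \<le> S_fun A2 B2 u0 x t * exp ((C1 + K3) * t) + C1 * \<beta> * exp_int (C1 + K3) t"
    and "I_fun A2 B2 u0 x t \<le> norm p * exp ((C1 + K3) * t) + C1 * \<beta> * exp_int (C1 + K3) t"
proof -
  define W where "W = {norm p | p y. y \<in> cball x (R_fun A2 B2 x t) \<and> p \<in> subdiff u0 UNIV y}"
  have W: "bdd_above W" "bdd_below W"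
    using lipschitz_subdiff_bound[OF lip] by (auto simp: W_def intro!: bdd_aboveI[of _ L] bdd_belowI[of _ 0])
  define c where "c = C1 + K3"
  define E where "E s = C1 * \<beta> * exp_int c s" for s
  have c0: "c \<ge> 0" using C1_nn K3_nn by (simp add: c_def)
  have "\<exists>s q. \<bar>s - t\<bar> < 1 / real (Suc n) \<and> norm (q - p) < 1 / real (Suc n) \<and>
      norm q \<le> Sup W * exp (c * s) + E s \<and> Inf W \<le> norm q * exp (c * s) + E s" for n
  proof -
    obtain s q P y where A: "\<bar>s - t\<bar> < 1 / real (Suc n)" "norm (q - p) < 1 / real (Suc n)"
      "y \<in> cball x (R_fun A2 B2 x t)" "P \<in> subdiff u0 UNIV y"
      "norm q \<le> norm P * exp (c * s) + E s" "norm P \<le> norm q * exp (c * s) + E s"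
      unfolding c_def E_def by (rule approximate_gradient_bounds[OF t p, of "1 / real (Suc n)"]) simp_all
    have PW: "norm P \<in> W" using A by (auto simp: W_def)
    have "norm P * exp (c * s) \<le> Sup W * exp (c * s)"
      by (intro mult_right_mono cSup_upper PW W) simp
    moreover have "Inf W \<le> norm P" by (intro cInf_lower PW W)
    ultimately have "norm q \<le> Sup W * exp (c * s) + E s" "Inf W \<le> norm q * exp (c * s) + E s"
      using A(5,6) by linarith+
    then show ?thesis using A(1,2) by blast
  qed
  then obtain s q where sq: "\<And>n. \<bar>s n - t\<bar> < 1 / real (Suc n)" "\<And>n. norm (q n - p) < 1 / real (Suc n)"
    "\<And>n. norm (q n) \<le> Sup W * exp (c * s n) + E (s n)" "\<And>n. Inf W \<le> norm (q n) * exp (c * s n) + E (s n)" by metis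
  have inv: "(\<lambda>n. 1 / real (Suc n)) \<longlonglongrightarrow> 0" using LIMSEQ_inverse_real_of_nat by (simp add: inverse_eq_divide)
  have "(\<lambda>n. s n - t) \<longlonglongrightarrow> 0"
    by (rule Lim_null_comparison[OF always_eventually inv]) (use sq(1) in \<open>auto intro: less_imp_le\<close>)
  then have sl: "s \<longlonglongrightarrow> t" by (simp add: LIM_zero_iff)
  have "(\<lambda>n. q n - p) \<longlonglongrightarrow> 0"
    by (rule Lim_null_comparison[OF always_eventually inv]) (use sq(2) in \<open>auto intro: less_imp_le\<close>)
  then have ql: "q \<longlonglongrightarrow> p" by (simp add: LIM_zero_iff)
  have El: "(\<lambda>n. E (s n)) \<longlonglongrightarrow> E t" unfolding E_def
    using continuous_on_exp_int[OF c0]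
    by (intro tendsto_intros isCont_tendsto_compose[OF _ sl]) (simp add: continuous_on_eq_continuous_at)
  have el: "(\<lambda>n. exp (c * s n)) \<longlonglongrightarrow> exp (c * t)" by (intro tendsto_intros sl)
  have "norm p \<le> Sup W * exp (c * t) + E t"
    by (rule LIMSEQ_le[OF tendsto_norm[OF ql] tendsto_add[OF tendsto_mult[OF tendsto_const el] El]]) (use sq(3) in auto)
  then show "norm p \<le> S_fun A2 B2 u0 x t * exp ((C1 + K3) * t) + C1 * \<beta> * exp_int (C1 + K3) t"
    by (simp add: S_fun_def W_def E_def c_def)
  have "Inf W \<le> norm p * exp (c * t) + E t"
    by (rule LIMSEQ_le[OF tendsto_const tendsto_add[OF tendsto_mult[OF tendsto_norm[OF ql] el] El]]) (use sq(4) in auto)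
  then show "I_fun A2 B2 u0 x t \<le> norm p * exp ((C1 + K3) * t) + C1 * \<beta> * exp_int (C1 + K3) t"
    by (simp add: I_fun_def W_def E_def c_def)
qed

end

theorem theorem4p5:
  fixes H :: "'a::euclidean_space \<Rightarrow> real \<Rightarrow> real \<Rightarrow> 'a \<Rightarrow> real"
    and u0 :: "'a \<Rightarrow> real" and u :: "'a \<Rightarrow> real \<Rightarrow> real"
    and T C1 \<beta> A2 B2 K3 :: real
  assumes T_pos: "T > 0"
    and u0_lip: "\<exists>L. L-lipschitz_on UNIV u0"
    and H1: "C1 \<ge> 0" "\<beta> \<in> {0, 1}"
      "\<forall>x y t v p. t \<in> {0..T} \<longrightarrow> \<bar>H x t v p - H y t v p\<bar> \<le> C1 * (\<beta> + norm p) * norm (x - y)"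
    and H2: "A2 \<ge> 0" "B2 \<ge> 0"
      "\<forall>x t v p q. t \<in> {0..T} \<longrightarrow> \<bar>H x t v p - H x t v q\<bar> \<le> (A2 * norm x + B2) * norm (p - q)"
    and H3: "K3 \<ge> 0"
      "\<forall>x t v w p. t \<in> {0..T} \<longrightarrow> \<bar>H x t v p - H x t w p\<bar> \<le> K3 * \<bar>v - w\<bar>"
    and H4: "\<forall>x t v. t \<in> {0..T} \<longrightarrow> convex_on UNIV (\<lambda>p. H x t v p)"
    and H5: "C2_on (\<lambda>(x, t, v, p). H x t v p) (UNIV \<times> {0..T} \<times> UNIV \<times> UNIV)"
    and H4st: "\<forall>x t v p \<xi>. t \<in> {0..T} \<and> \<xi> \<noteq> 0 \<longrightarrow> hess_p H x t v p \<xi> \<xi> > 0"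
    and visc: "viscosity_solution H u0 T u"
  shows "((C1, K3) \<noteq> (0, 0) \<longrightarrow>
            (\<forall>x t p. t \<in> {0<..<T} \<and> p \<in> subdiff_x u T x t \<longrightarrow>
               I_fun A2 B2 u0 x t * exp (- (C1 + K3) * t)
                 - C1 * \<beta> / (C1 + K3) * (1 - exp (- (C1 + K3) * t)) \<le> norm p \<and>
               norm p \<le> S_fun A2 B2 u0 x t * exp ((C1 + K3) * t)
                 + C1 * \<beta> / (C1 + K3) * (exp ((C1 + K3) * t) - 1)))
       \<and> ((C1, K3) = (0, 0) \<longrightarrow>
            (\<forall>x t p. t \<in> {0<..<T} \<and> p \<in> subdiff_x u T x t \<longrightarrow>
               I_fun A2 B2 u0 x t \<le> norm p \<and> norm p \<le> S_fun A2 B2 u0 x t))"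
proof (rule C2_on_state_gradient[OF H5], goal_cases)
  case g: (1 g)
  interpret strict_hj_solution H T C1 \<beta> A2 B2 K3 g u0 u
  proof unfold_locales
    show "0 \<le> \<beta>" using H1(2) by auto
  qed (fact T_pos H1(1) H2(1,2) H3(1) H1(3)[rule_format] H2(3)[rule_format] H3(2)[rule_format]
        H4[rule_format] H4st[rule_format, OF conjI] g visc)+
  obtain L where L: "L-lipschitz_on UNIV u0" using u0_lip by blast
  show ?thesis
  proof (intro conjI impI allI; elim conjE)
    fix x t p assume "(C1, K3) \<noteq> (0, 0)" and t: "t \<in> {0<..<T}" "p \<in> subdiff_x u T x t"
    then have c: "C1 + K3 > 0" using C1_nn K3_nn by auto
    have E: "C1 * \<beta> * exp_int (C1 + K3) t = C1 * \<beta> / (C1 + K3) * (exp ((C1 + K3) * t) - 1)"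
      using c by (simp add: exp_int_def)
    show "norm p \<le> S_fun A2 B2 u0 x t * exp ((C1 + K3) * t) + C1 * \<beta> / (C1 + K3) * (exp ((C1 + K3) * t) - 1)"
      using gradient_bounds(1)[OF t L] unfolding E .
    define m where "m = exp (- (C1 + K3) * t)"
    have em: "exp ((C1 + K3) * t) * m = 1" by (simp add: m_def flip: exp_add) (simp add: algebra_simps)
    have "I_fun A2 B2 u0 x t * m \<le> (norm p * exp ((C1 + K3) * t) + C1 * \<beta> / (C1 + K3) * (exp ((C1 + K3) * t) - 1)) * m"
      using gradient_bounds(2)[OF t L] unfolding E by (intro mult_right_mono) (simp_all add: m_def)
    also have "\<dots> = norm p * (exp ((C1 + K3) * t) * m) + C1 * \<beta> / (C1 + K3) * (exp ((C1 + K3) * t) * m - m)"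
      by (simp add: algebra_simps)
    also have "\<dots> = norm p + C1 * \<beta> / (C1 + K3) * (1 - m)" unfolding em by simp
    finally show "I_fun A2 B2 u0 x t * exp (- (C1 + K3) * t)
        - C1 * \<beta> / (C1 + K3) * (1 - exp (- (C1 + K3) * t)) \<le> norm p"
      unfolding m_def[symmetric] by simp
  next
    fix x t p assume "(C1, K3) = (0, 0)" and t: "t \<in> {0<..<T}" "p \<in> subdiff_x u T x t"
    then have c: "C1 = 0" "K3 = 0" by auto
    show "I_fun A2 B2 u0 x t \<le> norm p" "norm p \<le> S_fun A2 B2 u0 x t"
      using gradient_bounds[OF t L] unfolding c by simp_all
  qed
qed

end
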